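(* There is a classical algorithm which, given independent generators $g_2,\dots,g_L$ of the stabilizer group $\mathcal G$ of a stabilizer code on $L$ qubits encoding one logical qubit, logical operators $\bar Z,\bar Y$ of this code, and a subset $A\subseteq\{1,\dots,L\}$ with complement $B$, computes exactly, in $\mathcal O(L^3)$ time, the robustness of magic $\mathcal R(\rho_A)$, the Pauli spectrum $\Xi(\rho_A)$ (as the list of its distinct nonzero values together with their multiplicities), and hence the stabilizer 2-Rényi entropy $\tilde{\mathcal M}_2(\rho_A)$, of the reduced state $\rho_A=\mathrm{Tr}_B\,\rho$ of the pure $L$-qubit state $$\rho=\frac{1}{2^{L}}\Big(\mathbb 1+\frac{\bar Z-\bar Y}{\sqrt 2}\Big)\prod_{j=2}^{L}(\mathbb 1+g_j).$$
   Context: Hermitian Pauli operators on $L$ qubits are $\pm$ tensor products of single-qubit operators from $\{\mathbb 1,X,Y,Z\}$, specified by a sign and a binary vector of length $2L$; time is counted in elementary bit operations. Stabilizer code encoding one logical qubit: an abelian group $\mathcal G$ of Hermitian Pauli operators on $L$ qubits with $-\mathbb 1\notin\mathcal G$, generated by $L-1$ independent elements $g_2,\dots,g_L$. Logical operators are Hermitian Pauli operators that commute with every element of $\mathcal G$ and do not lie in $\pm\mathcal G$; $\bar Z$ and $\bar Y$ are anticommuting logical operators. For a (possibly mixed) state $\rho$ on $n$ qubits, with $P$ ranging over the $4^n$ Pauli strings with phase $+1$: the Pauli spectrum is the multiset $\Xi(\rho)=\{\mathrm{Tr}[\rho P]^2/2^n\}_P$, and the stabilizer 2-Rényi entropy is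 $\tilde{\mathcal M}_2(\rho)=-\log_2\dfrac{\sum_P \mathrm{Tr}[P\rho]^4}{\sum_P\mathrm{Tr}[P\rho]^2}$. The robustness of magic is $\mathcal R(\rho)=\min\{\sum_i|x_i| : \rho=\sum_i x_i\sigma_i,\ x_i\in\mathbb R,\ \sum_i x_i=1\}$, where $\sigma_i$ ranges over (the density matrices of) all pure $n$-qubit stabilizer states. *)

theory Defs
  imports
    "Jordan_Normal_Form.Matrix"
    "HOL-Algebra.Generated_Groups"
    "HOL-Library.Landau_Symbols"
    "HOL-Library.Multiset"
begin

section \<open>Pauli operators\<close>

text \<open>
  Qubits are labelled from 0, and bit \<open>k\<close> of a basis index \<open>i < 2 ^ n\<close> is the state of qubit \<open>k\<close>.
  A Hermitian Pauli operator on \<open>n\<close> qubits is specified by a sign (\<open>True\<close> for minus) and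
  a binary vector of length \<open>2 * n\<close>, the \<open>x\<close>-part followed by the \<open>z\<close>-part.
\<close>

type_synonym pauli = "bool \<times> bool list"

definition pauli_matrix :: "bool \<Rightarrow> bool \<Rightarrow> complex mat" where
  "pauli_matrix x z =
    (if x then
       if z then mat_of_rows_list 2 [[0, - \<i>], [\<i>, 0]] else mat_of_rows_list 2 [[0, 1], [1, 0]]
     else
       if z then mat_of_rows_list 2 [[1, 0], [0, -1]] else 1\<^sub>m 2)"

definition pauli_string :: "nat \<Rightarrow> bool list \<Rightarrow> complex mat" where
  "pauli_string n v = mat (2 ^ n) (2 ^ n) (\<lambda>(i, j).
     \<Prod>k<n. pauli_matrix (v ! k) (v ! (n + k)) $$ (of_bool (bit i k), of_bool (bit j k)))"

definition valid_pauli :: "nat \<Rightarrow> pauli \<Rightarrow> bool" where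
  "valid_pauli n p \<longleftrightarrow> length (snd p) = 2 * n"

definition pauli_op :: "nat \<Rightarrow> pauli \<Rightarrow> complex mat" where
  "pauli_op n p = (if fst p then -1 else 1) \<cdot>\<^sub>m pauli_string n (snd p)"

definition hermitian_paulis :: "nat \<Rightarrow> complex mat set" where
  "hermitian_paulis n = pauli_op n ` {p. valid_pauli n p}"


section \<open>Stabilizer codes and stabilizer states\<close>

definition qubit_GL :: "nat \<Rightarrow> complex mat monoid" where
  "qubit_GL n = units_of (ring_mat TYPE(complex) (2 ^ n) ())"

definition stab_group :: "nat \<Rightarrow> pauli list \<Rightarrow> complex mat set" where
  "stab_group n gs = generate (qubit_GL n) (pauli_op n ` set gs)"

definition independent_paulis :: "nat \<Rightarrow> pauli list \<Rightarrow> bool" where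
  "independent_paulis n gs \<longleftrightarrow>
    (\<forall>j<length gs. pauli_op n (gs ! j) \<notin>
       generate (qubit_GL n) {pauli_op n (gs ! i) | i. i < length gs \<and> i \<noteq> j})"

definition stabilizer_generators :: "nat \<Rightarrow> pauli list \<Rightarrow> bool" where
  "stabilizer_generators n gs \<longleftrightarrow>
     (\<forall>g\<in>set gs. valid_pauli n g) \<and>
     independent_paulis n gs \<and>
     stab_group n gs \<subseteq> hermitian_paulis n \<and>
     (\<forall>g\<in>stab_group n gs. \<forall>h\<in>stab_group n gs. g * h = h * g) \<and>
     - 1\<^sub>m (2 ^ n) \<notin> stab_group n gs"

definition logical_operator :: "nat \<Rightarrow> pauli list \<Rightarrow> pauli \<Rightarrow> bool" where
  "logical_operator n gs p \<longleftrightarrow>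
     valid_pauli n p \<and>
     (\<forall>g\<in>stab_group n gs. pauli_op n p * g = g * pauli_op n p) \<and>
     pauli_op n p \<notin> stab_group n gs \<and> - pauli_op n p \<notin> stab_group n gs"

definition pure_stabilizer_states :: "nat \<Rightarrow> complex mat set" where
  "pure_stabilizer_states n =
    {mat (2 ^ n) (2 ^ n) (\<lambda>(i, j). \<psi> $ i * cnj (\<psi> $ j)) | \<psi> gs.
       \<psi> \<in> carrier_vec (2 ^ n) \<and> (\<Sum>i<2 ^ n. (cmod (\<psi> $ i))\<^sup>2) = 1 \<and>
       stabilizer_generators n gs \<and> length gs = n \<and>
       (\<forall>g\<in>stab_group n gs. g *\<^sub>v \<psi> = \<psi>)}"


section \<open>Magic of a state\<close>

definition mat_trace :: "complex mat \<Rightarrow> complex" where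
  "mat_trace M = (\<Sum>i<dim_row M. M $$ (i, i))"

text \<open>
  Traces of products of two Hermitian matrices are real, so \<open>Re\<close> only changes the type here.
\<close>

definition pauli_expectation :: "nat \<Rightarrow> complex mat \<Rightarrow> bool list \<Rightarrow> real" where
  "pauli_expectation n \<rho> v = Re (mat_trace (\<rho> * pauli_string n v))"

definition pauli_spectrum :: "nat \<Rightarrow> complex mat \<Rightarrow> real multiset" where
  "pauli_spectrum n \<rho> =
     image_mset (\<lambda>v. (pauli_expectation n \<rho> v)\<^sup>2 / 2 ^ n) (mset_set {v. length v = 2 * n})"

definition stabilizer_entropy :: "nat \<Rightarrow> complex mat \<Rightarrow> real" where
  "stabilizer_entropy n \<rho> =
     - log 2 ((\<Sum>v | length v = 2 * n. pauli_expectation n \<rho> v ^ 4) /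
              (\<Sum>v | length v = 2 * n. pauli_expectation n \<rho> v ^ 2))"

text \<open>
  A coefficient family \<open>x\<close> is given on a finite set \<open>S\<close> of stabilizer states and is
  zero on the others.
\<close>

definition robustness :: "nat \<Rightarrow> complex mat \<Rightarrow> real" where
  "robustness n \<rho> = (LEAST r. \<exists>S (x :: complex mat \<Rightarrow> real).
     finite S \<and> S \<subseteq> pure_stabilizer_states n \<and>
     \<rho> = mat (2 ^ n) (2 ^ n) (\<lambda>(i, j). \<Sum>\<sigma>\<in>S. of_real (x \<sigma>) * \<sigma> $$ (i, j)) \<and>
     (\<Sum>\<sigma>\<in>S. x \<sigma>) = 1 \<and>
     r = (\<Sum>\<sigma>\<in>S. \<bar>x \<sigma>\<bar>))"


section \<open>Magic code states and reduced states\<close>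

definition code_magic_state :: "nat \<Rightarrow> pauli list \<Rightarrow> pauli \<Rightarrow> pauli \<Rightarrow> complex mat" where
  "code_magic_state L gs zb yb =
     (1 / 2 ^ L) \<cdot>\<^sub>m
       ((1\<^sub>m (2 ^ L) + complex_of_real (1 / sqrt 2) \<cdot>\<^sub>m (pauli_op L zb - pauli_op L yb)) *
        foldr (\<lambda>g M. (1\<^sub>m (2 ^ L) + pauli_op L g) * M) gs (1\<^sub>m (2 ^ L)))"

definition index_bits :: "nat \<Rightarrow> nat \<Rightarrow> bool list" where
  "index_bits n i = map (bit i) [0..<n]"

text \<open>
  The partial trace over the qubits outside \<open>A\<close>; the qubits in \<open>A\<close> keep their order.
\<close>

definition reduced_state :: "nat \<Rightarrow> nat set \<Rightarrow> complex mat \<Rightarrow> complex mat" where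
  "reduced_state L A \<rho> = mat (2 ^ card A) (2 ^ card A) (\<lambda>(a, a').
     \<Sum>(i, j) | i < 2 ^ L \<and> j < 2 ^ L \<and>
        nths (index_bits L i) A = index_bits (card A) a \<and>
        nths (index_bits L j) A = index_bits (card A) a' \<and>
        nths (index_bits L i) (- A) = nths (index_bits L j) (- A).
       \<rho> $$ (i, j))"


section \<open>Algorithms counting elementary bit operations\<close>

text \<open>
  Multitape Turing machines with cells holding a bit or a blank (\<open>None\<close>), presented as
  structured programs: a program mentions finitely many tapes, and moving a head by one cell,
  writing one cell and testing one cell each cost one unit. There are no arithmetic operations
  and no random access.
\<close>

type_synonym symbol = "bool option"

datatype program =
    Skip
  | Move_Left nat
  | Move_Right nat
  | Write nat symbol
  | Seq program program
  | If_Scanned nat "symbol set" program program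
  | While_Scanned nat "symbol set" program

type_synonym config = "(nat \<Rightarrow> int) \<times> (nat \<Rightarrow> int \<Rightarrow> symbol)"

definition scanned :: "config \<Rightarrow> nat \<Rightarrow> symbol" where
  "scanned c k = snd c k (fst c k)"

text \<open>\<open>exec p c t c'\<close>: started in \<open>c\<close>, the program \<open>p\<close> halts in \<open>c'\<close> after \<open>t\<close> steps.\<close>

inductive exec :: "program \<Rightarrow> config \<Rightarrow> nat \<Rightarrow> config \<Rightarrow> bool" where
  Skip: "exec Skip c 1 c"
| Move_Left: "exec (Move_Left k) (h, m) 1 (h(k := h k - 1), m)"
| Move_Right: "exec (Move_Right k) (h, m) 1 (h(k := h k + 1), m)"
| Write: "exec (Write k s) (h, m) 1 (h, m(k := (m k)(h k := s)))"
| Seq: "exec p c t c' \<Longrightarrow> exec q c' u c'' \<Longrightarrow> exec (Seq p q) c (t + u) c''"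
| If_True: "scanned c k \<in> S \<Longrightarrow> exec p c t c' \<Longrightarrow> exec (If_Scanned k S p q) c (1 + t) c'"
| If_False: "scanned c k \<notin> S \<Longrightarrow> exec q c t c' \<Longrightarrow> exec (If_Scanned k S p q) c (1 + t) c'"
| While_False: "scanned c k \<notin> S \<Longrightarrow> exec (While_Scanned k S p) c 1 c"
| While_True: "scanned c k \<in> S \<Longrightarrow> exec p c t c' \<Longrightarrow> exec (While_Scanned k S p) c' u c'' \<Longrightarrow>
    exec (While_Scanned k S p) c (1 + t + u) c''"

definition tape_of :: "bool list \<Rightarrow> int \<Rightarrow> symbol" where
  "tape_of w i = (if 0 \<le> i \<and> i < int (length w) then Some (w ! nat i) else None)"

text \<open>The input is read from tape 0, the output is left on tape 1.\<close>

definition computes_in :: "program \<Rightarrow> bool list \<Rightarrow> bool list \<Rightarrow> nat \<Rightarrow> bool" where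
  "computes_in p inp out t \<longleftrightarrow>
     (\<exists>h m. exec p (\<lambda>k. 0, \<lambda>k. if k = 0 then tape_of inp else tape_of []) t (h, m) \<and>
            m 1 = tape_of out)"


section \<open>Input and output formats\<close>

definition encode_pauli :: "pauli \<Rightarrow> bool list" where
  "encode_pauli p = fst p # snd p"

definition encode_input ::
    "nat \<Rightarrow> pauli list \<Rightarrow> pauli \<Rightarrow> pauli \<Rightarrow> nat set \<Rightarrow> bool list" where
  "encode_input L gs zb yb A =
     replicate L True @ [False] @ map (\<lambda>k. k \<in> A) [0..<L] @
     concat (map encode_pauli gs) @ encode_pauli zb @ encode_pauli yb"

text \<open>Binary digits, least significant digit first.\<close>

fun digits :: "nat \<Rightarrow> bool list" where
  "digits n = (if n = 0 then [] else odd n # digits (n div 2))"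

declare digits.simps [simp del]

text \<open>
  Every item of a sequence is preceded by \<open>True\<close> and the sequence is closed by \<open>False\<close>,
  so that the concatenated output can be parsed. Rationals are written in lowest terms.
\<close>

definition encode_list :: "('a \<Rightarrow> bool list) \<Rightarrow> 'a list \<Rightarrow> bool list" where
  "encode_list enc xs = concat (map (\<lambda>x. True # enc x) xs) @ [False]"

definition encode_nat :: "nat \<Rightarrow> bool list" where
  "encode_nat n = encode_list (\<lambda>d. [d]) (digits n)"

definition encode_rat :: "rat \<Rightarrow> bool list" where
  "encode_rat q = (case quotient_of q of (a, b) \<Rightarrow>
     (a < 0) # encode_nat (nat \<bar>a\<bar>) @ encode_nat (nat b))"

definition encode_output ::
    "rat \<Rightarrow> rat \<Rightarrow> (rat \<times> nat) list \<Rightarrow> rat \<Rightarrow> bool list" where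
  "encode_output a b spec q =
     encode_rat a @ encode_rat b @
     encode_list (\<lambda>(v, m). encode_rat v @ encode_nat m) spec @
     encode_rat q"

text \<open>
  Exact values: the robustness as an element \<open>a + b * sqrt 2\<close> of the quadratic field
  generated by \<open>sqrt 2\<close>, the spectrum as the list of its distinct nonzero values (rationals)
  with their multiplicities, and the entropy as \<open>- log 2 q\<close> with \<open>q\<close> rational.
\<close>

definition represents_robustness :: "rat \<Rightarrow> rat \<Rightarrow> real \<Rightarrow> bool" where
  "represents_robustness a b r \<longleftrightarrow> r = of_rat a + of_rat b * sqrt 2"

definition represents_spectrum :: "(rat \<times> nat) list \<Rightarrow> real multiset \<Rightarrow> bool" where
  "represents_spectrum spec M \<longleftrightarrow>
     distinct (map fst spec) \<and>
     (\<lambda>(v, m). of_rat v) ` set spec = set_mset M - {0} \<and>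
     (\<forall>(v, m)\<in>set spec. m = count M (of_rat v))"

definition represents_entropy :: "rat \<Rightarrow> real \<Rightarrow> bool" where
  "represents_entropy q s \<longleftrightarrow> 0 < q \<and> s = - log 2 (of_rat q)"

end

(* Expanding the product over the generators writes the code state as a sum of signed Pauli
   operators over the stabilizer group G and the cosets ZG and YG. The partial trace keeps exactly the
   operators supported on A. Those coming from G form a stabilizer group S on A, of order 2^k, and each
   of ZG and YG contributes either nothing or a full coset of S; let c be the number of surviving
   cosets. The reduced state therefore has 2^k squared expectation values 1, c * 2^k squared values 1/2,
   and zeros, which gives the spectrum and the entropy.

   For c <= 1 the state is a mixture of two stabilizer-group states, so its robustness is 1. For c = 2
   the two logical operators N1, N2 on A anticommute; a stabilizer state has a nonzero expectation for
   at most one of them, so N1 - N2 is a witness for robustness >= sqrt 2, and an explicit combination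
   of the four eigenstate mixtures of N1 and N2 attains sqrt 2. Every stabilizer group has at most 2^n
   elements and extends to one of order 2^n (by counting characters of the commutator form), whose
   projector has rank one; averaging over the signs of the added generators makes every
   stabilizer-group state a mixture of pure stabilizer states.

   The numbers k and c come from Gaussian elimination over the two-element field on the rows restricted
   to the complement of A: a generator row is removed when it becomes a pivot, and a row of a logical
   operator is dropped when it turns out not to lie in the row space. What matters is the number of
   ways to write a vector as a sum of rows, which elimination preserves. On a Turing machine each
   tape serves as a stack, the current column is always the first bit of every row, and one column
   costs one pass over the matrix. *)

theory Submission
  imports Defs
begin

section \<open>A calculus of timed total correctness for machines whose tapes are stacks\<close>

section \<open>Stack programs\<close>

text \<open>The algorithm never computes with numbers. Every number in the output other than a few
  constants is a power of two, so its binary digits can be copied from a unary counter. It never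
  looks at signs either: \<open>k\<close> and \<open>c\<close> depend only on the binary vectors,
  and spectrum, entropy and robustness depend only on \<open>k\<close>, \<open>c\<close> and the
  size of \<open>A\<close>. A single exponent \<open>k\<close> suffices for both logical operators
  because a nonempty reduced coset always has as many elements as the reduced group. The cubic bound
  arises as \<open>2 * L\<close> passes over a matrix with \<open>L + 1\<close> rows of at most
  \<open>2 * L\<close> bits, besides the tags. Robustness is defined as a least element of a set of
  reals, so its existence is part of the claim: the decomposition of norm \<open>sqrt 2\<close> has
  to meet the lower bound from the witness exactly. The commutation relation of the logical
  operators survives the restriction to \<open>A\<close> because an operator supported on
  \<open>A\<close> has trivial commutation factors on all other qubits.\<close>

text \<open>
  Every tape is used as a stack that grows to the right, with the head on its top cell
  (on cell \<open>-1\<close> if it is empty); popping erases the cell.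
\<close>

definition stack_config :: "bool list list \<Rightarrow> config" where
  "stack_config s = (\<lambda>k. if k < length s then int (length (s ! k)) - 1 else 0,
                     \<lambda>k. if k < length s then tape_of (rev (s ! k)) else tape_of [])"

definition push :: "nat \<Rightarrow> bool \<Rightarrow> program" where
  "push k b = Seq (Move_Right k) (Write k (Some b))"

definition pop :: "nat \<Rightarrow> program" where
  "pop k = Seq (Write k None) (Move_Left k)"

text \<open>A weakest precondition for total correctness that also hands the exact running time to
  the postcondition. The number of stacks is kept fixed because \<open>stack_config\<close> is shown
  to be injective on lists of equal length.\<close>

definition runs_to :: "program \<Rightarrow> (nat \<Rightarrow> bool list list \<Rightarrow> bool) \<Rightarrow> bool list list \<Rightarrow> bool" where
  "runs_to p Q s \<longleftrightarrow>
     (\<exists>t s'. exec p (stack_config s) t (stack_config s') \<and> length s' = length s \<and> Q t s')"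

fun top_of :: "bool list \<Rightarrow> symbol" where
  "top_of [] = None"
| "top_of (b # bs) = Some b"

inductive_cases exec_SkipE: "exec Skip c t c'"
inductive_cases exec_LeftE: "exec (Move_Left k) c t c'"
inductive_cases exec_RightE: "exec (Move_Right k) c t c'"
inductive_cases exec_WriteE: "exec (Write k a) c t c'"
inductive_cases exec_SeqE: "exec (Seq p q) c t c'"
inductive_cases exec_IfE: "exec (If_Scanned k S p q) c t c'"
inductive_cases exec_WhileE: "exec (While_Scanned k S p) c t c'"

text \<open>Needed to read the existential in \<open>runs_to\<close> backwards: once one run is
  known, it is the only run.\<close>

lemma exec_deterministic: "exec p c t c' \<Longrightarrow> exec p c u c'' \<Longrightarrow> t = u \<and> c' = c''"
proof (induction arbitrary: u c'' rule: exec.induct)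
  case (Seq p c t c' q u' d)
  from Seq.prems show ?case
  proof (rule exec_SeqE)
    fix t1 d1 u1 assume "u = t1 + u1" "exec p c t1 d1" "exec q d1 u1 c''"
    with Seq.IH(1)[of t1 d1] Seq.IH(2)[of u1 c''] show ?thesis by simp
  qed
next
  case (If_True c k S p t c' q)
  from If_True.prems If_True.hyps(1) obtain t1 where "u = 1 + t1" "exec p c t1 c''"
    by (elim exec_IfE) simp_all
  with If_True.IH[of t1 c''] show ?case by simp
next
  case (If_False c k S q t c' p)
  from If_False.prems If_False.hyps(1) obtain t1 where "u = 1 + t1" "exec q c t1 c''"
    by (elim exec_IfE) simp_all
  with If_False.IH[of t1 c''] show ?case by simp
next
  case (While_False c k S p)
  show ?case by (rule exec_WhileE[OF While_False.prems]) (use While_False.hyps in simp_all)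
next
  case (While_True c k S p t c' u' d)
  obtain t1 d1 u1 where
    "u = 1 + t1 + u1" "exec p c t1 d1" "exec (While_Scanned k S p) d1 u1 c''"
    by (rule exec_WhileE[OF While_True.prems]) (use While_True.hyps(1) in simp_all)
  with While_True.IH(1)[of t1 d1] While_True.IH(2)[of u1 c''] show ?case by simp
qed (auto elim: exec_SkipE exec_LeftE exec_RightE exec_WriteE)

lemma tape_of_inject: "tape_of v = tape_of w \<longleftrightarrow> v = w"
proof
  assume eq: "tape_of v = tape_of w"
  have "i < length v \<longleftrightarrow> i < length w" for i
    using fun_cong[OF eq, of "int i"] by (simp add: tape_of_def split: if_splits)
  then have len: "length v = length w"
    by (metis linorder_neqE_nat order_less_irrefl)
  show "v = w"
  proof (rule nth_equalityI[OF len])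
    fix i assume "i < length v"
    then show "v ! i = w ! i"
      using fun_cong[OF eq, of "int i"] len by (auto simp: tape_of_def)
  qed
qed simp

lemma stack_config_inject:
  assumes "stack_config s = stack_config s'" "length s = length s'"
  shows "s = s'"
proof (rule nth_equalityI[OF assms(2)])
  fix k assume k: "k < length s"
  have "snd (stack_config s) k = snd (stack_config s') k" using assms by simp
  then show "s ! k = s' ! k" using k assms(2) by (simp add: tape_of_inject stack_config_def)
qed

text \<open>Determinism and injectivity of \<open>stack_config\<close> turn a known run into an
  equivalence, so that each basic program gets a rewrite rule for \<open>simp\<close>.\<close>

lemma runs_to_det:
  assumes "exec p (stack_config s) t (stack_config s')" "length s' = length s"
  shows "runs_to p Q s \<longleftrightarrow> Q t s'"
proof
  assume "runs_to p Q s"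
  then obtain u r where "exec p (stack_config s) u (stack_config r)" "length r = length s" "Q u r"
    unfolding runs_to_def by blast
  with exec_deterministic[OF assms(1)] stack_config_inject[of s' r] assms(2) show "Q t s'"
    by metis
qed (use assms runs_to_def in blast)

lemma exec_Move_Right':
  "c' = ((fst c)(k := fst c k + 1), snd c) \<Longrightarrow> exec (Move_Right k) c 1 c'"
  by (cases c) (simp add: exec.Move_Right del: One_nat_def)

lemma exec_Move_Left':
  "c' = ((fst c)(k := fst c k - 1), snd c) \<Longrightarrow> exec (Move_Left k) c 1 c'"
  by (cases c) (simp add: exec.Move_Left del: One_nat_def)

lemma exec_Write':
  "c' = (fst c, (snd c)(k := (snd c k)(fst c k := a))) \<Longrightarrow> exec (Write k a) c 1 c'"
  by (cases c) (simp add: exec.Write del: One_nat_def)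

lemma tape_of_snoc: "tape_of (w @ [b]) = (tape_of w)(int (length w) := Some b)"
  by (auto simp: tape_of_def fun_eq_iff nth_append)

lemma exec_push:
  assumes "k < length s"
  shows "exec (push k b) (stack_config s) 2 (stack_config (s[k := b # s ! k]))"
proof -
  let ?c = "stack_config s"
  let ?d = "((fst ?c)(k := fst ?c k + 1), snd ?c)"
  have 1: "exec (Move_Right k) ?c 1 ?d" by (rule exec_Move_Right') simp
  have 2: "exec (Write k (Some b)) ?d 1 (stack_config (s[k := b # s ! k]))"
    by (rule exec_Write') (use assms in \<open>auto simp: stack_config_def fun_eq_iff tape_of_snoc nth_list_update\<close>)
  from exec.Seq[OF 1 2] show ?thesis unfolding push_def by (simp add: numeral_2_eq_2)
qed

lemma exec_pop:
  assumes "k < length s" "s ! k = b # bs"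
  shows "exec (pop k) (stack_config s) 2 (stack_config (s[k := bs]))"
proof -
  let ?c = "stack_config s"
  let ?d = "(fst ?c, (snd ?c)(k := (snd ?c k)(fst ?c k := None)))"
  have 1: "exec (Write k None) ?c 1 ?d" by (rule exec_Write') simp
  have b: "tape_of (rev bs) (int (length bs)) = None" by (simp add: tape_of_def)
  have 2: "exec (Move_Left k) ?d 1 (stack_config (s[k := bs]))"
    by (rule exec_Move_Left')
      (use assms b in \<open>auto simp: stack_config_def fun_eq_iff tape_of_snoc nth_list_update\<close>)
  from exec.Seq[OF 1 2] show ?thesis unfolding pop_def by (simp add: numeral_2_eq_2)
qed

lemma scanned_stack: "k < length s \<Longrightarrow> scanned (stack_config s) k = top_of (s ! k)"
  by (cases "s ! k") (auto simp: stack_config_def scanned_def tape_of_snoc tape_of_def)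

text \<open>
  This congruence rule keeps the simplifier out of programs and postconditions, so that \<open>simp\<close>
  executes a program from left to right.
\<close>

lemma runs_to_cong [cong]: "s = s' \<Longrightarrow> runs_to p Q s = runs_to p Q s'"
  by simp

lemma runs_to_push [simp]:
  "k < length s \<Longrightarrow> runs_to (push k b) Q s \<longleftrightarrow> Q 2 (s[k := b # s ! k])"
  by (rule runs_to_det[OF exec_push]) simp_all

lemma runs_to_pop [simp]:
  "k < length s \<Longrightarrow> s ! k \<noteq> [] \<Longrightarrow> runs_to (pop k) Q s \<longleftrightarrow> Q 2 (s[k := tl (s ! k)])"
  by (rule runs_to_det[OF exec_pop[where b = "hd (s ! k)"]]) simp_all

lemma runs_to_Skip [simp]: "runs_to Skip Q s \<longleftrightarrow> Q 1 s"
  by (rule runs_to_det[OF exec.Skip]) simp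

text \<open>Only an implication: a sequence may pass through a configuration that is not of stack
  form, as \<open>push\<close> does between the move and the write. As a conditional rule it still
  lets \<open>simp\<close> execute programs.\<close>

lemma runs_to_Seq [simp]:
  assumes "runs_to p (\<lambda>t s'. runs_to q (\<lambda>u. Q (t + u)) s') s"
  shows "runs_to (Seq p q) Q s"
proof -
  from assms obtain t s' u s'' where "exec p (stack_config s) t (stack_config s')"
    "length s' = length s" "exec q (stack_config s') u (stack_config s'')"
    "length s'' = length s'" "Q (t + u) s''"
    unfolding runs_to_def by blast
  then have "exec (Seq p q) (stack_config s) (t + u) (stack_config s'')"
    "length s'' = length s" "Q (t + u) s''"
    by (auto intro: exec.Seq)
  then show ?thesis unfolding runs_to_def by blast
qed

lemma runs_to_If [simp]:
  assumes "k < length s"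
  shows "runs_to (If_Scanned k S p q) Q s \<longleftrightarrow>
    (if top_of (s ! k) \<in> S then runs_to p (\<lambda>t. Q (1 + t)) s else runs_to q (\<lambda>t. Q (1 + t)) s)"
proof -
  have "exec (If_Scanned k S p q) (stack_config s) t c \<longleftrightarrow>
    (\<exists>u. t = 1 + u \<and> exec (if top_of (s ! k) \<in> S then p else q) (stack_config s) u c)" for t c
    unfolding scanned_stack[OF assms, symmetric]
    by (auto intro: exec.If_True[unfolded plus_1_eq_Suc] exec.If_False[unfolded plus_1_eq_Suc]
        elim: exec_IfE)
  then show ?thesis unfolding runs_to_def by auto
qed

lemma runs_to_While_done:
  assumes "k < length s" "top_of (s ! k) \<notin> S"
  shows "runs_to (While_Scanned k S p) Q s \<longleftrightarrow> Q 1 s"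
  by (rule runs_to_det[OF exec.While_False]) (use assms scanned_stack in auto)

lemma runs_to_While_step:
  assumes "k < length s" "top_of (s ! k) \<in> S"
    and "runs_to p (\<lambda>t s'. runs_to (While_Scanned k S p) (\<lambda>u. Q (1 + t + u)) s') s"
  shows "runs_to (While_Scanned k S p) Q s"
proof -
  from assms(3) obtain t s' u s'' where "exec p (stack_config s) t (stack_config s')"
    "length s' = length s" "exec (While_Scanned k S p) (stack_config s') u (stack_config s'')"
    "length s'' = length s'" "Q (1 + t + u) s''"
    unfolding runs_to_def by blast
  then have "exec (While_Scanned k S p) (stack_config s) (1 + t + u) (stack_config s'')"
    "length s'' = length s" "Q (1 + t + u) s''"
    using assms(1,2) exec.While_True[of "stack_config s" k S p t "stack_config s'" u "stack_config s''"]
    by (simp_all add: scanned_stack)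
  then show ?thesis unfolding runs_to_def by blast
qed

lemma runs_to_mono:
  "runs_to p Q s \<Longrightarrow> (\<And>t s'. length s' = length s \<Longrightarrow> Q t s' \<Longrightarrow> R t s') \<Longrightarrow> runs_to p R s"
  unfolding runs_to_def by blast

text \<open>The result is exact but the time is only bounded, so branches of different cost share
  one statement and loop bounds add up.\<close>

definition takes :: "program \<Rightarrow> bool list list \<Rightarrow> nat \<Rightarrow> bool list list \<Rightarrow> bool" where
  "takes p s T r \<longleftrightarrow> runs_to p (\<lambda>t s'. t \<le> T \<and> s' = r) s"

lemma runs_to_takes:
  assumes "takes p s T r" "\<And>t. t \<le> T \<Longrightarrow> Q t r"
  shows "runs_to p Q s"
  by (rule runs_to_mono[OF assms(1)[unfolded takes_def]]) (use assms(2) in auto)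

lemma takes_Seq:
  assumes "takes p s T r" "takes q r U r'" "T + U \<le> V"
  shows "takes (Seq p q) s V r'"
  unfolding takes_def
proof (rule runs_to_Seq, rule runs_to_takes[OF assms(1)], rule runs_to_takes[OF assms(2)])
qed (use assms(3) in auto)

lemma takes_While_step:
  assumes "k < length s" "top_of (s ! k) \<in> S" "takes p s T r"
    and "takes (While_Scanned k S p) r U r'" "1 + T + U \<le> V"
  shows "takes (While_Scanned k S p) s V r'"
  unfolding takes_def
proof (rule runs_to_While_step[OF assms(1,2)], rule runs_to_takes[OF assms(3)],
    rule runs_to_takes[OF assms(4)])
qed (use assms(5) in auto)

text \<open>The states enter through equations, so that rules for concrete programs apply when their
  stack lists agree only after simplification.\<close>

lemma takes_Seq_eq:
  "takes p s T r \<Longrightarrow> r = r0 \<Longrightarrow> takes q r0 U r' \<Longrightarrow> T + U \<le> V \<Longrightarrow> r' = r'' \<Longrightarrow>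
    takes (Seq p q) s V r''"
  using takes_Seq by blast

lemma takes_While_eq:
  "takes p s T r \<Longrightarrow> takes (While_Scanned k S p) r U r' \<Longrightarrow> k < length s \<Longrightarrow>
    top_of (s ! k) \<in> S \<Longrightarrow> 1 + T + U \<le> V \<Longrightarrow> r' = r'' \<Longrightarrow> takes (While_Scanned k S p) s V r''"
  using takes_While_step by blast

lemma takes_While_done:
  "k < length s \<Longrightarrow> top_of (s ! k) \<notin> S \<Longrightarrow> 1 \<le> V \<Longrightarrow> takes (While_Scanned k S p) s V s"
  by (simp add: takes_def runs_to_While_done)

lemma takes_mono: "takes p s T r \<Longrightarrow> T \<le> V \<Longrightarrow> r = r' \<Longrightarrow> takes p s V r'"
  unfolding takes_def[of p s V] by (erule runs_to_takes) simp

abbreviation bits :: "symbol set" where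
  "bits \<equiv> {Some True, Some False}"

lemma top_of_bits: "top_of xs \<in> bits \<longleftrightarrow> xs \<noteq> []"
  by (cases xs) auto

definition dup :: "nat \<Rightarrow> nat \<Rightarrow> program" where
  "dup i j = If_Scanned i {Some True} (push j True) (push j False)"

definition shift :: "nat \<Rightarrow> nat \<Rightarrow> program" where
  "shift i j = Seq (dup i j) (pop i)"

lemma runs_to_dup [simp]:
  "i < length s \<Longrightarrow> j < length s \<Longrightarrow> s ! i \<noteq> [] \<Longrightarrow>
    runs_to (dup i j) Q s \<longleftrightarrow> Q 3 (s[j := hd (s ! i) # s ! j])"
  unfolding dup_def by (cases "s ! i") (auto simp: numeral_3_eq_3)

definition move :: "nat \<Rightarrow> nat \<Rightarrow> program" where
  "move i j = While_Scanned i bits (Seq (dup i j) (pop i))"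

lemma list_update_numeral [simp]:
  "(x # xs)[numeral n := y] = x # xs[pred_numeral n := y]"
  by (simp add: numeral_eq_Suc)

text \<open>Moving reverses the contents. One bit costs 6 steps: 1 for the test, 3 for
  \<open>dup\<close> and 2 for \<open>pop\<close>; the final 1 is the test that ends the
  loop.\<close>

lemma takes_move:
  assumes "i < length s" "j < length s" "i \<noteq> j"
  shows "takes (move i j) s (6 * length (s ! i) + 1) (s[i := [], j := rev (s ! i) @ s ! j])"
  using assms
proof (induction "s ! i" arbitrary: s)
  case Nil
  then have "s[i := [], j := rev (s ! i) @ s ! j] = s" by (metis append_Nil list_update_id rev.simps(1))
  with Nil show ?case unfolding move_def by (auto intro!: takes_While_done)
next
  case (Cons b bs)
  let ?r = "s[i := bs, j := b # s ! j]"
  have "runs_to (Seq (dup i j) (pop i)) (\<lambda>t s'. t \<le> 5 \<and> s' = ?r) s"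
    unfolding dup_def by (rule runs_to_Seq) (use Cons.prems Cons.hyps(2)[symmetric] in
      \<open>cases b; simp add: list_update_swap[of i j]\<close>)
  then have step: "takes (Seq (dup i j) (pop i)) s 5 ?r" unfolding takes_def .
  have "takes (move i j) ?r (6 * length (?r ! i) + 1) (?r[i := [], j := rev (?r ! i) @ ?r ! j])"
    by (rule Cons.hyps) (use Cons.prems in auto)
  then have rec: "takes (move i j) ?r (6 * length bs + 1) (s[i := [], j := rev (s ! i) @ s ! j])"
    using Cons.prems Cons.hyps(2)[symmetric]
    by (simp add: list_update_swap[of i j])
  show ?case
    using takes_While_step[OF _ _ step rec[unfolded move_def]] Cons.prems Cons.hyps(2)[symmetric]
    by (cases b) (auto simp: move_def)
qed

section \<open>Linear algebra over the two-element field: subset sums of rows and their behaviour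
  under elimination\<close>

section \<open>Counting linear combinations over the two-element field\<close>

definition vxor :: "bool list \<Rightarrow> bool list \<Rightarrow> bool list" where
  "vxor u v = map2 (\<noteq>) u v"

abbreviation zeros :: "nat \<Rightarrow> bool list" where
  "zeros n \<equiv> replicate n False"

lemma length_vxor [simp]: "length (vxor u v) = min (length u) (length v)"
  by (simp add: vxor_def)

lemma nth_vxor [simp]: "i < length u \<Longrightarrow> i < length v \<Longrightarrow> vxor u v ! i \<longleftrightarrow> u ! i \<noteq> v ! i"
  by (simp add: vxor_def)

lemma vxor_Cons [simp]: "vxor (a # u) (b # v) = (a \<noteq> b) # vxor u v"
  by (simp add: vxor_def)

lemma vxor_Nil [simp]: "vxor [] v = []" "vxor u [] = []"
  by (simp_all add: vxor_def)

lemma vxor_commute: "vxor u v = vxor v u"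
  by (induction u arbitrary: v) (auto simp: vxor_def zip_Cons1 split: list.splits)

lemma vxor_assoc: "vxor (vxor u v) w = vxor u (vxor v w)"
proof (induction u arbitrary: v w)
  case (Cons a u)
  then show ?case by (cases v; cases w) auto
qed simp

lemma vxor_left_commute: "vxor u (vxor v w) = vxor v (vxor u w)"
  by (metis vxor_assoc vxor_commute)

lemma vxor_self: "vxor u u = zeros (length u)"
  by (induction u) auto

lemma vxor_zeros: "length u = n \<Longrightarrow> vxor u (zeros n) = u" "length u = n \<Longrightarrow> vxor (zeros n) u = u"
  by (induction u arbitrary: n) auto

lemma vxor_cancel: "length u = length v \<Longrightarrow> vxor u (vxor u v) = v"
  by (simp add: vxor_assoc[symmetric] vxor_self vxor_zeros)

text \<open>Subsets of row positions are counted, so equal rows count separately and the count for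
  the zero vector is the order of the kernel. The base case accepts a zero vector of any
  length.\<close>

fun combination_count :: "bool list list \<Rightarrow> bool list \<Rightarrow> nat" where
  "combination_count [] w = of_bool (True \<notin> set w)"
| "combination_count (v # R) w = combination_count R w + combination_count R (vxor v w)"

text \<open>Here \<open>p\<close> is a pivot row without its leading \<open>True\<close>: the entry
  in the current column is cleared by adding the pivot, and then the column is deleted.\<close>

definition reduce_row :: "bool list \<Rightarrow> bool list \<Rightarrow> bool list" where
  "reduce_row p v = (if hd v then vxor (tl v) p else tl v)"

lemma combination_count_middle:
  "combination_count (R @ x # S) w = combination_count (x # R @ S) w"
proof (induction R arbitrary: w)
  case (Cons a R)
  then show ?case by (simp add: vxor_left_commute)
qed simp

text \<open>Summing a subset of rows commutes with \<open>reduce_row p\<close>. The reduced sum hits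
  the reduced target iff the original sum is the target or the target plus the pivot, and the first
  bit tells which; the left side counts both alternatives. The pivot stays outside \<open>R\<close>
  and \<open>b\<close> is arbitrary so that the induction goes through.\<close>

lemma combination_count_pivot_aux:
  assumes "length p = m" "length w = m" "\<forall>r\<in>set R. length r = Suc m"
  shows "combination_count R (b # w) + combination_count R ((\<not> b) # vxor p w) =
    combination_count (map (reduce_row p) R) (if b then vxor p w else w)"
  using assms
proof (induction R arbitrary: b w)
  case Nil
  then show ?case by simp
next
  case (Cons v R)
  then obtain c r where v: "v = c # r" "length r = m" by (cases v) auto
  have 1: "combination_count R (b # w) + combination_count R ((\<not> b) # vxor p w) =
    combination_count (map (reduce_row p) R) (if b then vxor p w else w)"
    by (rule Cons.IH) (use Cons.prems in auto)
  have 2: "combination_count R ((c \<noteq> b) # vxor r w) +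
      combination_count R ((\<not> (c \<noteq> b)) # vxor p (vxor r w)) =
    combination_count (map (reduce_row p) R) (if c \<noteq> b then vxor p (vxor r w) else vxor r w)"
    by (rule Cons.IH) (use Cons.prems v in auto)
  have 3: "(if c \<noteq> b then vxor p (vxor r w) else vxor r w) =
    vxor (reduce_row p v) (if b then vxor p w else w)"
    using Cons.prems v vxor_cancel[of p "vxor r w"] vxor_left_commute[of r p w]
    by (auto simp: reduce_row_def vxor_assoc vxor_commute[of r p])
  have "combination_count R (vxor v ((\<not> b) # vxor p w)) =
    combination_count R ((\<not> (c \<noteq> b)) # vxor p (vxor r w))"
    using v vxor_left_commute[of r p w] by (cases b; cases c) simp_all
  with 1 2 3 v show ?case by simp
qed

text \<open>The first column decides whether the pivot takes part in a combination, so deleting the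
  pivot and the column neither loses nor merges combinations.\<close>

lemma combination_count_pivot:
  assumes "length p = m" "length w = Suc m" "\<forall>r\<in>set R. length r = Suc m"
  shows "combination_count ((True # p) # R) w =
    combination_count (map (reduce_row p) R) (reduce_row p w)"
proof -
  from assms obtain b w' where w: "w = b # w'" "length w' = m" by (cases w) auto
  with combination_count_pivot_aux[of p m w' R b] assms show ?thesis
    by (auto simp: reduce_row_def vxor_commute)
qed

lemma combination_count_no_pivot:
  assumes "length w = Suc m" "\<forall>r\<in>set R. length r = Suc m" "\<forall>r\<in>set R. \<not> hd r"
  shows "combination_count R w = (if hd w then 0 else combination_count (map tl R) (tl w))"
  using assms
proof (induction R arbitrary: w)
  case Nil
  then show ?case by (cases w) auto
next
  case (Cons v R)
  from Cons.prems obtain b w' c r where "w = b # w'" "length w' = m" "v = c # r" "length r = m" "\<not> c"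
    by (cases w; cases v) auto
  with Cons show ?case by simp
qed

section \<open>Elimination with tagged rows\<close>

text \<open>
  Only tagged rows (generators) may become pivots; an untagged row (logical operator) with a nonzero
  entry in a column without pivot is not in the row space and is dropped.
\<close>

fun pass :: "bool list option \<Rightarrow> (bool \<times> bool list) list \<Rightarrow> (bool \<times> bool list) list" where
  "pass P [] = []"
| "pass P ((t, v) # R) =
    (case P of
      None \<Rightarrow> if hd v then (if t then pass (Some (tl v)) R else pass None R)
              else (t, tl v) # pass None R
    | Some p \<Rightarrow> (t, reduce_row p v) # pass P R)"

fun eliminate :: "nat \<Rightarrow> (bool \<times> bool list) list \<Rightarrow> (bool \<times> bool list) list" where
  "eliminate 0 R = R"
| "eliminate (Suc m) R = eliminate m (pass None R)"

text \<open>Generators precede logical operators, so a pass has decided whether the column has a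
  pivot before it meets an untagged row.\<close>

definition tagged :: "bool list list \<Rightarrow> bool list list \<Rightarrow> (bool \<times> bool list) list" where
  "tagged gs ws = map (Pair True) gs @ map (Pair False) ws"

lemma pass_Some: "pass (Some p) R = map (map_prod id (reduce_row p)) R"
  by (induction R) (auto simp: split_beta)

lemma pass_None_untagged:
  "pass None (map (Pair False) ws) = map (Pair False) (map tl (filter (\<lambda>w. \<not> hd w) ws))"
  by (induction ws) auto

lemma pass_None_skip:
  "\<forall>g\<in>set gs. \<not> hd g \<Longrightarrow> pass None (map (Pair True) gs @ R) = map (Pair True) (map tl gs) @ pass None R"
  by (induction gs) auto

text \<open>Two quantities survive a pass: the count for the zero vector and the list of positive
  counts of the logical rows. The filter makes dropped rows invisible: such a row has entry one in a
  column where all generators vanish, hence count zero.\<close>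

lemma pass_tagged:
  assumes "\<forall>g\<in>set gs. length g = Suc m" "\<forall>w\<in>set ws. length w = Suc m"
  shows "\<exists>gs' ws'. pass None (tagged gs ws) = tagged gs' ws' \<and>
    (\<forall>g\<in>set gs'. length g = m) \<and> (\<forall>w\<in>set ws'. length w = m) \<and>
    combination_count gs' (zeros m) = combination_count gs (zeros (Suc m)) \<and>
    filter (\<lambda>x. 0 < x) (map (combination_count gs') ws') =
    filter (\<lambda>x. 0 < x) (map (combination_count gs) ws)"
proof (cases "\<exists>g\<in>set gs. hd g")
  case False
  then have nh: "\<forall>g\<in>set gs. \<not> hd g" by blast
  let ?ws = "map tl (filter (\<lambda>w. \<not> hd w) ws)"
  have "filter (\<lambda>x. 0 < x) (map (combination_count gs) ws) =
    filter (\<lambda>x. 0 < x) (map (combination_count (map tl gs)) ?ws)"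
    using assms(2)
  proof (induction ws)
    case (Cons w ws)
    then show ?case using combination_count_no_pivot[OF _ assms(1) nh, of w] by auto
  qed simp
  moreover have "combination_count gs (zeros (Suc m)) = combination_count (map tl gs) (zeros m)"
    using combination_count_no_pivot[OF _ assms(1) nh, of "zeros (Suc m)"] by simp
  ultimately show ?thesis
    using assms nh
    by (intro exI[of _ "map tl gs"] exI[of _ ?ws])
      (auto simp: tagged_def pass_None_skip pass_None_untagged)
next
  case True
  \<comment> \<open>\<open>g\<close> is the first generator with entry one, so the rows before it
    are merely shortened, which for them is the same as \<open>reduce_row p\<close>.\<close>
  then obtain g1 g g2 where gs: "gs = g1 @ g # g2" "hd g" "\<forall>x\<in>set g1. \<not> hd x"
    by (metis split_list_first_prop)
  with assms obtain p where p: "g = True # p" "length p = m" by (cases g) auto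
  let ?gs = "map (reduce_row p) (g1 @ g2)" and ?ws = "map (reduce_row p) ws"
  have g1: "map tl g1 = map (reduce_row p) g1"
    using gs(3) by (auto simp: reduce_row_def)
  have pass: "pass None (tagged gs ws) = tagged ?gs ?ws"
    using gs p g1 by (simp add: tagged_def pass_None_skip pass_Some)
  have cnt: "combination_count gs w = combination_count ?gs (reduce_row p w)" if "length w = Suc m" for w
    using combination_count_pivot[of p m w "g1 @ g2"] that assms gs p
      combination_count_middle[of g1 g g2 w] by simp
  have "combination_count ?gs (zeros m) = combination_count gs (zeros (Suc m))"
    using cnt[of "zeros (Suc m)"] by (simp add: reduce_row_def)
  moreover have "map (combination_count gs) ws = map (combination_count ?gs) ?ws"
    using cnt assms(2) by simp
  moreover have "\<forall>g\<in>set ?gs. length g = m" "\<forall>w\<in>set ?ws. length w = m"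
    using assms gs p by (auto simp: reduce_row_def)
  ultimately show ?thesis
    using pass by metis
qed

lemma combination_count_empty_rows:
  "\<forall>g\<in>set gs. length g = 0 \<Longrightarrow> combination_count gs [] = 2 ^ length gs"
  by (induction gs) auto

text \<open>Once all columns are deleted only tags remain, and each of the \<open>2 ^ k\<close>
  subsets of the \<open>k\<close> surviving empty rows sums to the empty vector. So \<open>k\<close>
  is the number of generators minus the rank of their rows, and all surviving logical rows have the
  same count.\<close>

lemma eliminate_tagged:
  assumes "\<forall>g\<in>set gs. length g = m" "\<forall>w\<in>set ws. length w = m"
  shows "\<exists>k c. eliminate m (tagged gs ws) = replicate k (True, []) @ replicate c (False, []) \<and>
    combination_count gs (zeros m) = 2 ^ k \<and>
    filter (\<lambda>x. 0 < x) (map (combination_count gs) ws) = replicate c (2 ^ k)"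
  using assms
proof (induction m arbitrary: gs ws)
  case 0
  then have "gs = replicate (length gs) []" "ws = replicate (length ws) []"
    by (auto intro!: replicate_eqI)
  then obtain k c where gw: "gs = replicate k []" "ws = replicate c []" by metis
  have "combination_count (replicate k []) [] = 2 ^ k"
    using combination_count_empty_rows[of "replicate k []"] by simp
  then show ?case
    by (intro exI[of _ k] exI[of _ c]) (simp add: gw tagged_def)
next
  case (Suc m)
  from pass_tagged[OF Suc.prems] obtain gs' ws' where
    "pass None (tagged gs ws) = tagged gs' ws'"
    "\<forall>g\<in>set gs'. length g = m" "\<forall>w\<in>set ws'. length w = m"
    "combination_count gs' (zeros m) = combination_count gs (zeros (Suc m))"
    "filter (\<lambda>x. 0 < x) (map (combination_count gs') ws') =
     filter (\<lambda>x. 0 < x) (map (combination_count gs) ws)"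
    by blast
  with Suc.IH[of gs' ws'] show ?case by simp
qed

lemma length_pass: "length (pass P R) \<le> length R"
  by (induction P R rule: pass.induct) (auto split: option.splits intro: le_SucI)

lemma pass_row_lengths:
  assumes "\<forall>r\<in>set R. length (snd r) = Suc m" "\<forall>p. P = Some p \<longrightarrow> length p = m"
  shows "\<forall>r\<in>set (pass P R). length (snd r) = m"
  using assms
  by (induction P R rule: pass.induct) (auto split: option.splits if_splits simp: reduce_row_def)

section \<open>Implementation of the algorithm and its running time\<close>

section \<open>The elimination program\<close>

text \<open>
  Stack 0 holds the input, 1 the output (reversed), 2 the matrix row by row (tag first), 3 the rows
  already processed (reversed), 4 the number of remaining columns in unary, 7 the pivot row, 8 a
  flag for its presence, 9 the mask of kept qubits, 11 and 12 their number in unary;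
  5, 6 and 10 are auxiliary.
\<close>

definition for_width :: "program \<Rightarrow> program" where
  "for_width p = Seq (While_Scanned 4 bits (Seq (pop 4) (Seq (push 5 True) p))) (move 5 4)"

definition copy_row :: program where
  "copy_row = for_width (shift 2 3)"

definition skip_row :: program where
  "skip_row = for_width (pop 2)"

definition load_row :: program where
  "load_row = Seq (for_width (shift 2 6)) (Seq (move 6 7) (push 8 True))"

definition xor_bit :: program where
  "xor_bit = If_Scanned 7 {Some True} (If_Scanned 2 {Some True} (push 3 False) (push 3 True)) (dup 2 3)"

definition xor_row :: program where
  "xor_row = Seq (While_Scanned 7 bits (Seq xor_bit (Seq (shift 7 6) (pop 2)))) (move 6 7)"

text \<open>The tag is already popped, so the bit tested is the entry in the current column. A row
  with entry zero is copied whether or not a pivot is stored, in agreement with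
  \<open>reduce_row\<close>. A new pivot is loaded without being written back, which removes it from
  the matrix.\<close>

definition row_step :: "bool \<Rightarrow> program" where
  "row_step t = If_Scanned 2 {Some True}
     (Seq (pop 2) (If_Scanned 8 bits (Seq (push 3 t) xor_row) (if t then load_row else skip_row)))
     (Seq (pop 2) (Seq (push 3 t) copy_row))"

definition any_row :: program where
  "any_row = If_Scanned 2 {Some True} (Seq (pop 2) (row_step True)) (Seq (pop 2) (row_step False))"

definition clear :: "nat \<Rightarrow> program" where
  "clear k = While_Scanned k bits (pop k)"

definition one_round :: program where
  "one_round = Seq (While_Scanned 2 bits any_row) (Seq (move 3 2) (Seq (clear 7) (clear 8)))"

text \<open>The width is decreased before the round, so that during a round stack 4 holds the length
  of a row without its tag and current entry.\<close>

definition all_rounds :: program where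
  "all_rounds = While_Scanned 4 bits (Seq (pop 4) one_round)"

text \<open>A round costs 1 for the test, 4 for the counter passed from stack 4 to stack 5, and 5
  for the shift. The same bound is used for the loading and the skipping loop.\<close>

lemma takes_copy_loop:
  "takes (While_Scanned 4 bits (Seq (pop 4) (Seq (push 5 True) (shift 2 3))))
    [i, ou, r @ m, q, replicate (length r) True, w', p, p', f, k, k', n1, n2] (10 * length r + 1)
    [i, ou, m, rev r @ q, [], replicate (length r) True @ w', p, p', f, k, k', n1, n2]"
proof (induction r arbitrary: q w')
  case Nil
  show ?case by (simp add: takes_While_done)
next
  case (Cons b r)
  have step: "takes (Seq (pop 4) (Seq (push 5 True) (shift 2 3)))
    [i, ou, (b # r) @ m, q, replicate (length (b # r)) True, w', p, p', f, k, k', n1, n2] 9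
    [i, ou, r @ m, b # q, replicate (length r) True, True # w', p, p', f, k, k', n1, n2]"
    unfolding takes_def shift_def by simp
  show ?case
    by (rule takes_While_eq[OF step Cons.IH])
      (simp_all add: replicate_app_Cons_same)
qed

lemma takes_load_loop:
  "takes (While_Scanned 4 bits (Seq (pop 4) (Seq (push 5 True) (shift 2 6))))
    [i, ou, r @ m, q, replicate (length r) True, w', p, p', f, k, k', n1, n2] (10 * length r + 1)
    [i, ou, m, q, [], replicate (length r) True @ w', rev r @ p, p', f, k, k', n1, n2]"
proof (induction r arbitrary: p w')
  case Nil
  show ?case by (simp add: takes_While_done)
next
  case (Cons b r)
  have step: "takes (Seq (pop 4) (Seq (push 5 True) (shift 2 6)))
    [i, ou, (b # r) @ m, q, replicate (length (b # r)) True, w', p, p', f, k, k', n1, n2] 9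
    [i, ou, r @ m, q, replicate (length r) True, True # w', b # p, p', f, k, k', n1, n2]"
    unfolding takes_def shift_def by simp
  show ?case
    by (rule takes_While_eq[OF step Cons.IH])
      (simp_all add: replicate_app_Cons_same)
qed

lemma takes_skip_loop:
  "takes (While_Scanned 4 bits (Seq (pop 4) (Seq (push 5 True) (pop 2))))
    [i, ou, r @ m, q, replicate (length r) True, w', p, p', f, k, k', n1, n2] (10 * length r + 1)
    [i, ou, m, q, [], replicate (length r) True @ w', p, p', f, k, k', n1, n2]"
proof (induction r arbitrary: w')
  case Nil
  show ?case by (simp add: takes_While_done)
next
  case (Cons b r)
  have step: "takes (Seq (pop 4) (Seq (push 5 True) (pop 2)))
    [i, ou, (b # r) @ m, q, replicate (length (b # r)) True, w', p, p', f, k, k', n1, n2] 9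
    [i, ou, r @ m, q, replicate (length r) True, True # w', p, p', f, k, k', n1, n2]"
    unfolding takes_def by simp
  show ?case
    by (rule takes_While_eq[OF step Cons.IH])
      (simp_all add: replicate_app_Cons_same)
qed

lemma takes_xor_loop:
  assumes "length u = length r"
  shows "takes (While_Scanned 7 bits (Seq xor_bit (Seq (shift 7 6) (pop 2))))
    [i, ou, r @ m, q, w, w', p, u, f, k, k', n1, n2] (12 * length r + 1)
    [i, ou, m, rev (vxor r u) @ q, w, w', rev u @ p, [], f, k, k', n1, n2]"
  using assms
proof (induction r u arbitrary: p q rule: list_induct2')
  case 1
  show ?case by (simp add: takes_While_done)
next
  case (4 b r c u)
  have step: "takes (Seq xor_bit (Seq (shift 7 6) (pop 2)))
    [i, ou, (b # r) @ m, q, w, w', p, c # u, f, k, k', n1, n2] 11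
    [i, ou, r @ m, (b \<noteq> c) # q, w, w', c # p, u, f, k, k', n1, n2]"
    unfolding takes_def shift_def xor_bit_def by simp
  show ?case
    by (rule takes_While_eq[OF step "4.IH"])
      (use 4 in \<open>simp_all add: top_of_bits\<close>)
qed simp_all

lemma takes_restore_width:
  "takes (move 5 4) [i, ou, m, q, [], replicate w True, p, p', f, k, k', n1, n2] (6 * w + 1)
    [i, ou, m, q, replicate w True, [], p, p', f, k, k', n1, n2]"
  by (rule takes_mono[OF takes_move]) simp_all

lemma takes_copy_row:
  assumes "w = length r"
  shows "takes copy_row
    [i, ou, r @ m, q, replicate w True, [], p, p', f, k, k', n1, n2] (16 * w + 2)
    [i, ou, m, rev r @ q, replicate w True, [], p, p', f, k, k', n1, n2]"
  unfolding copy_row_def for_width_def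
  by (rule takes_Seq_eq[OF takes_copy_loop[of i ou r m q "[]", folded assms] _ takes_restore_width])
    (use assms in simp_all)

lemma takes_skip_row:
  assumes "w = length r"
  shows "takes skip_row
    [i, ou, r @ m, q, replicate w True, [], p, p', f, k, k', n1, n2] (16 * w + 2)
    [i, ou, m, q, replicate w True, [], p, p', f, k, k', n1, n2]"
  unfolding skip_row_def for_width_def
  by (rule takes_Seq_eq[OF takes_skip_loop[of i ou r m q "[]", folded assms] _ takes_restore_width])
    (use assms in simp_all)

lemma takes_move_6_7:
  "takes (move 6 7) [i, ou, m, q, w, w', p, [], f, k, k', n1, n2] (6 * length p + 1)
    [i, ou, m, q, w, w', [], rev p, f, k, k', n1, n2]"
  by (rule takes_mono[OF takes_move]) simp_all

lemma takes_push: "j < length s \<Longrightarrow> takes (push j b) s 2 (s[j := b # s ! j])"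
  by (simp add: takes_def)

lemma takes_pop: "j < length s \<Longrightarrow> s ! j \<noteq> [] \<Longrightarrow> takes (pop j) s 2 (s[j := tl (s ! j)])"
  by (simp add: takes_def)

lemma takes_load_row:
  assumes "w = length r"
  shows "takes load_row
    [i, ou, r @ m, q, replicate w True, [], [], [], f, k, k', n1, n2] (22 * w + 5)
    [i, ou, m, q, replicate w True, [], [], r, True # f, k, k', n1, n2]"
proof -
  have 1: "takes (for_width (shift 2 6))
    [i, ou, r @ m, q, replicate w True, [], [], [], f, k, k', n1, n2] (16 * w + 2)
    [i, ou, m, q, replicate w True, [], rev r, [], f, k, k', n1, n2]"
    unfolding for_width_def
    by (rule takes_Seq_eq[OF takes_load_loop[of i ou r m q "[]" "[]", folded assms] _
          takes_restore_width]) (use assms in simp_all)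
  have 2: "takes (Seq (move 6 7) (push 8 True))
    [i, ou, m, q, replicate w True, [], rev r, [], f, k, k', n1, n2] (6 * w + 3)
    [i, ou, m, q, replicate w True, [], [], r, True # f, k, k', n1, n2]"
    by (rule takes_Seq_eq[OF takes_move_6_7 refl takes_push]) (use assms in simp_all)
  show ?thesis unfolding load_row_def by (rule takes_Seq[OF 1 2]) simp
qed

lemma takes_xor_row:
  assumes "length r = length u"
  shows "takes xor_row [i, ou, r @ m, q, w, w', [], u, f, k, k', n1, n2] (18 * length u + 2)
    [i, ou, m, rev (vxor r u) @ q, w, w', [], u, f, k, k', n1, n2]"
  unfolding xor_row_def
  by (rule takes_Seq_eq[OF takes_xor_loop refl takes_move_6_7]) (use assms in simp_all)

fun pivot_row :: "bool list option \<Rightarrow> bool list" where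
  "pivot_row None = []"
| "pivot_row (Some p) = p"

fun pivot_flag :: "bool list option \<Rightarrow> bool list" where
  "pivot_flag None = []"
| "pivot_flag (Some p) = [True]"

definition flat :: "(bool \<times> bool list) list \<Rightarrow> bool list" where
  "flat R = concat (map (\<lambda>(t, v). t # v) R)"

lemma flat_simps [simp]: "flat [] = []" "flat ((t, v) # R) = t # v @ flat R"
  by (simp_all add: flat_def)

lemma takes_any_row_False:
  assumes "w = length r"
  shows "takes any_row
    [i, ou, t # False # r @ m, q, replicate w True, [], p, p', f, k, k', n1, n2] (24 * w + 20)
    [i, ou, m, rev (t # r) @ q, replicate w True, [], p, p', f, k, k', n1, n2]"
  unfolding any_row_def row_step_def takes_def
  using assms by (simp add: runs_to_takes[OF takes_copy_row])

lemma takes_any_row_Some: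
  assumes "w = length r" "length p = w"
  shows "takes any_row
    [i, ou, t # True # r @ m, q, replicate w True, [], [], p, [True], k, k', n1, n2] (24 * w + 20)
    [i, ou, m, rev (t # vxor r p) @ q, replicate w True, [], [], p, [True], k, k', n1, n2]"
  unfolding any_row_def row_step_def takes_def
  using assms by (simp add: runs_to_takes[OF takes_xor_row])

lemma takes_any_row_None:
  assumes "w = length r"
  shows "takes any_row
    [i, ou, t # True # r @ m, q, replicate w True, [], [], [], [], k, k', n1, n2] (24 * w + 20)
    [i, ou, m, q, replicate w True, [], [], if t then r else [], if t then [True] else [], k, k', n1, n2]"
  unfolding any_row_def row_step_def takes_def
  using assms
  by (simp add: runs_to_takes[OF takes_load_row] runs_to_takes[OF takes_skip_row])

text \<open>Stacks 7 and 8 encode the option argument of \<open>pass\<close>. The pivot left at the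
  end is existential because \<open>pass\<close> does not return it; clearing the stacks needs only
  its length.\<close>

lemma takes_pass:
  assumes "\<forall>r\<in>set R. length (snd r) = Suc w" "\<forall>p. P = Some p \<longrightarrow> length p = w"
  shows "\<exists>P'. (\<forall>p. P' = Some p \<longrightarrow> length p = w) \<and> takes (While_Scanned 2 bits any_row)
    [i, ou, flat R, q, replicate w True, [], [], pivot_row P, pivot_flag P, k, k', n1, n2]
    ((24 * w + 21) * length R + 1)
    [i, ou, [], rev (flat (pass P R)) @ q, replicate w True, [], [], pivot_row P', pivot_flag P',
     k, k', n1, n2]"
  using assms
proof (induction R arbitrary: P q)
  case Nil
  then show ?case by (intro exI[of _ P]) (simp add: takes_While_done)
next
  case (Cons row R)
  then obtain t b r where row: "row = (t, b # r)" and w: "w = length r"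
    by (cases row; cases "snd row") auto
  let ?Q = "\<lambda>P q. [i, ou, flat R, q, replicate w True, [], [], pivot_row P, pivot_flag P, k, k', n1, n2]"
  \<comment> \<open>All cases take one form: a row replaces the pivot by \<open>P1\<close> and the
    output by \<open>q1\<close>, and \<open>out\<close> says that \<open>pass\<close> does the same.
    The induction hypothesis is then applied once for all of them.\<close>
  obtain P1 q1 where step: "takes any_row
      [i, ou, flat (row # R), q, replicate w True, [], [], pivot_row P, pivot_flag P, k, k', n1, n2]
      (24 * w + 20) (?Q P1 q1)"
    and len: "\<forall>p. P1 = Some p \<longrightarrow> length p = w"
    and out: "rev (flat (pass P (row # R))) @ q = rev (flat (pass P1 R)) @ q1"
  proof (cases b)
    case False
    show ?thesis
      by (rule that[where ?P1.0 = P and ?q1.0 = "rev (t # r) @ q"])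
        (use takes_any_row_False[OF w, of i ou t "flat R" q] row Cons.prems False in
          \<open>auto simp: reduce_row_def split: option.split\<close>)
  next
    case True
    show ?thesis
    proof (cases P)
      case None
      show ?thesis
        by (rule that[where ?P1.0 = "if t then Some r else None" and ?q1.0 = q])
          (use takes_any_row_None[OF w, of i ou t "flat R" q k k' n1 n2] row w True None in auto)
    next
      case (Some p)
      with Cons.prems have "length p = w" by simp
      then show ?thesis
        using that[where ?P1.0 = P and ?q1.0 = "rev (t # vxor r p) @ q"]
          takes_any_row_Some[OF w, of p i ou t "flat R" q k k' n1 n2] row Some True
        by (simp add: reduce_row_def)
    qed
  qed
  from Cons.IH[OF _ len, of q1] Cons.prems obtain P' where
    "\<forall>p. P' = Some p \<longrightarrow> length p = w"
    "takes (While_Scanned 2 bits any_row) (?Q P1 q1) ((24 * w + 21) * length R + 1)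
      [i, ou, [], rev (flat (pass P1 R)) @ q1, replicate w True, [], [], pivot_row P', pivot_flag P',
       k, k', n1, n2]"
    by auto
  then show ?case
    using takes_While_eq[OF step, of 2 bits] out row
    by (intro exI[of _ P'] conjI) (auto simp: top_of_bits)
qed

lemma takes_clear:
  assumes "j < length s"
  shows "takes (clear j) s (3 * length (s ! j) + 1) (s[j := []])"
  using assms
proof (induction "s ! j" arbitrary: s)
  case Nil
  then show ?case unfolding clear_def
    by (metis One_nat_def add.commute add_0 list.size(3) list_update_id mult_0_right order_refl
        plus_1_eq_Suc takes_While_done top_of_bits)
next
  case (Cons b bs)
  have rec: "takes (clear j) (s[j := bs]) (3 * length bs + 1) (s[j := []])"
    using Cons.hyps(1)[of "s[j := bs]"] Cons.prems by simp
  have step: "takes (pop j) s 2 (s[j := bs])"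
    using takes_pop[OF Cons.prems] Cons.hyps(2)[symmetric] by simp
  show ?case unfolding clear_def
    by (rule takes_While_eq[OF step rec[unfolded clear_def]])
      (use Cons.prems Cons.hyps(2)[symmetric] in \<open>auto simp: top_of_bits\<close>)
qed

lemma takes_one_round:
  assumes "\<forall>r\<in>set R. length (snd r) = Suc w"
  shows "takes one_round
    [i, ou, flat R, [], replicate w True, [], [], [], [], k, k', n1, n2]
    (40 * (w + 1) * (length R + 1))
    [i, ou, flat (pass None R), [], replicate w True, [], [], [], [], k, k', n1, n2]"
proof -
  from takes_pass[OF assms, of None i ou "[]" k k' n1 n2] obtain P where
    P: "\<forall>p. P = Some p \<longrightarrow> length p = w" and
    1: "takes (While_Scanned 2 bits any_row)
      [i, ou, flat R, [], replicate w True, [], [], [], [], k, k', n1, n2]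
      ((24 * w + 21) * length R + 1)
      [i, ou, [], rev (flat (pass None R)), replicate w True, [], [], pivot_row P, pivot_flag P,
       k, k', n1, n2]"
    by auto
  have len: "length (pivot_row P) \<le> w" "length (pivot_flag P) \<le> 1"
    using P by (cases P; simp)+
  \<comment> \<open>A pass shortens rows and adds none, so moving the output back is also linear in
    the size of the matrix.\<close>
  have "length (flat S) = length S * (w + 1)" if "\<forall>r\<in>set S. length (snd r) = w" for S
    using that by (induction S) (auto simp: flat_def split_beta)
  from this[of "pass None R"] pass_row_lengths[OF assms, of None] length_pass[of None R]
  have flat_len: "length (flat (pass None R)) \<le> length R * (w + 1)"
    by (metis (no_types, lifting) mult_le_mono1 option.distinct(1))
  have 2: "takes (move 3 2)
      [i, ou, [], rev (flat (pass None R)), replicate w True, [], [], pivot_row P, pivot_flag P,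
       k, k', n1, n2] (6 * (length R * (w + 1)) + 1)
      [i, ou, flat (pass None R), [], replicate w True, [], [], pivot_row P, pivot_flag P,
       k, k', n1, n2]"
    by (rule takes_mono[OF takes_move]) (use flat_len in simp_all)
  have 3: "takes (clear 7)
      [i, ou, flat (pass None R), [], replicate w True, [], [], pivot_row P, pivot_flag P,
       k, k', n1, n2] (3 * w + 1)
      [i, ou, flat (pass None R), [], replicate w True, [], [], [], pivot_flag P,
       k, k', n1, n2]"
    by (rule takes_mono[OF takes_clear]) (use len in simp_all)
  have 4: "takes (clear 8)
      [i, ou, flat (pass None R), [], replicate w True, [], [], [], pivot_flag P,
       k, k', n1, n2] 4
      [i, ou, flat (pass None R), [], replicate w True, [], [], [], [],
       k, k', n1, n2]"
    by (rule takes_mono[OF takes_clear]) (use len in simp_all)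
  show ?thesis unfolding one_round_def
    by (rule takes_Seq[OF 1 takes_Seq[OF 2 takes_Seq[OF 3 4 order_refl] order_refl]])
      (simp add: algebra_simps)
qed

text \<open>Each of the \<open>w\<close> rounds is linear in the matrix. The resulting product of
  two widths and the number of rows is the cubic part of the running time; 43 leaves room for the 3
  extra steps per round.\<close>

lemma takes_all_rounds:
  assumes "\<forall>r\<in>set R. length (snd r) = w"
  shows "takes all_rounds
    [i, ou, flat R, [], replicate w True, [], [], [], [], k, k', n1, n2]
    (43 * w * (w + 1) * (length R + 1) + 1)
    [i, ou, flat (eliminate w R), [], [], [], [], [], [], k, k', n1, n2]"
  using assms
proof (induction w arbitrary: R)
  case 0
  then show ?case unfolding all_rounds_def by (simp add: takes_While_done)
next
  case (Suc w)
  have step: "takes (Seq (pop 4) one_round)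
    [i, ou, flat R, [], replicate (Suc w) True, [], [], [], [], k, k', n1, n2]
    (2 + 40 * (w + 1) * (length R + 1))
    [i, ou, flat (pass None R), [], replicate w True, [], [], [], [], k, k', n1, n2]"
    by (rule takes_Seq_eq[OF takes_pop _ takes_one_round[OF Suc.prems]]) simp_all
  have rec: "takes all_rounds
    [i, ou, flat (pass None R), [], replicate w True, [], [], [], [], k, k', n1, n2]
    (43 * w * (w + 1) * (length R + 1) + 1)
    [i, ou, flat (eliminate w (pass None R)), [], [], [], [], [], [], k, k', n1, n2]"
    by (rule takes_mono[OF Suc.IH])
      (use pass_row_lengths[OF Suc.prems, of None] length_pass[of None R] in auto)
  show ?case
    unfolding all_rounds_def
    by (rule takes_While_eq[OF step rec[unfolded all_rounds_def]]) (simp_all add: algebra_simps)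
qed

section \<open>Reading the input\<close>

text \<open>Restriction to the complement of the kept qubits is done by zeroing entries instead of
  deleting them: all rows keep the length \<open>2 * L\<close>, and a masked row vanishes iff the
  operator is supported on the kept qubits. The mask is doubled for the \<open>x\<close>-part and
  the \<open>z\<close>-part.\<close>

definition masked :: "bool list \<Rightarrow> bool list \<Rightarrow> bool list" where
  "masked kept v = map2 (\<lambda>b a. b \<and> \<not> a) v (kept @ kept)"

text \<open>Each mark of the unary \<open>L\<close> gives two marks of width, for the columns of
  both halves, and one mark for reading the mask.\<close>

definition read_size :: program where
  "read_size = While_Scanned 2 {Some True}
     (Seq (pop 2) (Seq (push 4 True) (Seq (push 4 True) (push 6 True))))"

text \<open>The number of kept qubits is recorded twice, since writing a power of two consumes its
  exponent and the spectrum has up to two nonzero values.\<close>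

definition read_mask :: program where
  "read_mask = While_Scanned 6 bits
     (Seq (pop 6) (Seq (dup 2 9)
       (If_Scanned 2 {Some True} (Seq (pop 2) (Seq (push 11 True) (push 12 True))) (pop 2))))"

definition read_half :: program where
  "read_half = Seq (While_Scanned 9 bits
     (Seq (If_Scanned 9 {Some True} (push 2 False) (dup 0 2)) (Seq (pop 0) (shift 9 10)))) (move 10 9)"

text \<open>The input is consumed from its end: the \<open>z\<close>-half comes before the
  \<open>x\<close>-half and the sign last, where it is discarded because only the vector enters the
  elimination. Pushing restores the original order on stack 2.\<close>

definition read_row :: "bool \<Rightarrow> program" where
  "read_row t = Seq read_half (Seq read_half (Seq (pop 0) (push 2 t)))"

lemma takes_read_size:
  "takes read_size [i, ou, replicate l True @ False # m, q, w, w', p, p', f, k, k', n1, n2] (9 * l + 1)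
    [i, ou, False # m, q, replicate (2 * l) True @ w, w', replicate l True @ p, p', f, k, k', n1, n2]"
proof (induction l arbitrary: w p)
  case 0
  show ?case unfolding read_size_def by (simp add: takes_While_done)
next
  case (Suc l)
  have step: "takes (Seq (pop 2) (Seq (push 4 True) (Seq (push 4 True) (push 6 True))))
    [i, ou, replicate (Suc l) True @ False # m, q, w, w', p, p', f, k, k', n1, n2] 8
    [i, ou, replicate l True @ False # m, q, True # True # w, w', True # p, p', f, k, k', n1, n2]"
    unfolding takes_def by simp
  show ?case unfolding read_size_def
    by (rule takes_While_eq[OF step Suc.IH[unfolded read_size_def]])
      (simp_all add: replicate_app_Cons_same)
qed

lemma takes_read_mask:
  "takes read_mask [i, ou, kept @ m, q, w, w', replicate (length kept) True, p', f, k, k', n1, n2]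
    (13 * length kept + 1)
    [i, ou, m, q, w, w', [], p', f, rev kept @ k, k',
     replicate (length (filter id kept)) True @ n1, replicate (length (filter id kept)) True @ n2]"
proof (induction kept arbitrary: k n1 n2)
  case Nil
  show ?case unfolding read_mask_def by (simp add: takes_While_done)
next
  case (Cons b kept)
  have step: "takes (Seq (pop 6) (Seq (dup 2 9)
       (If_Scanned 2 {Some True} (Seq (pop 2) (Seq (push 11 True) (push 12 True))) (pop 2))))
    [i, ou, (b # kept) @ m, q, w, w', replicate (length (b # kept)) True, p', f, k, k', n1, n2] 12
    [i, ou, kept @ m, q, w, w', replicate (length kept) True, p', f, b # k, k',
     if b then True # n1 else n1, if b then True # n2 else n2]"
    unfolding takes_def by simp
  show ?case unfolding read_mask_def
    by (rule takes_While_eq[OF step Cons.IH[unfolded read_mask_def]])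
      (simp_all add: replicate_app_Cons_same)
qed

lemma takes_read_half_loop:
  assumes "length kept = length v"
  shows "takes (While_Scanned 9 bits
     (Seq (If_Scanned 9 {Some True} (push 2 False) (dup 0 2)) (Seq (pop 0) (shift 9 10))))
    [v @ i, ou, m, q, w, w', p, p', f, kept, k', n1, n2] (12 * length kept + 1)
    [i, ou, rev (map2 (\<lambda>b a. b \<and> \<not> a) v kept) @ m, q, w, w', p, p', f, [], rev kept @ k', n1, n2]"
  using assms
proof (induction kept v arbitrary: m k' rule: list_induct2')
  case 1
  show ?case by (simp add: takes_While_done)
next
  case (4 a kept b v)
  have step: "takes
     (Seq (If_Scanned 9 {Some True} (push 2 False) (dup 0 2)) (Seq (pop 0) (shift 9 10)))
    [(b # v) @ i, ou, m, q, w, w', p, p', f, a # kept, k', n1, n2] 11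
    [v @ i, ou, (b \<and> \<not> a) # m, q, w, w', p, p', f, kept, a # k', n1, n2]"
    unfolding takes_def shift_def by simp
  show ?case
    by (rule takes_While_eq[OF step "4.IH"])
      (use 4 in \<open>simp_all add: top_of_bits\<close>)
qed simp_all

lemma takes_read_half:
  assumes "length kept = length v"
  shows "takes read_half
    [rev v @ i, ou, m, q, w, w', p, p', f, rev kept, [], n1, n2] (18 * length kept + 2)
    [i, ou, map2 (\<lambda>b a. b \<and> \<not> a) v kept @ m, q, w, w', p, p', f, rev kept, [], n1, n2]"
proof -
  have eq: "rev (map2 (\<lambda>b a. b \<and> \<not> a) (rev v) (rev kept)) = map2 (\<lambda>b a. b \<and> \<not> a) v kept"
    using assms by (simp add: zip_rev rev_map)
  have 1: "takes (While_Scanned 9 bits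
     (Seq (If_Scanned 9 {Some True} (push 2 False) (dup 0 2)) (Seq (pop 0) (shift 9 10))))
    [rev v @ i, ou, m, q, w, w', p, p', f, rev kept, [], n1, n2] (12 * length kept + 1)
    [i, ou, map2 (\<lambda>b a. b \<and> \<not> a) v kept @ m, q, w, w', p, p', f, [], kept, n1, n2]"
    by (rule takes_mono[OF takes_read_half_loop]) (use assms eq in simp_all)
  have 2: "takes (move 10 9)
    [i, ou, map2 (\<lambda>b a. b \<and> \<not> a) v kept @ m, q, w, w', p, p', f, [], kept, n1, n2] (6 * length kept + 1)
    [i, ou, map2 (\<lambda>b a. b \<and> \<not> a) v kept @ m, q, w, w', p, p', f, rev kept, [], n1, n2]"
    by (rule takes_mono[OF takes_move]) simp_all
  show ?thesis unfolding read_half_def by (rule takes_Seq[OF 1 2]) simp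
qed

lemma takes_read_row:
  assumes "length v = 2 * length kept"
  shows "takes (read_row t)
    [rev (encode_pauli (sg, v)) @ i, ou, m, q, w, w', p, p', f, rev kept, [], n1, n2]
    (36 * length kept + 8)
    [i, ou, t # masked kept v @ m, q, w, w', p, p', f, rev kept, [], n1, n2]"
proof -
  let ?l = "length kept"
  define x z where "x = take ?l v" and "z = drop ?l v"
  have v: "v = x @ z" "length x = ?l" "length z = ?l" using assms by (auto simp: x_def z_def)
  let ?f = "\<lambda>v. map2 (\<lambda>b a. b \<and> \<not> a) v kept"
  have 1: "takes read_half
    [rev z @ rev x @ sg # i, ou, m, q, w, w', p, p', f, rev kept, [], n1, n2] (18 * ?l + 2)
    [rev x @ sg # i, ou, ?f z @ m, q, w, w', p, p', f, rev kept, [], n1, n2]"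
    by (rule takes_read_half) (simp add: v)
  have 2: "takes read_half
    [rev x @ sg # i, ou, ?f z @ m, q, w, w', p, p', f, rev kept, [], n1, n2] (18 * ?l + 2)
    [sg # i, ou, ?f x @ ?f z @ m, q, w, w', p, p', f, rev kept, [], n1, n2]"
    by (rule takes_read_half) (simp add: v)
  have 3: "takes (Seq (pop 0) (push 2 t))
    [sg # i, ou, ?f x @ ?f z @ m, q, w, w', p, p', f, rev kept, [], n1, n2] 4
    [i, ou, t # ?f x @ ?f z @ m, q, w, w', p, p', f, rev kept, [], n1, n2]"
    unfolding takes_def by simp
  have "takes (read_row t)
    [rev z @ rev x @ sg # i, ou, m, q, w, w', p, p', f, rev kept, [], n1, n2] (36 * ?l + 8)
    [i, ou, t # ?f x @ ?f z @ m, q, w, w', p, p', f, rev kept, [], n1, n2]"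
    unfolding read_row_def
    by (rule takes_Seq[OF 1 takes_Seq[OF 2 3 order_refl]]) simp
  then show ?thesis
    by (simp add: v masked_def encode_pauli_def)
qed

text \<open>The loop ends when the input is exhausted, so the number of generators need not be
  stored. The induction runs from the right because the last generator lies on top.\<close>

lemma takes_read_rows:
  assumes "\<forall>g\<in>set gs. length (snd g) = 2 * length kept"
  shows "takes (While_Scanned 0 bits (read_row True))
    [rev (concat (map encode_pauli gs)), ou, m, q, w, w', p, p', f, rev kept, [], n1, n2]
    ((36 * length kept + 9) * length gs + 1)
    [[], ou, flat (map (\<lambda>g. (True, masked kept (snd g))) gs) @ m, q, w, w', p, p', f, rev kept, [], n1, n2]"
  using assms
proof (induction gs arbitrary: m rule: rev_induct)
  case Nil
  show ?case by (simp add: takes_While_done)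
next
  case (snoc g gs)
  let ?m = "True # masked kept (snd g) @ m"
  have step: "takes (read_row True)
    [rev (encode_pauli g) @ rev (concat (map encode_pauli gs)), ou, m, q, w, w', p, p', f, rev kept, [], n1, n2]
    (36 * length kept + 8)
    [rev (concat (map encode_pauli gs)), ou, ?m, q, w, w', p, p', f, rev kept, [], n1, n2]"
    using takes_read_row[of "snd g" kept True "fst g"] snoc.prems by simp
  have "takes (While_Scanned 0 bits (read_row True))
    [rev (concat (map encode_pauli gs)), ou, ?m, q, w, w', p, p', f, rev kept, [], n1, n2]
    ((36 * length kept + 9) * length gs + 1)
    [[], ou, flat (map (\<lambda>g. (True, masked kept (snd g))) gs) @ ?m, q, w, w', p, p', f, rev kept, [], n1, n2]"
    by (rule snoc.IH) (use snoc.prems in simp)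
  moreover have "encode_pauli g \<noteq> []" by (simp add: encode_pauli_def)
  ultimately show ?case
    using takes_While_eq[OF step, where V = "(36 * length kept + 9) * length (gs @ [g]) + 1", OF _ _ _ _ refl]
    by (simp add: top_of_bits flat_def algebra_simps del: insert_iff)
qed

text \<open>Initially all heads are on cell \<open>0\<close>, not on cell \<open>-1\<close> as for empty stacks.\<close>

fun lefts :: "nat \<Rightarrow> program" where
  "lefts 0 = Skip"
| "lefts (Suc n) = Seq (lefts n) (Move_Left (Suc n))"

lemma exec_lefts:
  "exec (lefts n) (\<lambda>k. 0, m) (n + 1) (\<lambda>k. if 1 \<le> k \<and> k \<le> n then -1 else 0, m)"
proof (induction n)
  case 0
  have "(\<lambda>k. if 1 \<le> k \<and> k \<le> (0 :: nat) then - 1 else 0 :: int) = (\<lambda>k. 0)" by auto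
  then show ?case using exec.Skip[of "(\<lambda>k. 0, m)"] by simp
next
  case (Suc n)
  have "exec (Move_Left (Suc n)) (\<lambda>k. if 1 \<le> k \<and> k \<le> n then -1 else 0, m) 1
    (\<lambda>k. if 1 \<le> k \<and> k \<le> Suc n then -1 else 0, m)"
    by (rule exec_Move_Left') auto
  from exec.Seq[OF Suc.IH this] show ?case by simp
qed

definition goto_end :: program where
  "goto_end = Seq (While_Scanned 0 bits (Move_Right 0)) (Move_Left 0)"

lemma exec_goto_end:
  "exec goto_end (h(0 := 0), m(0 := tape_of w)) (2 * length w + 2)
    (h(0 := int (length w) - 1), m(0 := tape_of w))"
proof -
  have "exec (While_Scanned 0 bits (Move_Right 0)) (h(0 := int l), m(0 := tape_of w))
      (2 * (length w - l) + 1) (h(0 := int (length w)), m(0 := tape_of w))" if "l \<le> length w" for l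
    using that
  proof (induction "length w - l" arbitrary: l)
    case 0
    then have l: "l = length w" by simp
    have "scanned (h(0 := int (length w)), m(0 := tape_of w)) 0 \<notin> bits"
      by (simp add: scanned_def tape_of_def)
    from exec.While_False[OF this] show ?case
      unfolding l diff_self_eq_0 mult_0_right add_0 .
  next
    case (Suc d)
    have 1: "exec (Move_Right 0) (h(0 := int l), m(0 := tape_of w)) 1
        (h(0 := int (Suc l)), m(0 := tape_of w))"
      by (rule exec_Move_Right') auto
    have 2: "exec (While_Scanned 0 bits (Move_Right 0)) (h(0 := int (Suc l)), m(0 := tape_of w))
        (2 * (length w - Suc l) + 1) (h(0 := int (length w)), m(0 := tape_of w))"
      by (rule Suc.hyps(1)) (use Suc in auto)
    have sc: "scanned (h(0 := int l), m(0 := tape_of w)) 0 \<in> bits"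
      using Suc by (auto simp: scanned_def tape_of_def)
    have "1 + 1 + (2 * (length w - Suc l) + 1) = 2 * (length w - l) + 1"
      using Suc by simp
    with exec.While_True[OF sc 1 2] show ?case by metis
  qed
  from this[of 0] have 1: "exec (While_Scanned 0 bits (Move_Right 0)) (h(0 := 0), m(0 := tape_of w))
      (2 * length w + 1) (h(0 := int (length w)), m(0 := tape_of w))" by simp
  have 2: "exec (Move_Left 0) (h(0 := int (length w)), m(0 := tape_of w)) 1
      (h(0 := int (length w) - 1), m(0 := tape_of w))"
    by (rule exec_Move_Left') auto
  from exec.Seq[OF 1 2] show ?thesis unfolding goto_end_def by simp
qed

text \<open>Twelve heads move to cell \<open>-1\<close> and the input head to its last cell, which
  is the configuration of a list of 13 stacks; all further tapes keep head 0, the default of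
  \<open>stack_config\<close>. The constant 15 consists of 13 for \<open>lefts 12\<close> and 2 from
  \<open>goto_end\<close>.\<close>

lemma computes_in_if_takes:
  assumes "takes p (rev w # replicate 12 []) T s" "s ! 1 = rev r" "1 < length s"
  shows "\<exists>t. computes_in (Seq (lefts 12) (Seq goto_end p)) w r t \<and> t \<le> 2 * length w + 15 + T"
proof -
  define m where "m = (\<lambda>k :: nat. if k = 0 then tape_of w else tape_of [])"
  define h where "h = (\<lambda>k :: nat. if 1 \<le> k \<and> k \<le> 12 then -1 else 0 :: int)"
  have 1: "exec (lefts 12) (\<lambda>k. 0, m) 13 (h, m)"
    using exec_lefts[of 12 m] by (simp add: h_def)
  have "h(0 := 0) = h" "m(0 := tape_of w) = m" by (auto simp: h_def m_def)
  with exec_goto_end[of h m w] have 2: "exec goto_end (h, m) (2 * length w + 2)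
      (h(0 := int (length w) - 1), m)" by simp
  have "(h(0 := int (length w) - 1), m) = stack_config (rev w # replicate 12 [])"
    by (auto simp: stack_config_def h_def m_def fun_eq_iff nth_Cons split: nat.splits)
  with 2 have 2: "exec goto_end (h, m) (2 * length w + 2) (stack_config (rev w # replicate 12 []))"
    by simp
  from assms(1) obtain t where t: "t \<le> T"
    and 3: "exec p (stack_config (rev w # replicate 12 [])) t (stack_config s)"
    unfolding takes_def runs_to_def by blast
  have "exec (Seq (lefts 12) (Seq goto_end p)) (\<lambda>k. 0, m) (13 + (2 * length w + 2 + t)) (stack_config s)"
    by (rule exec.Seq[OF 1 exec.Seq[OF 2 3]])
  moreover have "snd (stack_config s) 1 = tape_of r"
    using assms by (simp add: stack_config_def)
  ultimately have "computes_in (Seq (lefts 12) (Seq goto_end p)) w r (13 + (2 * length w + 2 + t))"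
    unfolding computes_in_def m_def by (metis surjective_pairing)
  with t show ?thesis by (intro exI[of _ "13 + (2 * length w + 2 + t)"] conjI) simp_all
qed

section \<open>Writing the output\<close>

text \<open>The exponent \<open>k\<close> is stored twice, once for each multiplicity that may be
  written; the flag stack is reused for \<open>c\<close>.\<close>

definition count_tags :: program where
  "count_tags = While_Scanned 2 bits (If_Scanned 2 {Some True}
     (Seq (pop 2) (Seq (push 5 True) (push 6 True))) (Seq (pop 2) (push 8 True)))"

lemma takes_count_tags:
  "takes count_tags
    [i, ou, replicate a True @ replicate c False, q, w, w', p, p', f, k, k', n1, n2] (8 * (a + c) + 1)
    [i, ou, [], q, w, replicate a True @ w', replicate a True @ p, p', replicate c True @ f, k, k', n1, n2]"
proof (induction a arbitrary: w' p)
  case 0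
  show ?case
  proof (induction c arbitrary: f)
    case 0
    show ?case unfolding count_tags_def by (simp add: takes_While_done)
  next
    case (Suc c)
    have step: "takes (If_Scanned 2 {Some True}
        (Seq (pop 2) (Seq (push 5 True) (push 6 True))) (Seq (pop 2) (push 8 True)))
      [i, ou, replicate 0 True @ replicate (Suc c) False, q, w, w', p, p', f, k, k', n1, n2] 7
      [i, ou, replicate 0 True @ replicate c False, q, w, w', p, p', True # f, k, k', n1, n2]"
      unfolding takes_def by simp
    show ?case unfolding count_tags_def
      by (rule takes_While_eq[OF step Suc.IH[unfolded count_tags_def]])
        (simp_all add: replicate_app_Cons_same)
  qed
next
  case (Suc a)
  have step: "takes (If_Scanned 2 {Some True}
      (Seq (pop 2) (Seq (push 5 True) (push 6 True))) (Seq (pop 2) (push 8 True)))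
    [i, ou, replicate (Suc a) True @ replicate c False, q, w, w', p, p', f, k, k', n1, n2] 7
    [i, ou, replicate a True @ replicate c False, q, w, True # w', True # p, p', f, k, k', n1, n2]"
    unfolding takes_def by simp
  show ?case unfolding count_tags_def
    by (rule takes_While_eq[OF step Suc.IH[unfolded count_tags_def]])
      (simp_all add: replicate_app_Cons_same)
qed

fun emit :: "bool list \<Rightarrow> program" where
  "emit [] = Skip"
| "emit (b # bs) = Seq (push 1 b) (emit bs)"

lemma takes_emit:
  "1 < length s \<Longrightarrow> takes (emit bs) s (2 * length bs + 1) (s[1 := rev bs @ s ! 1])"
proof (induction bs arbitrary: s)
  case Nil
  then show ?case by (simp add: takes_def)
next
  case (Cons b bs)
  then show ?case
    using takes_Seq_eq[OF takes_push[of 1 s b] refl Cons.IH] by simp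
qed

text \<open>The digits of \<open>2 ^ n\<close> are \<open>n\<close> zeros and a one, so each mark of
  a unary exponent becomes one encoded zero digit and no arithmetic takes place. The offset
  \<open>e\<close> sits in the constant tail.\<close>

definition emit_power :: "nat \<Rightarrow> nat \<Rightarrow> program" where
  "emit_power k e = Seq (While_Scanned k bits (Seq (pop k) (emit [True, False])))
     (emit (encode_nat (2 ^ e)))"

lemma digits_power: "digits (2 ^ n) = replicate n False @ [True]"
proof (induction n)
  case 0
  show ?case by (simp add: digits.simps[of "Suc 0"] digits.simps[of 0])
next
  case (Suc n)
  then show ?case by (simp add: digits.simps[of "2 * _"])
qed

lemma encode_nat_power:
  "encode_nat (2 ^ n) = concat (replicate n [True, False]) @ [True, True, False]"
  by (simp add: encode_nat_def encode_list_def digits_power)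

lemma encode_nat_power_add:
  "encode_nat (2 ^ (n + e)) = concat (replicate n [True, False]) @ encode_nat (2 ^ e)"
  by (simp add: encode_nat_power replicate_add)

lemma takes_emit_power:
  assumes "k < length s" "1 < length s" "k \<noteq> 1" "s ! k = replicate n True"
  shows "takes (emit_power k e) s (8 * n + 2 * length (encode_nat (2 ^ e)) + 2)
    (s[k := [], 1 := rev (encode_nat (2 ^ (n + e))) @ s ! 1])"
proof -
  have "takes (While_Scanned k bits (Seq (pop k) (emit [True, False]))) s (8 * n + 1)
    (s[k := [], 1 := rev (concat (replicate n [True, False])) @ s ! 1])"
    using assms
  proof (induction n arbitrary: s)
    case 0
    then have "s[k := [], 1 := s ! 1] = s" by (metis list_update_id replicate_0)
    with 0 show ?case by (simp add: takes_While_done)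
  next
    case (Suc n)
    have step: "takes (Seq (pop k) (emit [True, False])) s 7
      (s[k := replicate n True, 1 := [False, True] @ s ! 1])"
      using Suc.prems unfolding takes_def by simp
    have "takes (While_Scanned k bits (Seq (pop k) (emit [True, False])))
      (s[k := replicate n True, 1 := [False, True] @ s ! 1]) (8 * n + 1)
      (s[k := [], 1 := rev (concat (replicate n [True, False])) @ [False, True] @ s ! 1])"
      using Suc.IH[of "s[k := replicate n True, 1 := [False, True] @ s ! 1]"] Suc.prems
      by (simp add: list_update_swap[of k "Suc 0"])
    from takes_While_eq[OF step this] show ?case
      using Suc.prems by simp
  qed
  from takes_Seq_eq[OF this refl takes_emit[of _ "encode_nat (2 ^ e)"]] show ?thesis
    using assms unfolding emit_power_def by (simp add: encode_nat_power_add)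
qed

definition emit_item :: "nat \<Rightarrow> nat \<Rightarrow> nat \<Rightarrow> nat \<Rightarrow> program" where
  "emit_item j d k e = Seq (emit (True # False # encode_nat 1)) (Seq (emit_power j d) (emit_power k e))"

text \<open>The tests on stack 8 distinguish the values of \<open>c\<close>. The pair written first
  represents robustness 1 or \<open>sqrt 2\<close>, and the last rational is
  \<open>(1 + c / 4) / (1 + c / 2)\<close>. The multiplicity \<open>c * 2 ^ k\<close> is
  \<open>2 ^ k\<close> for \<open>c = 1\<close> and \<open>2 ^ (k + 1)\<close> for
  \<open>c = 2\<close>.\<close>

definition write_output :: program where
  "write_output = If_Scanned 8 bits
     (Seq (pop 8) (If_Scanned 8 bits
       (Seq (emit (encode_rat 0 @ encode_rat 1)) (Seq (emit_item 11 0 5 0)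
         (Seq (emit_item 12 1 6 1) (emit (False # encode_rat (3 / 4))))))
       (Seq (emit (encode_rat 1 @ encode_rat 0)) (Seq (emit_item 11 0 5 0)
         (Seq (emit_item 12 1 6 0) (emit (False # encode_rat (5 / 6))))))))
     (Seq (emit (encode_rat 1 @ encode_rat 0)) (Seq (emit_item 11 0 5 0) (emit (False # encode_rat 1))))"

definition spectrum_output :: "nat \<Rightarrow> nat \<Rightarrow> nat \<Rightarrow> (rat \<times> nat) list" where
  "spectrum_output n k c =
     (1 / 2 ^ n, 2 ^ k) # (if c = 0 then [] else [(1 / 2 ^ Suc n, c * 2 ^ k)])"

definition output_bits :: "nat \<Rightarrow> nat \<Rightarrow> nat \<Rightarrow> bool list" where
  "output_bits n k c = encode_output (if c = 2 then 0 else 1) (if c = 2 then 1 else 0)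
     (spectrum_output n k c) (if c = 0 then 1 else if c = 1 then 5 / 6 else 3 / 4)"

text \<open>Independent of the input, and left symbolic because only its being constant matters for
  the cubic bound.\<close>

definition output_cost :: nat where
  "output_cost = 100 + 10 * (length (encode_rat 0) + length (encode_rat 1) + length (encode_rat (3 / 4)) +
     length (encode_rat (5 / 6)) + length (encode_nat 1) + length (encode_nat 2))"

lemma encode_rat_power: "encode_rat (1 / 2 ^ n) = False # encode_nat 1 @ encode_nat (2 ^ n)"
proof -
  have "(1 / 2 ^ n :: rat) = Fract 1 (2 ^ n)"
    by (simp add: Fract_of_int_quotient)
  then have "quotient_of (1 / 2 ^ n) = (1, 2 ^ n)"
    by (simp add: quotient_of_Fract normalize_def Let_def)
  then show ?thesis
    by (simp add: encode_rat_def nat_power_eq)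
qed

lemma takes_emit_item:
  assumes "j < length s" "k < length s" "1 < length s" "distinct [1, j, k]"
    and "s ! j = replicate n True" "s ! k = replicate l True"
    and "r = s[j := [], k := [], 1 := rev (True # False # encode_nat 1 @ encode_nat (2 ^ (n + d)) @
      encode_nat (2 ^ (l + e))) @ s ! 1]"
  shows "takes (emit_item j d k e) s (8 * n + 8 * l + 2 * length (encode_nat 1) +
    2 * length (encode_nat (2 ^ d)) + 2 * length (encode_nat (2 ^ e)) + 9) r"
proof -
  let ?h = "True # False # encode_nat 1"
  let ?s1 = "s[1 := rev ?h @ s ! 1]"
  let ?s2 = "?s1[j := [], 1 := rev (encode_nat (2 ^ (n + d))) @ ?s1 ! 1]"
  have 1: "takes (emit ?h) s (2 * length ?h + 1) ?s1"
    by (rule takes_emit) (use assms in simp)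
  have 2: "takes (emit_power j d) ?s1 (8 * n + 2 * length (encode_nat (2 ^ d)) + 2) ?s2"
    by (rule takes_emit_power) (use assms in auto)
  have 3: "takes (emit_power k e) ?s2 (8 * l + 2 * length (encode_nat (2 ^ e)) + 2)
    (?s2[k := [], 1 := rev (encode_nat (2 ^ (l + e))) @ ?s2 ! 1])"
    by (rule takes_emit_power) (use assms in auto)
  have "?s2[k := [], 1 := rev (encode_nat (2 ^ (l + e))) @ ?s2 ! 1] = r"
    using assms by (auto intro!: nth_equalityI simp: nth_list_update)
  from takes_mono[OF takes_Seq[OF 1 takes_Seq[OF 2 3 order_refl] order_refl] _ this] show ?thesis
    unfolding emit_item_def by simp
qed

lemma takes_write_output:
  assumes "c \<le> 2"
  shows "\<exists>s. length s = 13 \<and> s ! 1 = rev (output_bits n k c) \<and> takes write_output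
    [i, [], m, q, w, replicate k True, replicate k True, p', replicate c True, kk, kk',
     replicate n True, replicate n True] (16 * n + 16 * k + output_cost) s"
proof -
  let ?st = "\<lambda>ou w' p f n1 n2. [i, ou, m, q, w, w', p, p', f, kk, kk', n1, n2]"
  let ?K = "replicate k True" and ?N = "replicate n True"
  let ?it = "\<lambda>d e. True # False # encode_nat 1 @ encode_nat (2 ^ (n + d)) @ encode_nat (2 ^ (k + e))"
  have emit: "takes (emit bs) (?st ou w' p f n1 n2) (2 * length bs + 1) (?st (rev bs @ ou) w' p f n1 n2)"
    for bs ou w' p f n1 n2
    by (rule takes_mono[OF takes_emit]) simp_all
  have item1: "takes (emit_item 11 0 5 0) (?st ou ?K p f ?N n2)
      (8 * n + 8 * k + 6 * length (encode_nat 1) + 9) (?st (rev (?it 0 0) @ ou) [] p f [] n2)" for ou p f n2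
    by (rule takes_mono[OF takes_emit_item[where n = n and l = k]]) simp_all
  have item2: "takes (emit_item 12 1 6 e) (?st ou w' ?K f n1 ?N)
      (8 * n + 8 * k + 2 * length (encode_nat 1) + 2 * length (encode_nat 2) +
        2 * length (encode_nat (2 ^ e)) + 9)
      (?st (rev (?it 1 e) @ ou) w' [] f n1 [])" for ou w' f n1 e
    by (rule takes_mono[OF takes_emit_item[where n = n and l = k]]) simp_all
  have rat1: "encode_rat (1 / (2 * 2 ^ n)) = False # encode_nat 1 @ encode_nat (2 * 2 ^ n)"
    using encode_rat_power[of "Suc n"] by simp
  have fin: ?thesis if "takes write_output (?st [] ?K ?K f ?N ?N) (16 * n + 16 * k + output_cost) s"
    "f = replicate c True" "length s = 13" "s ! 1 = rev (output_bits n k c)" for f s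
    using that by blast
  consider "c = 0" | "c = 1" | "c = 2" using assms by linarith
  then show ?thesis
  proof cases
    case 1
    have "takes (Seq (emit (encode_rat 1 @ encode_rat 0)) (Seq (emit_item 11 0 5 0) (emit (False # encode_rat 1))))
      (?st [] ?K ?K [] ?N ?N) (16 * n + 16 * k + output_cost - 1)
      (?st (rev (output_bits n k c)) [] ?K [] [] ?N)"
      by (rule takes_Seq_eq[OF emit refl takes_Seq[OF item1 emit order_refl]])
        (simp_all add: 1 output_cost_def output_bits_def encode_output_def encode_list_def
          spectrum_output_def encode_rat_power)
    then have "takes write_output (?st [] ?K ?K [] ?N ?N) (16 * n + 16 * k + output_cost)
      (?st (rev (output_bits n k c)) [] ?K [] [] ?N)"
      unfolding write_output_def takes_def[of _ _ "16 * n + 16 * k + output_cost"]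
      by (simp add: runs_to_takes output_cost_def)
    from fin[OF this] 1 show ?thesis by simp
  next
    case 2
    have "takes (Seq (emit (encode_rat 1 @ encode_rat 0)) (Seq (emit_item 11 0 5 0)
         (Seq (emit_item 12 1 6 0) (emit (False # encode_rat (5 / 6))))))
      (?st [] ?K ?K [] ?N ?N) (16 * n + 16 * k + output_cost - 4)
      (?st (rev (output_bits n k c)) [] [] [] [] [])"
      by (rule takes_Seq_eq[OF emit refl takes_Seq[OF item1 takes_Seq[OF item2 emit order_refl] order_refl]])
        (simp_all add: 2 output_cost_def output_bits_def encode_output_def encode_list_def
          spectrum_output_def encode_rat_power rat1)
    then have "takes write_output (?st [] ?K ?K [True] ?N ?N) (16 * n + 16 * k + output_cost)
      (?st (rev (output_bits n k c)) [] [] [] [] [])"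
      unfolding write_output_def takes_def[of _ _ "16 * n + 16 * k + output_cost"]
      by (simp add: runs_to_takes output_cost_def)
    from fin[OF this] 2 show ?thesis by simp
  next
    case 3
    have "takes (Seq (emit (encode_rat 0 @ encode_rat 1)) (Seq (emit_item 11 0 5 0)
         (Seq (emit_item 12 1 6 1) (emit (False # encode_rat (3 / 4))))))
      (?st [] ?K ?K [True] ?N ?N) (16 * n + 16 * k + output_cost - 4)
      (?st (rev (output_bits n k c)) [] [] [True] [] [])"
      by (rule takes_Seq_eq[OF emit refl takes_Seq[OF item1 takes_Seq[OF item2 emit order_refl] order_refl]])
        (simp_all add: 3 output_cost_def output_bits_def encode_output_def encode_list_def
          spectrum_output_def encode_rat_power rat1)
    then have "takes write_output (?st [] ?K ?K [True, True] ?N ?N) (16 * n + 16 * k + output_cost)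
      (?st (rev (output_bits n k c)) [] [] [True] [] [])"
      unfolding write_output_def takes_def[of _ _ "16 * n + 16 * k + output_cost"]
      by (simp add: runs_to_takes output_cost_def)
    from fin[OF this] 3 show ?thesis by (simp add: numeral_2_eq_2)
  qed
qed

definition algorithm :: program where
  "algorithm = Seq (lefts 12) (Seq goto_end
     (Seq (move 0 2) (Seq read_size (Seq (pop 2) (Seq read_mask (Seq (move 2 0)
     (Seq (read_row False) (Seq (read_row False) (Seq (While_Scanned 0 bits (read_row True))
     (Seq all_rounds (Seq count_tags write_output)))))))))))"

text \<open>With base \<open>L + 2\<close> instead of \<open>L\<close> the cube dominates constants
  and terms such as \<open>L + 1\<close>.\<close>

definition running_time :: "nat \<Rightarrow> nat" where
  "running_time L = (1000 + output_cost) * (L + 2) ^ 3"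

lemma length_masked [simp]: "length (masked kept v) = min (length v) (2 * length kept)"
  by (simp add: masked_def)

lemma algorithm_computes:
  fixes gs :: "pauli list" and L :: nat and A :: "nat set"
  defines "K \<equiv> map (\<lambda>k. k \<in> A) [0..<L]"
  defines "mrows \<equiv> map (\<lambda>g. masked K (snd (g :: pauli)))"
  assumes L: "1 \<le> L" "length gs = L - 1" "A \<subseteq> {0..<L}"
    and len: "\<forall>g\<in>set (gs @ [zb, yb]). length (snd g) = 2 * L"
    and elim: "eliminate (2 * L) (tagged (mrows gs) (mrows [zb, yb])) =
      replicate k (True, []) @ replicate c (False, [])"
    and k: "k \<le> L" and c: "c \<le> 2"
  shows "\<exists>t. computes_in algorithm (encode_input L gs zb yb A) (output_bits (card A) k c) t \<and>
    t \<le> running_time L"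
proof -
  let ?w = "encode_input L gs zb yb A"
  let ?rs = "concat (map encode_pauli gs) @ encode_pauli zb @ encode_pauli yb"
  let ?R = "tagged (mrows gs) (mrows [zb, yb])"
  let ?T = "\<lambda>n. replicate n True"
  have lenK [simp]: "length K = L" by (simp add: K_def)
  have filt: "length (filter id K) = card A"
  proof -
    have "length (filter id K) = card ((\<lambda>k. k) ` {k. k < L \<and> K ! k})"
      by (simp add: length_filter_conv_card)
    also have "{k. k < L \<and> K ! k} = A" using L(3) by (auto simp: K_def)
    finally show ?thesis by (simp add: id_def)
  qed
  have w: "?w = ?T L @ False # K @ ?rs" by (simp add: encode_input_def K_def)
  have rs: "length ?rs = (L + 1) * (2 * L + 1)"
  proof -
    have "\<forall>g\<in>set gs. length (encode_pauli g) = 2 * L + 1"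
      using len by (simp add: encode_pauli_def)
    then have "length (concat (map encode_pauli gs)) = length gs * (2 * L + 1)"
      by (induction gs) auto
    moreover obtain l where "L = Suc l" using L(1) by (cases L) auto
    ultimately show ?thesis using len L(2) by (simp add: encode_pauli_def)
  qed
  have lw: "length ?w = 2 * L + 1 + (L + 1) * (2 * L + 1)"
    using w rs by simp
  let ?s0 = "rev ?w # replicate 12 []"
  have s0: "?s0 = [rev ?w, [], [], [], [], [], [], [], [], [], [], [], []]"
    by (simp add: numeral_eq_Suc)
  have 1: "takes (move 0 2) ?s0 (6 * length ?w + 1)
    [[], [], ?T L @ False # K @ ?rs, [], [], [], [], [], [], [], [], [], []]"
    unfolding s0 by (rule takes_mono[OF takes_move]) (simp_all add: w)
  have 2: "takes read_size [[], [], ?T L @ False # K @ ?rs, [], [], [], [], [], [], [], [], [], []] (9 * L + 1)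
    [[], [], False # K @ ?rs, [], ?T (2 * L), [], ?T L, [], [], [], [], [], []]"
    by (rule takes_mono[OF takes_read_size]) simp_all
  have 3: "takes (pop 2) [[], [], False # K @ ?rs, [], ?T (2 * L), [], ?T L, [], [], [], [], [], []] 2
    [[], [], K @ ?rs, [], ?T (2 * L), [], ?T L, [], [], [], [], [], []]"
    by (rule takes_mono[OF takes_pop]) simp_all
  have 4: "takes read_mask [[], [], K @ ?rs, [], ?T (2 * L), [], ?T L, [], [], [], [], [], []] (13 * L + 1)
    [[], [], ?rs, [], ?T (2 * L), [], [], [], [], rev K, [], ?T (card A), ?T (card A)]"
    by (rule takes_mono[OF takes_read_mask[of _ _ K, unfolded lenK]]) (simp_all add: filt)
  have 5: "takes (move 2 0) [[], [], ?rs, [], ?T (2 * L), [], [], [], [], rev K, [], ?T (card A), ?T (card A)]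
    (6 * length ?rs + 1)
    [rev ?rs, [], [], [], ?T (2 * L), [], [], [], [], rev K, [], ?T (card A), ?T (card A)]"
    by (rule takes_mono[OF takes_move]) simp_all
  have 6: "takes (read_row False)
    [rev ?rs, [], [], [], ?T (2 * L), [], [], [], [], rev K, [], ?T (card A), ?T (card A)] (36 * L + 8)
    [rev (concat (map encode_pauli gs) @ encode_pauli zb), [], False # masked K (snd yb), [], ?T (2 * L),
     [], [], [], [], rev K, [], ?T (card A), ?T (card A)]"
    using takes_read_row[of "snd yb" K False "fst yb" _ "[]" "[]"] len by simp
  have 7: "takes (read_row False)
    [rev (concat (map encode_pauli gs) @ encode_pauli zb), [], False # masked K (snd yb), [], ?T (2 * L),
     [], [], [], [], rev K, [], ?T (card A), ?T (card A)] (36 * L + 8)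
    [rev (concat (map encode_pauli gs)), [], flat [(False, masked K (snd zb)), (False, masked K (snd yb))],
     [], ?T (2 * L), [], [], [], [], rev K, [], ?T (card A), ?T (card A)]"
    using takes_read_row[of "snd zb" K False "fst zb"] len by simp
  have flat: "flat (map (\<lambda>g. (True, masked K (snd g))) gs) @
      flat [(False, masked K (snd zb)), (False, masked K (snd yb))] = flat ?R"
    by (simp add: tagged_def mrows_def flat_def comp_def)
  have 8: "takes (While_Scanned 0 bits (read_row True))
    [rev (concat (map encode_pauli gs)), [], flat [(False, masked K (snd zb)), (False, masked K (snd yb))],
     [], ?T (2 * L), [], [], [], [], rev K, [], ?T (card A), ?T (card A)]
    ((36 * L + 9) * length gs + 1)
    [[], [], flat ?R, [], ?T (2 * L), [], [], [], [], rev K, [], ?T (card A), ?T (card A)]"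
    by (rule takes_mono[OF takes_read_rows[of _ K]]) (use len flat in simp_all)
  have 9: "takes all_rounds
    [[], [], flat ?R, [], ?T (2 * L), [], [], [], [], rev K, [], ?T (card A), ?T (card A)]
    (43 * (2 * L) * (2 * L + 1) * (L + 2) + 1)
    [[], [], ?T k @ replicate c False, [], [], [], [], [], [], rev K, [], ?T (card A), ?T (card A)]"
  proof (rule takes_mono[OF takes_all_rounds])
    show "\<forall>r\<in>set ?R. length (snd r) = 2 * L"
      using len by (auto simp: tagged_def mrows_def)
    have "length ?R = L + 1" using L by (simp add: tagged_def mrows_def)
    then show "43 * (2 * L) * (2 * L + 1) * (length ?R + 1) + 1 \<le> 43 * (2 * L) * (2 * L + 1) * (L + 2) + 1"
      by simp
    have flat_empty: "flat (replicate j (b, [])) = replicate j b" for j b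
      by (induction j) auto
    have "flat (eliminate (2 * L) ?R) = ?T k @ replicate c False"
      unfolding elim by (simp add: flat_empty[symmetric]) (simp add: flat_def)
    then show "[[], [], flat (eliminate (2 * L) ?R), [], [], [], [], [], [], rev K, [], ?T (card A), ?T (card A)] =
      [[], [], ?T k @ replicate c False, [], [], [], [], [], [], rev K, [], ?T (card A), ?T (card A)]" by simp
  qed
  have 10: "takes count_tags
    [[], [], ?T k @ replicate c False, [], [], [], [], [], [], rev K, [], ?T (card A), ?T (card A)] (8 * (k + c) + 1)
    [[], [], [], [], [], ?T k, ?T k, [], ?T c, rev K, [], ?T (card A), ?T (card A)]"
    by (rule takes_mono[OF takes_count_tags]) simp_all
  obtain s where s: "length s = 13" "s ! 1 = rev (output_bits (card A) k c)" and
    11: "takes write_output [[], [], [], [], [], ?T k, ?T k, [], ?T c, rev K, [], ?T (card A), ?T (card A)]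
      (16 * card A + 16 * k + output_cost) s"
    using takes_write_output[OF c, of "card A" k "[]" "[]" "[]" "[]" "[]" "rev K" "[]"] by blast
  note main = takes_Seq[OF 1 takes_Seq[OF 2 takes_Seq[OF 3 takes_Seq[OF 4 takes_Seq[OF 5
    takes_Seq[OF 6 takes_Seq[OF 7 takes_Seq[OF 8 takes_Seq[OF 9 takes_Seq[OF 10 11 order_refl]
    order_refl] order_refl] order_refl] order_refl] order_refl] order_refl] order_refl] order_refl] order_refl]
  from computes_in_if_takes[OF main s(2)] s(1) obtain t where
    t: "computes_in algorithm ?w (output_bits (card A) k c) t"
    and time: "t \<le> 2 * length ?w + 15 + (6 * length ?w + 1 + (9 * L + 1 + (2 + (13 * L + 1 +
      (6 * length ?rs + 1 + (36 * L + 8 + (36 * L + 8 + ((36 * L + 9) * length gs + 1 +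
      (43 * (2 * L) * (2 * L + 1) * (L + 2) + 1 + (8 * (k + c) + 1 +
      (16 * card A + 16 * k + output_cost)))))))))))"
    unfolding algorithm_def by auto
  have cA: "card A \<le> L" using card_mono[OF _ L(3)] by simp
  \<comment> \<open>Every factor in the time bound is at most a constant multiple of
    \<open>x\<close>, so each summand can be bounded separately by a multiple of
    \<open>x ^ 3\<close>.\<close>
  define x where "x = L + 2"
  have bounds: "L \<le> x" "2 * L + 1 \<le> 2 * x" "length gs \<le> x" "k \<le> x" "c \<le> x" "card A \<le> x"
    "L + 1 \<le> x" "1 \<le> x" "L + 2 \<le> x"
    using L k c cA by (auto simp: x_def)
  have sq: "x \<le> x ^ 3" "x ^ 2 \<le> x ^ 3" "1 \<le> x ^ 3"
    using bounds(8) by (auto simp: power_increasing self_le_power)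
  have "(L + 1) * (2 * L + 1) \<le> x * (2 * x)" by (intro mult_mono) (use bounds in auto)
  then have b1: "(L + 1) * (2 * L + 1) \<le> 2 * x ^ 3"
    using sq(2) by (simp add: power2_eq_square)
  have "(36 * L + 9) * length gs \<le> (45 * x) * x" by (intro mult_mono) (use bounds in auto)
  then have b2: "(36 * L + 9) * length gs \<le> 45 * x ^ 3"
    using sq(2) by (simp add: power2_eq_square)
  have "43 * (2 * L) * (2 * L + 1) * (L + 2) \<le> 86 * x * (2 * x) * x"
    by (intro mult_mono[of "43 * (2 * L) * (2 * L + 1)" "86 * x * (2 * x)"]
        mult_mono[of "43 * (2 * L)" "86 * x"]) (use bounds in auto)
  then have b3: "43 * (2 * L) * (2 * L + 1) * (L + 2) \<le> 172 * x ^ 3"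
    by (simp add: power3_eq_cube)
  have b4: "output_cost \<le> output_cost * x ^ 3" using sq(3) by simp
  have b5: "L \<le> x ^ 3" "k \<le> x ^ 3" "c \<le> x ^ 3" "card A \<le> x ^ 3" using bounds sq(1) by linarith+
  \<comment> \<open>Naming the nonlinear products makes the remaining estimate linear.\<close>
  obtain a b d where abd: "a = (L + 1) * (2 * L + 1)" "b = (36 * L + 9) * length gs"
    "d = 43 * (2 * L) * (2 * L + 1) * (L + 2)" by blast
  have "t \<le> 110 * L + 14 * a + b + d + 24 * k + 8 * c + 16 * card A + output_cost + 48"
    using time unfolding lw rs abd[symmetric] by simp
  also have "\<dots> \<le> 110 * x ^ 3 + 14 * (2 * x ^ 3) + 45 * x ^ 3 + 172 * x ^ 3 + 24 * x ^ 3 + 8 * x ^ 3 +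
      16 * x ^ 3 + output_cost * x ^ 3 + 48 * x ^ 3"
    by (intro add_mono mult_left_mono)
      (use b1 b2 b3 b4 b5 sq(3) in \<open>unfold abd[symmetric], simp_all\<close>)
  also have "\<dots> \<le> 1000 * x ^ 3 + output_cost * x ^ 3" by simp
  finally have "t \<le> 1000 * x ^ 3 + output_cost * x ^ 3" .
  then have "t \<le> (1000 + output_cost) * x ^ 3" by (simp add: add_mult_distrib)
  with t show ?thesis unfolding running_time_def x_def by blast
qed

text \<open>For \<open>1 \<le> L\<close> one has \<open>L + 2 \<le> 3 * L\<close>, whence the factor
  27.\<close>

lemma running_time_cubic: "(\<lambda>L. real (running_time L)) \<in> O(\<lambda>L. real L ^ 3)"
proof (rule bigoI)
  show "\<forall>\<^sub>F L in at_top. norm (real (running_time L)) \<le> (1000 + real output_cost) * 27 * norm (real L ^ 3)"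
    using eventually_ge_at_top[of 1]
  proof eventually_elim
    case (elim L)
    then have "real (L + 2) ^ 3 \<le> (3 * real L) ^ 3" by (intro power_mono) auto
    then have "(1000 + real output_cost) * real (L + 2) ^ 3 \<le> (1000 + real output_cost) * (27 * real L ^ 3)"
      by (intro mult_left_mono) (auto simp: power_mult_distrib)
    also have "\<dots> = (1000 + real output_cost) * 27 * norm (real L ^ 3)" by simp
    finally show ?case by (simp only: running_time_def of_nat_mult of_nat_power of_nat_add
        of_nat_numeral real_norm_def abs_of_nonneg of_nat_0_le_iff mult_nonneg_nonneg norm_of_nat
        abs_mult abs_power2 power_abs)
  qed
qed

section \<open>Pauli operators as binary vectors with phases, and the abelian groups they
  form\<close>

section \<open>The algebra of Pauli strings\<close>

definition pauli_entry :: "bool \<Rightarrow> bool \<Rightarrow> bool \<Rightarrow> bool \<Rightarrow> complex" where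
  "pauli_entry x z a b =
    (if x then if a = b then 0 else if z then if a then \<i> else - \<i> else 1
     else if a \<noteq> b then 0 else if z \<and> a then -1 else 1)"

text \<open>The scalar in the product of two single-qubit Pauli matrices: \<open>\<i>\<close> for
  the cyclic products XY, YZ and ZX, \<open>- \<i>\<close> for the reversed ones, and 1 if the
  factors commute.\<close>

definition phase1 :: "bool \<Rightarrow> bool \<Rightarrow> bool \<Rightarrow> bool \<Rightarrow> complex" where
  "phase1 x z x' z' = (if (x \<and> z') = (z \<and> x') then 1
    else if (x \<and> \<not> z \<and> x' \<and> z') \<or> (x \<and> z \<and> \<not> x' \<and> z') \<or> (\<not> x \<and> z \<and> x' \<and> \<not> z') then \<i> else - \<i>)"

text \<open>The sign given by the symplectic form on one qubit.\<close>

definition comm1 :: "bool \<Rightarrow> bool \<Rightarrow> bool \<Rightarrow> bool \<Rightarrow> complex" where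
  "comm1 x z x' z' = (if (x \<and> z') = (z \<and> x') then 1 else -1)"

definition phase :: "nat \<Rightarrow> bool list \<Rightarrow> bool list \<Rightarrow> complex" where
  "phase n v w = (\<Prod>k<n. phase1 (v ! k) (v ! (n + k)) (w ! k) (w ! (n + k)))"

definition comm_sign :: "nat \<Rightarrow> bool list \<Rightarrow> bool list \<Rightarrow> complex" where
  "comm_sign n v w = (\<Prod>k<n. comm1 (v ! k) (v ! (n + k)) (w ! k) (w ! (n + k)))"

text \<open>Arbitrary complex scalars make these operators closed under products, so that a phase
  has to be recognised as a sign only where Hermitian operators are concerned.\<close>

definition scaled_pauli :: "nat \<Rightarrow> bool list \<Rightarrow> complex \<Rightarrow> complex mat" where
  "scaled_pauli n v c = c \<cdot>\<^sub>m pauli_string n v"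

lemma pauli_matrix_entry: "pauli_matrix x z $$ (of_bool a, of_bool b) = pauli_entry x z a b"
  by (cases x; cases z; cases a; cases b)
    (simp_all add: pauli_matrix_def pauli_entry_def mat_of_rows_list_def)

lemma pauli_string_entry:
  "i < 2 ^ n \<Longrightarrow> j < 2 ^ n \<Longrightarrow>
    pauli_string n v $$ (i, j) = (\<Prod>k<n. pauli_entry (v ! k) (v ! (n + k)) (bit i k) (bit j k))"
  by (simp add: pauli_string_def pauli_matrix_entry)

lemma pauli_string_carrier [simp]: "pauli_string n v \<in> carrier_mat (2 ^ n) (2 ^ n)"
  by (simp add: pauli_string_def)

lemma scaled_pauli_carrier [simp]: "scaled_pauli n v c \<in> carrier_mat (2 ^ n) (2 ^ n)"
  by (simp add: scaled_pauli_def)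

lemma scaled_pauli_dim [simp]:
  "dim_row (scaled_pauli n v c) = 2 ^ n" "dim_col (scaled_pauli n v c) = 2 ^ n"
  by (simp_all add: scaled_pauli_def pauli_string_def)

lemma pauli_string_dim [simp]:
  "dim_row (pauli_string n v) = 2 ^ n" "dim_col (pauli_string n v) = 2 ^ n"
  by (simp_all add: pauli_string_def)

lemma sum_lessThan_double:
  fixes f :: "nat \<Rightarrow> 'a :: comm_monoid_add"
  shows "(\<Sum>m<2 * d. f m) = (\<Sum>m<d. f m) + (\<Sum>m<d. f (d + m))"
proof -
  have u: "{..<2 * d} = {..<d} \<union> {d..<2 * d}" by auto
  have "sum f {..<2 * d} = sum f {..<d} + sum f {d..<2 * d}"
    unfolding u by (rule sum.union_disjoint) auto
  moreover have "sum f {d..<2 * d} = sum (\<lambda>m. f (m + d)) {0..<d}"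
    using sum.shift_bounds_nat_ivl[of f 0 d d] by (simp add: mult_2)
  ultimately show ?thesis by (simp add: atLeast0LessThan add.commute)
qed

lemma bit_add_power:
  assumes "m < 2 ^ n" "k < n"
  shows "bit (2 ^ n + m) k \<longleftrightarrow> bit (m :: nat) k"
proof -
  have "(2 ^ n + m) mod 2 ^ n = m" using assms by simp
  then have "take_bit n (2 ^ n + m) = m" by (simp add: take_bit_eq_mod)
  then show ?thesis using assms(2) by (metis bit_take_bit_iff)
qed

lemma bit_power_top:
  assumes "m < 2 ^ n"
  shows "\<not> bit (m :: nat) n" "bit (2 ^ n + m) n"
proof -
  show "\<not> bit m n" using assms unfolding bit_iff_odd by simp
  have "(2 ^ n + m) div 2 ^ n = 1" using assms by (simp add: div_add1_eq)
  then show "bit (2 ^ n + m) n" unfolding bit_iff_odd by simp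
qed

text \<open>A basis index is a string of bits, so summing a product over all indices factors qubit
  by qubit. Products, traces and partial traces of Pauli strings are reduced to single-qubit
  identities in this way, in place of a calculus of tensor products.\<close>

lemma sum_prod_bits:
  fixes F :: "nat \<Rightarrow> bool \<Rightarrow> 'a :: comm_semiring_1"
  shows "(\<Sum>m<(2 :: nat) ^ n. \<Prod>k<n. F k (bit m k)) = (\<Prod>k<n. F k False + F k True)"
proof (induction n)
  case (Suc n)
  have "(\<Sum>m<(2 :: nat) ^ Suc n. \<Prod>k<Suc n. F k (bit m k)) =
      (\<Sum>m<(2 :: nat) ^ n. (\<Prod>k<n. F k (bit m k)) * F n (bit m n)) +
      (\<Sum>m<(2 :: nat) ^ n. (\<Prod>k<n. F k (bit (2 ^ n + m) k)) * F n (bit (2 ^ n + m) n))"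
    by (simp add: sum_lessThan_double)
  also have "\<dots> = (\<Sum>m<(2 :: nat) ^ n. (\<Prod>k<n. F k (bit m k)) * F n False) +
      (\<Sum>m<(2 :: nat) ^ n. (\<Prod>k<n. F k (bit m k)) * F n True)"
    by (intro arg_cong2[where f = "(+)"] sum.cong refl arg_cong2[where f = "(*)"] prod.cong)
      (auto simp: bit_add_power bit_power_top)
  also have "\<dots> = (\<Prod>k<n. F k False + F k True) * (F n False + F n True)"
    by (simp add: sum_distrib_right[symmetric] Suc distrib_left)
  finally show ?case by simp
qed simp

lemma index_eq_iff_bits:
  assumes "i < 2 ^ n" "j < 2 ^ n"
  shows "i = j \<longleftrightarrow> (\<forall>k<n. bit i k = bit (j :: nat) k)"
proof
  assume "\<forall>k<n. bit i k = bit j k"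
  then have "take_bit n i = take_bit n j" by (intro bit_eqI) (auto simp: bit_take_bit_iff)
  then show "i = j" using assms by (simp add: take_bit_nat_eq_self)
qed simp

lemma prod_of_bool: "finite I \<Longrightarrow> (\<Prod>k\<in>I. of_bool (P k)) = (of_bool (\<forall>k\<in>I. P k) :: 'a :: comm_semiring_1)"
  by (induction I rule: finite_induct) auto

lemma pauli_string_mult:
  assumes "length v = 2 * n" "length w = 2 * n"
  shows "pauli_string n v * pauli_string n w = scaled_pauli n (vxor v w) (phase n v w)"
proof (rule eq_matI)
  fix i j assume "i < dim_row (scaled_pauli n (vxor v w) (phase n v w))"
    "j < dim_col (scaled_pauli n (vxor v w) (phase n v w))"
  then have ij: "i < 2 ^ n" "j < 2 ^ n" by simp_all
  have entry: "pauli_entry x z a False * pauli_entry x' z' False b +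
      pauli_entry x z a True * pauli_entry x' z' True b =
      phase1 x z x' z' * pauli_entry (x \<noteq> x') (z \<noteq> z') a b" for x z x' z' a b
    by (cases x; cases z; cases x'; cases z'; cases a; cases b)
      (simp_all add: pauli_entry_def phase1_def)
  have "(pauli_string n v * pauli_string n w) $$ (i, j) =
      (\<Sum>m<(2 :: nat) ^ n. pauli_string n v $$ (i, m) * pauli_string n w $$ (m, j))"
    using ij by (simp add: scalar_prod_def atLeast0LessThan)
  also have "\<dots> = (\<Sum>m<(2 :: nat) ^ n. \<Prod>k<n. pauli_entry (v ! k) (v ! (n + k)) (bit i k) (bit m k) *
      pauli_entry (w ! k) (w ! (n + k)) (bit m k) (bit j k))"
    using ij by (intro sum.cong) (simp_all add: pauli_string_entry prod.distrib)
  also have "\<dots> = (\<Prod>k<n. phase1 (v ! k) (v ! (n + k)) (w ! k) (w ! (n + k)) *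
      pauli_entry (vxor v w ! k) (vxor v w ! (n + k)) (bit i k) (bit j k))"
    unfolding sum_prod_bits[where F = "\<lambda>k b. pauli_entry (v ! k) (v ! (n + k)) (bit i k) b *
      pauli_entry (w ! k) (w ! (n + k)) b (bit j k)"]
    by (rule prod.cong) (use assms in \<open>simp_all add: entry\<close>)
  also have "\<dots> = scaled_pauli n (vxor v w) (phase n v w) $$ (i, j)"
    using ij by (simp add: scaled_pauli_def phase_def pauli_string_entry prod.distrib)
  finally show "(pauli_string n v * pauli_string n w) $$ (i, j) =
    scaled_pauli n (vxor v w) (phase n v w) $$ (i, j)" .
qed simp_all

lemma scaled_pauli_mult:
  assumes "length v = 2 * n" "length w = 2 * n"
  shows "scaled_pauli n v c * scaled_pauli n w d = scaled_pauli n (vxor v w) (c * d * phase n v w)"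
proof -
  have "scaled_pauli n v c * scaled_pauli n w d = c \<cdot>\<^sub>m (d \<cdot>\<^sub>m (pauli_string n v * pauli_string n w))"
    unfolding scaled_pauli_def
    by (simp add: mult_smult_distrib[OF pauli_string_carrier pauli_string_carrier]
        mult_smult_assoc_mat[OF pauli_string_carrier smult_carrier_mat[OF pauli_string_carrier]])
  then show ?thesis
    unfolding pauli_string_mult[OF assms] by (auto simp: scaled_pauli_def intro!: eq_matI)
qed

lemma pauli_string_trace:
  assumes "length v = 2 * n"
  shows "mat_trace (pauli_string n v) = (if v = zeros (2 * n) then 2 ^ n else 0)"
proof -
  have "mat_trace (pauli_string n v) =
      (\<Sum>i<(2 :: nat) ^ n. \<Prod>k<n. pauli_entry (v ! k) (v ! (n + k)) (bit i k) (bit i k))"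
    by (simp add: mat_trace_def pauli_string_entry)
  also have "\<dots> = (\<Prod>k<n. if v ! k \<or> v ! (n + k) then 0 else 2)"
    unfolding sum_prod_bits[where F = "\<lambda>k b. pauli_entry (v ! k) (v ! (n + k)) b b"]
    by (rule prod.cong) (auto simp: pauli_entry_def)
  also have "\<dots> = (if v = zeros (2 * n) then 2 ^ n else 0)"
  proof (cases "v = zeros (2 * n)")
    case False
    then obtain k where k: "k < 2 * n" "v ! k"
      using assms by (metis (full_types) length_replicate nth_equalityI nth_replicate)
    then have "(if k < n then k else k - n) < n \<and> (v ! (if k < n then k else k - n) \<or>
        v ! (n + (if k < n then k else k - n)))"
      by auto
    then have "\<exists>k<n. v ! k \<or> v ! (n + k)" by blast
    then show ?thesis using False by (auto intro!: prod_zero)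
  qed simp
  finally show ?thesis .
qed

lemma pauli_string_zeros: "pauli_string n (zeros (2 * n)) = 1\<^sub>m (2 ^ n)"
proof (rule eq_matI)
  fix i j assume "i < dim_row (1\<^sub>m (2 ^ n) :: complex mat)" "j < dim_col (1\<^sub>m (2 ^ n) :: complex mat)"
  then have ij: "i < 2 ^ n" "j < 2 ^ n" by simp_all
  have "pauli_string n (zeros (2 * n)) $$ (i, j) = (\<Prod>k<n. of_bool (bit i k = bit j k))"
    using ij by (auto simp: pauli_string_entry pauli_entry_def intro!: prod.cong)
  also have "\<dots> = of_bool (i = j)"
    using index_eq_iff_bits[OF ij] by (auto simp: prod_of_bool)
  finally show "pauli_string n (zeros (2 * n)) $$ (i, j) = 1\<^sub>m (2 ^ n) $$ (i, j)"
    using ij by simp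
qed simp_all

lemma scaled_pauli_one: "scaled_pauli n (zeros (2 * n)) 1 = 1\<^sub>m (2 ^ n)"
  by (auto simp: scaled_pauli_def pauli_string_zeros intro!: eq_matI)

lemma mat_trace_smult: "M \<in> carrier_mat d d \<Longrightarrow> mat_trace (c \<cdot>\<^sub>m M) = c * mat_trace M"
  by (auto simp: mat_trace_def sum_distrib_left)

lemma scaled_pauli_trace:
  "length v = 2 * n \<Longrightarrow> mat_trace (scaled_pauli n v c) = (if v = zeros (2 * n) then c * 2 ^ n else 0)"
  unfolding scaled_pauli_def by (simp add: mat_trace_smult[OF pauli_string_carrier] pauli_string_trace)

lemma phase_self [simp]: "phase n v v = 1"
  by (auto simp: phase_def phase1_def intro!: prod.neutral)

lemma phase_commute: "phase n w v = cnj (phase n v w)"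
  unfolding phase_def cnj_prod by (rule prod.cong) (auto simp: phase1_def)

lemma phase_comm_sign: "phase n v w = comm_sign n v w * phase n w v"
  unfolding phase_def comm_sign_def prod.distrib[symmetric]
  by (rule prod.cong) (auto simp: phase1_def comm1_def)

lemma norm_phase [simp]: "norm (phase n v w) = 1"
  unfolding phase_def prod_norm[symmetric] by (rule prod.neutral) (auto simp: phase1_def)

lemma phase_nonzero [simp]: "phase n v w \<noteq> 0"
  using norm_phase[of n v w] by (metis norm_zero zero_neq_one)

lemma comm_sign_cases: "comm_sign n v w = 1 \<or> comm_sign n v w = -1"
proof -
  have "(\<Prod>k\<in>I. f k) = 1 \<or> (\<Prod>k\<in>I. f k) = -1"
    if "\<And>k. f k = 1 \<or> f k = -1" for f :: "nat \<Rightarrow> complex" and I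
    using that by (induction I rule: infinite_finite_induct) force+
  then show ?thesis unfolding comm_sign_def comm1_def by simp
qed

lemma comm_sign_commute: "comm_sign n v w = comm_sign n w v"
  unfolding comm_sign_def by (rule prod.cong) (auto simp: comm1_def)

lemma comm_sign_vxor:
  assumes "length u = 2 * n" "length v = 2 * n"
  shows "comm_sign n (vxor u v) w = comm_sign n u w * comm_sign n v w"
  unfolding comm_sign_def prod.distrib[symmetric]
  by (rule prod.cong) (use assms in \<open>auto simp: comm1_def\<close>)

lemma comm_sign_nondegenerate:
  assumes "length v = 2 * n" "v \<noteq> zeros (2 * n)"
  shows "\<exists>w. length w = 2 * n \<and> comm_sign n v w = -1"
proof -
  obtain k where k: "k < 2 * n" "v ! k"
    using assms by (metis (full_types) length_replicate nth_equalityI nth_replicate)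
  \<comment> \<open>The witness has a single one, at the position conjugate to \<open>k\<close>,
    with \<open>x\<close> and \<open>z\<close> exchanged on the same qubit \<open>k0\<close>. Only
    the factor of that qubit is \<open>-1\<close>.\<close>
  define m where "m = (if k < n then n + k else k - n)"
  define w where "w = (zeros (2 * n))[m := True]"
  define k0 where "k0 = (if k < n then k else k - n)"
  have k0: "k0 < n" using k by (auto simp: k0_def)
  have "comm_sign n v w = (\<Prod>j<n. if j = k0 then -1 else 1)"
    unfolding comm_sign_def
    by (rule prod.cong) (use k in \<open>auto simp: comm1_def w_def m_def k0_def nth_list_update split: if_splits\<close>)
  also have "\<dots> = -1" using k0 by (simp add: prod.delta')
  finally show ?thesis by (intro exI[of _ w]) (simp add: w_def)
qed

text \<open>Multiply both sides by the Pauli string of \<open>v\<close> and take traces: the left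
  side gives \<open>c * 2 ^ n\<close>, which is nonzero, and the right side vanishes unless
  \<open>w = v\<close>.\<close>

lemma scaled_pauli_inject:
  assumes "scaled_pauli n v c = scaled_pauli n w d" "length v = 2 * n" "length w = 2 * n" "c \<noteq> 0"
  shows "v = w \<and> c = d"
proof -
  have "scaled_pauli n v c * scaled_pauli n v 1 = scaled_pauli n w d * scaled_pauli n v 1"
    using assms(1) by simp
  then have eq: "scaled_pauli n (zeros (2 * n)) c = scaled_pauli n (vxor w v) (d * phase n w v)"
    using assms(2,3) by (simp add: scaled_pauli_mult vxor_self)
  have tr: "c * 2 ^ n = (if vxor w v = zeros (2 * n) then d * phase n w v * 2 ^ n else 0)"
    using arg_cong[OF eq, of mat_trace] assms(2,3) by (simp add: scaled_pauli_trace)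
  with assms have "vxor w v = zeros (2 * n)" by (auto split: if_splits)
  then have "w = v"
    using vxor_cancel[of w v] vxor_zeros(1)[of w "2 * n"] assms by simp
  with tr assms show ?thesis by (simp add: vxor_self)
qed

lemma scaled_pauli_commute_iff:
  assumes "length v = 2 * n" "length w = 2 * n" "c \<noteq> 0" "d \<noteq> 0"
  shows "scaled_pauli n v c * scaled_pauli n w d = scaled_pauli n w d * scaled_pauli n v c \<longleftrightarrow>
    comm_sign n v w = 1"
proof
  assume "scaled_pauli n v c * scaled_pauli n w d = scaled_pauli n w d * scaled_pauli n v c"
  then have "scaled_pauli n (vxor v w) (c * d * phase n v w) = scaled_pauli n (vxor v w) (d * c * phase n w v)"
    using assms by (simp add: scaled_pauli_mult vxor_commute)
  then have "c * d * phase n v w = d * c * phase n w v"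
    using scaled_pauli_inject[of n "vxor v w" _ "vxor v w"] assms by simp
  then show "comm_sign n v w = 1"
    using assms phase_comm_sign[of n v w] by simp
next
  assume "comm_sign n v w = 1"
  then show "scaled_pauli n v c * scaled_pauli n w d = scaled_pauli n w d * scaled_pauli n v c"
    using assms phase_comm_sign[of n v w] by (simp add: scaled_pauli_mult vxor_commute mult.commute)
qed

lemma scaled_pauli_uminus: "- scaled_pauli n v c = scaled_pauli n v (- c)"
  by (auto simp: scaled_pauli_def intro!: eq_matI)

lemma pauli_op_scaled: "pauli_op n p = scaled_pauli n (snd p) (if fst p then -1 else 1)"
  by (simp add: pauli_op_def scaled_pauli_def)

lemma hermitian_paulis_iff:
  "M \<in> hermitian_paulis n \<longleftrightarrow>
    (\<exists>v c. length v = 2 * n \<and> (c = 1 \<or> c = -1) \<and> M = scaled_pauli n v c)"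
proof
  assume "\<exists>v c. length v = 2 * n \<and> (c = 1 \<or> c = -1) \<and> M = scaled_pauli n v c"
  then obtain v c where "length v = 2 * n" "c = 1 \<or> c = -1" "M = scaled_pauli n v c" by blast
  then have "M = pauli_op n (c = -1, v)" "valid_pauli n (c = -1, v)"
    by (auto simp: pauli_op_scaled valid_pauli_def)
  then show "M \<in> hermitian_paulis n" unfolding hermitian_paulis_def by blast
next
  assume "M \<in> hermitian_paulis n"
  then obtain p where "length (snd p) = 2 * n" "M = scaled_pauli n (snd p) (if fst p then -1 else 1)"
    by (auto simp: hermitian_paulis_def pauli_op_scaled valid_pauli_def)
  then show "\<exists>v c. length v = 2 * n \<and> (c = 1 \<or> c = -1) \<and> M = scaled_pauli n v c"
    by (intro exI[of _ "snd p"] exI[of _ "if fst p then -1 else 1"]) simp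
qed

lemma pauli_entry_cnj: "cnj (pauli_entry x z a b) = pauli_entry x z b a"
  by (auto simp: pauli_entry_def)

lemma scaled_pauli_hermitian:
  assumes "c = 1 \<or> c = -1" "i < 2 ^ n" "j < 2 ^ n"
  shows "cnj (scaled_pauli n v c $$ (i, j)) = scaled_pauli n v c $$ (j, i)"
  using assms
  by (auto simp: scaled_pauli_def pauli_string_entry cnj_prod pauli_entry_cnj)

section \<open>Hermitian Pauli operators\<close>

lemma hermitian_pauliE:
  assumes "M \<in> hermitian_paulis n"
  obtains v c where "length v = 2 * n" "c = 1 \<or> c = -1" "M = scaled_pauli n v c"
  using assms unfolding hermitian_paulis_iff by blast

lemma hermitian_pauliI:
  "length v = 2 * n \<Longrightarrow> c = 1 \<or> c = -1 \<Longrightarrow> scaled_pauli n v c \<in> hermitian_paulis n"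
  unfolding hermitian_paulis_iff by blast

lemma hermitian_pauli_carrier: "M \<in> hermitian_paulis n \<Longrightarrow> M \<in> carrier_mat (2 ^ n) (2 ^ n)"
  by (auto elim: hermitian_pauliE)

lemma hermitian_pauli_square:
  assumes "M \<in> hermitian_paulis n"
  shows "M * M = 1\<^sub>m (2 ^ n)"
  using assms by (elim hermitian_pauliE) (auto simp: scaled_pauli_mult vxor_self scaled_pauli_one)

lemma hermitian_pauli_uminus: "M \<in> hermitian_paulis n \<Longrightarrow> - M \<in> hermitian_paulis n"
  by (elim hermitian_pauliE) (auto simp: scaled_pauli_uminus intro!: hermitian_pauliI)

lemma one_hermitian_pauli: "1\<^sub>m (2 ^ n) \<in> hermitian_paulis n"
  unfolding hermitian_paulis_iff scaled_pauli_one[symmetric]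
  by (intro exI[of _ "zeros (2 * n)"] exI[of _ 1]) simp

lemma finite_bool_lists [simp]: "finite {v :: bool list. length v = m}"
  using finite_lists_length_eq[of "UNIV :: bool set" m] by simp

lemma card_bool_lists: "card {v :: bool list. length v = m} = 2 ^ m"
  using card_lists_length_eq[of "UNIV :: bool set" m] by simp

lemma finite_hermitian_paulis [simp]: "finite (hermitian_paulis n)"
proof -
  have "{p. valid_pauli n p} = UNIV \<times> {v. length v = 2 * n}"
    by (auto simp: valid_pauli_def)
  then show ?thesis unfolding hermitian_paulis_def by simp
qed

text \<open>Commuting makes the phase equal to its complex conjugate, hence real; having modulus
  one, it is a sign.\<close>

lemma hermitian_pauli_mult:
  assumes "M \<in> hermitian_paulis n" "N \<in> hermitian_paulis n" "M * N = N * M"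
  shows "M * N \<in> hermitian_paulis n"
proof -
  obtain v c where v: "length v = 2 * n" "c = 1 \<or> c = -1" "M = scaled_pauli n v c"
    using assms(1) by (rule hermitian_pauliE)
  obtain w d where w: "length w = 2 * n" "d = 1 \<or> d = -1" "N = scaled_pauli n w d"
    using assms(2) by (rule hermitian_pauliE)
  have "comm_sign n v w = 1"
    using scaled_pauli_commute_iff[of v n w c d] assms(3) v w by auto
  then have "phase n v w = cnj (phase n v w)"
    using phase_comm_sign[of n v w] phase_commute[of n w v] by simp
  then have "Im (phase n v w) = 0" by (metis Reals_cnj_iff complex_is_Real_iff)
  then obtain r where r: "phase n v w = complex_of_real r"
    by (metis complex_of_real_def complex.collapse)
  then have "\<bar>r\<bar> = 1" using norm_phase[of n v w] by simp
  then have "r = 1 \<or> r = -1" by linarith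
  then have "phase n v w = 1 \<or> phase n v w = -1" using r by auto
  then show ?thesis
    unfolding hermitian_paulis_iff using v w
    by (intro exI[of _ "vxor v w"] exI[of _ "c * d * phase n v w"]) (auto simp: scaled_pauli_mult)
qed

text \<open>Orthogonality of the Pauli operators in the trace form, from which all expectation
  values are computed.\<close>

lemma hermitian_pauli_trace:
  assumes "M \<in> hermitian_paulis n" "N \<in> hermitian_paulis n"
  shows "mat_trace (M * N) = (if M = N then 2 ^ n else if M = - N then - (2 ^ n) else 0)"
proof -
  obtain v c where v: "length v = 2 * n" "c = 1 \<or> c = -1" "M = scaled_pauli n v c"
    using assms(1) by (rule hermitian_pauliE)
  obtain w d where w: "length w = 2 * n" "d = 1 \<or> d = -1" "N = scaled_pauli n w d"
    using assms(2) by (rule hermitian_pauliE)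
  have eq: "(scaled_pauli n v c = scaled_pauli n w e) \<longleftrightarrow> v = w \<and> c = e" for e
    using scaled_pauli_inject[of n v c w e] v w by auto
  have x: "vxor v w = zeros (2 * n) \<longleftrightarrow> v = w"
    using vxor_cancel[of v w] vxor_zeros(1)[of v "2 * n"] vxor_self[of v] v w by auto
  show ?thesis
    unfolding v(3) w(3) scaled_pauli_uminus eq
    using v w by (auto simp: scaled_pauli_mult scaled_pauli_trace x)
qed

lemma hermitian_pauli_neq_uminus:
  assumes "M \<in> hermitian_paulis n"
  shows "M \<noteq> - M"
proof
  assume "M = - M"
  obtain v c where v: "length v = 2 * n" "c = 1 \<or> c = -1" "M = scaled_pauli n v c"
    using assms by (rule hermitian_pauliE)
  then show False using scaled_pauli_inject[of n v c v "-c"] \<open>M = - M\<close>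
    by (auto simp: scaled_pauli_uminus)
qed

lemma mult_uminus_left:
  "A \<in> carrier_mat d d \<Longrightarrow> B \<in> carrier_mat d d \<Longrightarrow> - A * B = - (A * B :: complex mat)"
  by (auto intro!: eq_matI simp: scalar_prod_def sum_negf)

lemma mult_uminus_right:
  "A \<in> carrier_mat d d \<Longrightarrow> B \<in> carrier_mat d d \<Longrightarrow> A * - B = - (A * B :: complex mat)"
  by (auto intro!: eq_matI simp: scalar_prod_def sum_negf)

lemma uminus_uminus_mat [simp]: "- (- A) = (A :: complex mat)"
  by (auto intro!: eq_matI)

lemma hermitian_pauli_cancel:
  assumes "M \<in> hermitian_paulis n" "N \<in> carrier_mat (2 ^ n) (2 ^ n)"
  shows "M * (M * N) = N"
proof -
  have "M * (M * N) = (M * M) * N"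
    using assms hermitian_pauli_carrier[OF assms(1)] by (simp add: assoc_mult_mat)
  then show ?thesis using assms by (simp add: hermitian_pauli_square left_mult_one_mat)
qed

section \<open>Stabilizer groups\<close>

text \<open>A notion free of generators, because the reduction of a group to a subset of the qubits
  comes without any. Closure under inverses follows since every element squares to the
  identity.\<close>

definition stabilizer_group :: "nat \<Rightarrow> complex mat set \<Rightarrow> bool" where
  "stabilizer_group n H \<longleftrightarrow> H \<subseteq> hermitian_paulis n \<and> 1\<^sub>m (2 ^ n) \<in> H \<and> - 1\<^sub>m (2 ^ n) \<notin> H \<and>
    (\<forall>M\<in>H. \<forall>N\<in>H. M * N \<in> H \<and> M * N = N * M)"

lemma stabilizer_groupD:
  assumes "stabilizer_group n H"
  shows "H \<subseteq> hermitian_paulis n" "1\<^sub>m (2 ^ n) \<in> H" "- 1\<^sub>m (2 ^ n) \<notin> H"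
    "\<And>M N. M \<in> H \<Longrightarrow> N \<in> H \<Longrightarrow> M * N \<in> H" "\<And>M N. M \<in> H \<Longrightarrow> N \<in> H \<Longrightarrow> M * N = N * M"
    "\<And>M. M \<in> H \<Longrightarrow> M \<in> hermitian_paulis n" "\<And>M. M \<in> H \<Longrightarrow> M \<in> carrier_mat (2 ^ n) (2 ^ n)"
    "finite H"
  using assms hermitian_pauli_carrier finite_subset[OF _ finite_hermitian_paulis]
  unfolding stabilizer_group_def by blast+

lemma stabilizer_group_uminus:
  assumes "stabilizer_group n H" "M \<in> H"
  shows "- M \<notin> H"
proof
  assume "- M \<in> H"
  then have "M * - M \<in> H" using stabilizer_groupD(4)[OF assms(1)] assms(2) by blast
  moreover have "M * - M = - 1\<^sub>m (2 ^ n)"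
    using stabilizer_groupD[OF assms(1)] assms(2)
    by (simp add: mult_uminus_right[of _ "2 ^ n"] hermitian_pauli_square)
  ultimately show False using stabilizer_groupD(3)[OF assms(1)] by simp
qed

lemma coset_mem_iff:
  assumes H: "stabilizer_group n H" and N: "N \<in> hermitian_paulis n" and M: "M \<in> carrier_mat (2 ^ n) (2 ^ n)"
  shows "M \<in> (*) N ` H \<longleftrightarrow> N * M \<in> H"
proof
  assume "M \<in> (*) N ` H"
  then show "N * M \<in> H"
    using hermitian_pauli_cancel[OF N] stabilizer_groupD(7)[OF H] by auto
next
  assume "N * M \<in> H"
  moreover have "M = N * (N * M)" using hermitian_pauli_cancel[OF N M] by simp
  ultimately show "M \<in> (*) N ` H" by blast
qed

lemma inj_on_coset:
  assumes "stabilizer_group n H" "N \<in> hermitian_paulis n"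
  shows "inj_on ((*) N) H"
  by (rule inj_on_inverseI[of _ "(*) N"])
    (use hermitian_pauli_cancel assms stabilizer_groupD(7) in blast)

lemma coset_disjoint:
  assumes H: "stabilizer_group n H" and N: "N \<in> hermitian_paulis n" "N \<notin> H"
  shows "H \<inter> (*) N ` H = {}"
proof -
  have False if M: "M \<in> H" "N * M \<in> H" for M
  proof -
    have "N * M * M \<in> H" using stabilizer_groupD(4)[OF H] M by blast
    moreover have "N * M * M = N"
      using assoc_mult_mat[of N "2 ^ n" "2 ^ n" M "2 ^ n" M "2 ^ n"] stabilizer_groupD(6,7)[OF H M(1)]
        hermitian_pauli_carrier[OF N(1)] hermitian_pauli_square[of M n]
      by simp
    ultimately show False using N by simp
  qed
  then show ?thesis by blast
qed

text \<open>\<open>- N \<notin> H\<close> is what keeps minus the identity out of the coset: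
  \<open>N * M\<close> equal to it would mean \<open>M = - N\<close>.\<close>

lemma stabilizer_group_extend:
  assumes H: "stabilizer_group n H" and N: "N \<in> hermitian_paulis n" "N \<notin> H" "- N \<notin> H"
    and comm: "\<And>M. M \<in> H \<Longrightarrow> N * M = M * N"
  shows "stabilizer_group n (H \<union> (*) N ` H)" "card (H \<union> (*) N ` H) = 2 * card H"
proof -
  note D = stabilizer_groupD[OF H]
  have Nc: "N \<in> carrier_mat (2 ^ n) (2 ^ n)" using N(1) by (rule hermitian_pauli_carrier)
  note [simp] = assoc_mult_mat[of _ "2 ^ n" "2 ^ n" _ "2 ^ n" _ "2 ^ n"] Nc D(7)
  have [simp]: "N * M \<in> carrier_mat (2 ^ n) (2 ^ n)" if "M \<in> H" for M
    using mult_carrier_mat[OF Nc D(7)[OF that]] .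
  have a: "M * (N * M') = N * (M * M')" if "M \<in> H" "M' \<in> H" for M M'
  proof -
    have "M * (N * M') = (M * N) * M'" using that by simp
    also have "\<dots> = (N * M) * M'" using comm that by simp
    finally show ?thesis using that by simp
  qed
  have b: "N * M * (N * M') = M * M'" if "M \<in> H" "M' \<in> H" for M M'
  proof -
    have "N * M * (N * M') = N * (M * (N * M'))" using that by simp
    also have "\<dots> = N * (N * (M * M'))" using a that by simp
    also have "\<dots> = M * M'"
      using hermitian_pauli_cancel[OF N(1) D(7)[OF D(4)[OF that]]] .
    finally show ?thesis .
  qed
  have "- 1\<^sub>m (2 ^ n) \<noteq> N * M" if "M \<in> H" for M
  proof
    assume "- 1\<^sub>m (2 ^ n) = N * M"
    then have "N * - 1\<^sub>m (2 ^ n) = N * (N * M)" by simp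
    then have "- N = M" using hermitian_pauli_cancel[OF N(1)] that
      by (simp add: mult_uminus_right[OF Nc one_carrier_mat] right_mult_one_mat[OF Nc])
    with N(3) that show False by simp
  qed
  moreover have "(*) N ` H \<subseteq> hermitian_paulis n"
    using hermitian_pauli_mult[OF N(1) D(6) comm] by blast
  moreover have "M * M' \<in> H \<union> (*) N ` H \<and> M * M' = M' * M"
    if "M \<in> H \<union> (*) N ` H" "M' \<in> H \<union> (*) N ` H" for M M'
  proof -
    have c: "N * M1 * M2 = N * (M1 * M2)" if "M1 \<in> H" "M2 \<in> H" for M1 M2 using that by simp
    from that show ?thesis
    proof (elim UnE imageE)
      assume "M \<in> H" "M' \<in> H"
      then show ?thesis using D(4,5) by blast
    next
      fix K assume "M \<in> H" "M' = N * K" "K \<in> H"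
      then show ?thesis using a[of M K] c[of K M] D(4)[of M K] D(5)[of M K] by simp
    next
      fix K assume "M' \<in> H" "M = N * K" "K \<in> H"
      then show ?thesis using a[of M' K] c[of K M'] D(4)[of K M'] D(5)[of M' K] by simp
    next
      fix K K' assume "M = N * K" "M' = N * K'" "K \<in> H" "K' \<in> H"
      then show ?thesis using b[of K K'] b[of K' K] D(4)[of K K'] D(5)[of K K'] by simp
    qed
  qed
  ultimately show "stabilizer_group n (H \<union> (*) N ` H)"
    unfolding stabilizer_group_def using D(1-3) by auto
  show "card (H \<union> (*) N ` H) = 2 * card H"
    using card_Un_disjoint[OF D(8) finite_imageI[OF D(8)] coset_disjoint[OF H N(1,2)]]
      card_image[OF inj_on_coset[OF H N(1)]] by simp
qed

section \<open>The generated group\<close>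

lemma group_qubit_GL: "group (qubit_GL n)"
proof -
  interpret ring "ring_mat TYPE(complex) (2 ^ n) ()" by (rule ring_mat)
  show ?thesis unfolding qubit_GL_def by (rule units_group)
qed

lemma qubit_GL_simps:
  "mult (qubit_GL n) = (*)" "one (qubit_GL n) = 1\<^sub>m (2 ^ n)"
  by (simp_all add: qubit_GL_def units_of_def ring_mat_def)

lemma carrier_qubit_GL: "carrier (qubit_GL n) \<subseteq> carrier_mat (2 ^ n) (2 ^ n)"
  by (auto simp: qubit_GL_def units_of_def ring_mat_def Units_def)

lemma hermitian_pauli_qubit_GL:
  assumes "M \<in> hermitian_paulis n"
  shows "M \<in> carrier (qubit_GL n)" "inv\<^bsub>qubit_GL n\<^esub> M = M"
proof -
  show c: "M \<in> carrier (qubit_GL n)"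
    using assms hermitian_pauli_carrier[OF assms] hermitian_pauli_square[OF assms]
    by (auto simp: qubit_GL_def units_of_def ring_mat_def Units_def)
  show "inv\<^bsub>qubit_GL n\<^esub> M = M"
    by (rule group.inv_equality[OF group_qubit_GL _ c c])
      (simp add: qubit_GL_simps hermitian_pauli_square[OF assms])
qed

lemma pauli_op_hermitian: "valid_pauli n p \<Longrightarrow> pauli_op n p \<in> hermitian_paulis n"
  by (auto simp: hermitian_paulis_def)

text \<open>\<open>N\<close> is an involution commuting with the generated group, so every word can
  be rewritten with at most one \<open>N\<close>, at its front.\<close>

lemma generate_insert_commuting:
  assumes N: "N \<in> hermitian_paulis n" and S: "S \<subseteq> hermitian_paulis n"
    and comm: "\<And>M. M \<in> generate (qubit_GL n) S \<Longrightarrow> N * M = M * N"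
  shows "generate (qubit_GL n) (insert N S) =
    generate (qubit_GL n) S \<union> (*) N ` generate (qubit_GL n) S"
proof -
  let ?G = "generate (qubit_GL n) S"
  have Sc: "S \<subseteq> carrier (qubit_GL n)" using S hermitian_pauli_qubit_GL(1) by blast
  have Gc: "M \<in> carrier_mat (2 ^ n) (2 ^ n)" if "M \<in> ?G" for M
    using group.generate_in_carrier[OF group_qubit_GL Sc that] carrier_qubit_GL by blast
  have Nc: "N \<in> carrier_mat (2 ^ n) (2 ^ n)" using N by (rule hermitian_pauli_carrier)
  have one: "1\<^sub>m (2 ^ n) \<in> ?G" using generate.one[of "qubit_GL n" S] by (simp add: qubit_GL_simps)
  have mult: "M * M' \<in> ?G" if "M \<in> ?G" "M' \<in> ?G" for M M'
    using generate.eng[OF that] by (simp add: qubit_GL_simps)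
  note [simp] = assoc_mult_mat[of _ "2 ^ n" "2 ^ n" _ "2 ^ n" _ "2 ^ n"] Nc Gc
  have [simp]: "N * M \<in> carrier_mat (2 ^ n) (2 ^ n)" if "M \<in> ?G" for M
    using mult_carrier_mat[OF Nc Gc[OF that]] .
  have NN: "N \<in> (*) N ` ?G"
    using one right_mult_one_mat[OF Nc] by (metis image_eqI)
  have a: "M * (N * M') = N * (M * M')" if "M \<in> ?G" "M' \<in> ?G" for M M'
  proof -
    have "M * (N * M') = (M * N) * M'" using that by simp
    also have "\<dots> = (N * M) * M'" using comm that by simp
    finally show ?thesis using that by simp
  qed
  have "M \<in> ?G \<union> (*) N ` ?G" if "M \<in> generate (qubit_GL n) (insert N S)" for M
    using that
  proof induction
    case one
    then show ?case using \<open>1\<^sub>m (2 ^ n) \<in> ?G\<close> by (simp add: qubit_GL_simps)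
  next
    case (incl h)
    then show ?case using NN by (auto intro: generate.incl)
  next
    case (inv h)
    then have "inv\<^bsub>qubit_GL n\<^esub> h = h" using N S hermitian_pauli_qubit_GL(2) by blast
    with inv show ?case using NN by (auto intro: generate.incl)
  next
    case (eng h1 h2)
    from eng.IH have "h1 * h2 \<in> ?G \<union> (*) N ` ?G"
    proof (elim UnE imageE)
      assume "h1 \<in> ?G" "h2 \<in> ?G"
      then show ?thesis using mult by blast
    next
      fix K assume "h1 \<in> ?G" "h2 = N * K" "K \<in> ?G"
      then show ?thesis using a[of h1 K] mult by auto
    next
      fix K assume "h2 \<in> ?G" "h1 = N * K" "K \<in> ?G"
      then have "h1 * h2 = N * (K * h2)" "K * h2 \<in> ?G" using mult by auto
      then show ?thesis by blast
    next
      fix K K' assume *: "h1 = N * K" "h2 = N * K'" "K \<in> ?G" "K' \<in> ?G"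
      then have "h1 * h2 = N * (K * (N * K'))" by simp
      also have "\<dots> = N * (N * (K * K'))" using a * by simp
      also have "\<dots> = K * K'" by (rule hermitian_pauli_cancel[OF N Gc[OF mult[OF *(3,4)]]])
      finally show ?thesis using mult * by simp
    qed
    then show ?case by (simp add: qubit_GL_simps)
  qed
  moreover have "?G \<subseteq> generate (qubit_GL n) (insert N S)"
    by (rule group.mono_generate[OF group_qubit_GL]) blast
  moreover have "N * M \<in> generate (qubit_GL n) (insert N S)" if "M \<in> ?G" for M
    using generate.eng[OF generate.incl[of N "insert N S" "qubit_GL n"], of M] that
      \<open>?G \<subseteq> generate (qubit_GL n) (insert N S)\<close>
    by (auto simp: qubit_GL_simps)
  ultimately show ?thesis by blast
qed

lemma stab_group_Nil: "stab_group n [] = {1\<^sub>m (2 ^ n)}"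
  using group.generate_empty[OF group_qubit_GL, of n] by (simp add: stab_group_def qubit_GL_simps)

lemma stabilizer_generators_group:
  assumes "stabilizer_generators n gs"
  shows "stabilizer_group n (stab_group n gs)"
proof -
  have "1\<^sub>m (2 ^ n) \<in> stab_group n gs"
    unfolding stab_group_def using generate.one[of "qubit_GL n"] by (simp add: qubit_GL_simps)
  moreover have "M * N \<in> stab_group n gs" if "M \<in> stab_group n gs" "N \<in> stab_group n gs" for M N
    using that generate.eng[of M "qubit_GL n" _ N] unfolding stab_group_def by (simp add: qubit_GL_simps)
  ultimately show ?thesis
    using assms unfolding stabilizer_generators_def stabilizer_group_def by blast
qed

lemma stab_group_mem: "g \<in> set gs \<Longrightarrow> pauli_op n g \<in> stab_group n gs"
  unfolding stab_group_def by (rule generate.incl) simp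

text \<open>Together with \<open>stabilizer_generators_Cons\<close> this replaces the symmetric
  notion of independence by a recursive one, which allows induction over the list of generators. The
  negative of the first generator is excluded because the group would contain minus the
  identity.\<close>

lemma stabilizer_generators_ConsD:
  assumes "stabilizer_generators n (g # gs)"
  shows "stabilizer_generators n gs" "pauli_op n g \<in> hermitian_paulis n"
    "pauli_op n g \<notin> stab_group n gs" "- pauli_op n g \<notin> stab_group n gs"
    "\<And>M. M \<in> stab_group n gs \<Longrightarrow> pauli_op n g * M = M * pauli_op n g"
proof -
  let ?ops = "\<lambda>gs j. {pauli_op n (gs ! i) | i. i < length gs \<and> i \<noteq> j}"
  note S = stabilizer_generators_group[OF assms]
  have sub: "stab_group n gs \<subseteq> stab_group n (g # gs)"
    unfolding stab_group_def by (rule group.mono_generate[OF group_qubit_GL]) auto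
  have g: "pauli_op n g \<in> stab_group n (g # gs)" by (rule stab_group_mem) simp
  show gh: "pauli_op n g \<in> hermitian_paulis n" using stabilizer_groupD(6)[OF S g] .
  show "pauli_op n g * M = M * pauli_op n g" if "M \<in> stab_group n gs" for M
    using stabilizer_groupD(5)[OF S g] sub that by blast
  have ind: "pauli_op n ((g # gs) ! j) \<notin> generate (qubit_GL n) (?ops (g # gs) j)"
    if "j < Suc (length gs)" for j
    using assms that unfolding stabilizer_generators_def independent_paulis_def by auto
  have "pauli_op n ` set gs \<subseteq> ?ops (g # gs) 0"
  proof
    fix x assume "x \<in> pauli_op n ` set gs"
    then obtain i where "i < length gs" "x = pauli_op n (gs ! i)" by (auto simp: in_set_conv_nth)
    then show "x \<in> ?ops (g # gs) 0" by (auto intro!: exI[of _ "Suc i"])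
  qed
  from group.mono_generate[OF group_qubit_GL this, of n]
  show "pauli_op n g \<notin> stab_group n gs"
    using ind[of 0] by (auto simp: stab_group_def)
  show "- pauli_op n g \<notin> stab_group n gs"
    using stabilizer_group_uminus[OF S g] sub by blast
  have "pauli_op n (gs ! j) \<notin> generate (qubit_GL n) (?ops gs j)" if "j < length gs" for j
  proof -
    have "?ops gs j \<subseteq> ?ops (g # gs) (Suc j)"
    proof
      fix x assume "x \<in> ?ops gs j"
      then obtain i where "i < length gs" "i \<noteq> j" "x = pauli_op n (gs ! i)" by blast
      then show "x \<in> ?ops (g # gs) (Suc j)" by (auto intro!: exI[of _ "Suc i"])
    qed
    from group.mono_generate[OF group_qubit_GL this, of n] ind[of "Suc j"] that show ?thesis by auto
  qed
  then show "stabilizer_generators n gs"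
    using assms sub unfolding stabilizer_generators_def independent_paulis_def by (auto 0 3)
qed

lemma stab_group_Cons:
  assumes "stabilizer_generators n gs" "pauli_op n g \<in> hermitian_paulis n"
    "\<And>M. M \<in> stab_group n gs \<Longrightarrow> pauli_op n g * M = M * pauli_op n g"
  shows "stab_group n (g # gs) = stab_group n gs \<union> (*) (pauli_op n g) ` stab_group n gs"
proof -
  have "pauli_op n ` set gs \<subseteq> hermitian_paulis n"
    using assms(1) pauli_op_hermitian unfolding stabilizer_generators_def by blast
  from generate_insert_commuting[OF assms(2) this] assms(3) show ?thesis
    unfolding stab_group_def by simp
qed

text \<open>Why an old generator stays independent: the other generators together with
  \<open>g\<close> generate a subgroup of the old group and its coset by \<open>g\<close>. The
  subgroup misses the generator by the old independence, and the coset is disjoint from the whole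
  old group.\<close>

lemma stabilizer_generators_Cons:
  assumes gs: "stabilizer_generators n gs" and g: "valid_pauli n g"
    and notin: "pauli_op n g \<notin> stab_group n gs" "- pauli_op n g \<notin> stab_group n gs"
    and comm: "\<And>M. M \<in> stab_group n gs \<Longrightarrow> pauli_op n g * M = M * pauli_op n g"
  shows "stabilizer_generators n (g # gs)"
proof -
  let ?ops = "\<lambda>gs j. {pauli_op n (gs ! i) | i. i < length gs \<and> i \<noteq> j}"
  note G = stabilizer_generators_group[OF gs] and gh = pauli_op_hermitian[OF g]
  have Cons: "stab_group n (g # gs) = stab_group n gs \<union> (*) (pauli_op n g) ` stab_group n gs"
    by (rule stab_group_Cons[OF gs gh comm])
  have ext: "stabilizer_group n (stab_group n (g # gs))"
    unfolding Cons by (rule stabilizer_group_extend(1)[OF G gh notin comm])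
  have valid: "pauli_op n ` set gs \<subseteq> hermitian_paulis n"
    using gs pauli_op_hermitian unfolding stabilizer_generators_def by blast
  have "pauli_op n ((g # gs) ! j) \<notin> generate (qubit_GL n) (?ops (g # gs) j)"
    if "j < Suc (length gs)" for j
  proof (cases j)
    case 0
    have "?ops (g # gs) 0 \<subseteq> pauli_op n ` set gs"
      by (auto simp: nth_Cons')
    from group.mono_generate[OF group_qubit_GL this, of n] notin 0 show ?thesis
      by (auto simp: stab_group_def)
  next
    case (Suc m)
    then have m: "m < length gs" using that by simp
    let ?O = "generate (qubit_GL n) (?ops gs m)"
    have ops: "?ops gs m \<subseteq> pauli_op n ` set gs" by auto
    have OG: "?O \<subseteq> stab_group n gs" unfolding stab_group_def by (rule group.mono_generate[OF group_qubit_GL ops])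
    have "?ops (g # gs) (Suc m) \<subseteq> insert (pauli_op n g) (?ops gs m)"
    proof
      fix x assume "x \<in> ?ops (g # gs) (Suc m)"
      then obtain i where "i < Suc (length gs)" "i \<noteq> Suc m" "x = pauli_op n ((g # gs) ! i)" by auto
      then show "x \<in> insert (pauli_op n g) (?ops gs m)" by (cases i) auto
    qed
    from group.mono_generate[OF group_qubit_GL this, of n]
    have "generate (qubit_GL n) (?ops (g # gs) (Suc m)) \<subseteq> ?O \<union> (*) (pauli_op n g) ` ?O"
      using generate_insert_commuting[OF gh, of "?ops gs m"] ops valid comm OG by blast
    moreover have "pauli_op n (gs ! m) \<notin> ?O"
      using gs m unfolding stabilizer_generators_def independent_paulis_def by blast
    moreover have "pauli_op n (gs ! m) \<notin> (*) (pauli_op n g) ` ?O"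
      using coset_disjoint[OF G gh notin(1)] OG stab_group_mem[of "gs ! m" gs n] m by auto
    ultimately show ?thesis using Suc by auto
  qed
  then have "independent_paulis n (g # gs)" unfolding independent_paulis_def by simp
  then show ?thesis
    using gs g stabilizer_groupD[OF ext] unfolding stabilizer_generators_def by auto
qed

lemma card_stab_group: "stabilizer_generators n gs \<Longrightarrow> card (stab_group n gs) = 2 ^ length gs"
proof (induction gs)
  case (Cons g gs)
  note D = stabilizer_generators_ConsD[OF Cons.prems]
  show ?case
    using stabilizer_group_extend(2)[OF stabilizer_generators_group[OF D(1)] D(2-5)]
      stab_group_Cons[OF D(1,2,5)] Cons.IH[OF D(1)] by simp
qed (simp add: stab_group_Nil)

lemma stabilizer_generators_Nil: "stabilizer_generators n []"
  using hermitian_pauli_neq_uminus[OF one_hermitian_pauli, of n] one_hermitian_pauli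
  unfolding stabilizer_generators_def independent_paulis_def stab_group_Nil by simp

text \<open>Forgetting the signs turns a stabilizer group into an isotropic subspace of the binary
  symplectic space.\<close>

definition pauli_vectors :: "nat \<Rightarrow> complex mat set \<Rightarrow> bool list set" where
  "pauli_vectors n H = {v. length v = 2 * n \<and> (scaled_pauli n v 1 \<in> H \<or> scaled_pauli n v (-1) \<in> H)}"

lemma finite_pauli_vectors [simp]: "finite (pauli_vectors n H)"
  unfolding pauli_vectors_def by (rule finite_subset[OF _ finite_bool_lists[of "2 * n"]]) auto

lemma pauli_vectorsE:
  assumes "v \<in> pauli_vectors n H"
  obtains c where "length v = 2 * n" "c = 1 \<or> c = -1" "scaled_pauli n v c \<in> H"
  using assms unfolding pauli_vectors_def by blast

lemma pauli_vectorsI: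
  "length v = 2 * n \<Longrightarrow> c = 1 \<or> c = -1 \<Longrightarrow> scaled_pauli n v c \<in> H \<Longrightarrow> v \<in> pauli_vectors n H"
  unfolding pauli_vectors_def by blast

lemma card_pauli_vectors:
  assumes "H \<subseteq> hermitian_paulis n" "\<And>M. M \<in> H \<Longrightarrow> - M \<notin> H"
  shows "card (pauli_vectors n H) = card H"
proof -
  define f where "f v = scaled_pauli n v (if scaled_pauli n v 1 \<in> H then 1 else -1)" for v
  have "bij_betw f (pauli_vectors n H) H"
    unfolding bij_betw_def
  proof
    show "inj_on f (pauli_vectors n H)"
    proof (rule inj_onI)
      fix v w assume "v \<in> pauli_vectors n H" "w \<in> pauli_vectors n H" "f v = f w"
      then show "v = w"
        using scaled_pauli_inject[of n v "if scaled_pauli n v 1 \<in> H then 1 else -1" w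
          "if scaled_pauli n w 1 \<in> H then 1 else -1"]
        by (simp add: f_def pauli_vectors_def split: if_splits)
    qed
    show "f ` pauli_vectors n H = H"
    proof
      show "f ` pauli_vectors n H \<subseteq> H" by (auto simp: f_def pauli_vectors_def)
      show "H \<subseteq> f ` pauli_vectors n H"
      proof
        fix M assume M: "M \<in> H"
        then have "M \<in> hermitian_paulis n" using assms(1) by blast
        then obtain v c where v: "length v = 2 * n" "c = 1 \<or> c = -1" "M = scaled_pauli n v c"
          by (rule hermitian_pauliE)
        have "f v = M"
          using v(2,3) M assms(2)[OF M] by (auto simp: f_def scaled_pauli_uminus)
        moreover have "v \<in> pauli_vectors n H" by (rule pauli_vectorsI[OF v(1,2)]) (use M v in simp)
        ultimately show "M \<in> f ` pauli_vectors n H" by blast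
      qed
    qed
  qed
  then show ?thesis by (rule bij_betw_same_card)
qed

text \<open>Orthogonality of characters: if some \<open>u\<close> in \<open>V\<close> has sign
  \<open>-1\<close>, translation by \<open>u\<close> permutes \<open>V\<close> and negates the
  sum.\<close>

lemma sum_comm_sign:
  assumes V: "V \<subseteq> {v. length v = 2 * n}" "\<And>u v. u \<in> V \<Longrightarrow> v \<in> V \<Longrightarrow> vxor u v \<in> V"
  shows "(\<Sum>v\<in>V. comm_sign n v w) = (if \<forall>v\<in>V. comm_sign n v w = 1 then of_nat (card V) else 0)"
proof (cases "\<forall>v\<in>V. comm_sign n v w = 1")
  case False
  then obtain u where u: "u \<in> V" "comm_sign n u w = -1" using comm_sign_cases by metis
  have [simp]: "vxor u (vxor u v) = v" if "v \<in> V" for v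
  proof (rule vxor_cancel)
    have "length u = 2 * n" "length v = 2 * n" using V(1) u(1) that by auto
    then show "length u = length v" by simp
  qed
  have [simp]: "vxor u v \<in> V" if "v \<in> V" for v using V(2)[OF u(1) that] .
  have "(\<Sum>v\<in>V. comm_sign n v w) = (\<Sum>v\<in>V. comm_sign n (vxor u v) w)"
    by (rule sum.reindex_bij_witness[where i = "vxor u" and j = "vxor u"]) simp_all
  also have "\<dots> = (\<Sum>v\<in>V. - comm_sign n v w)"
  proof (rule sum.cong[OF refl])
    fix v assume "v \<in> V"
    with V(1) u(1) have "length u = 2 * n" "length v = 2 * n" by auto
    then show "comm_sign n (vxor u v) w = - comm_sign n v w"
      using comm_sign_vxor[of u n v w] u(2) by simp
  qed
  finally have "(\<Sum>v\<in>V. comm_sign n v w) = 0" by (simp add: sum_negf)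
  with False show ?thesis by auto
qed simp

lemma card_commutant:
  assumes V: "V \<subseteq> {v. length v = 2 * n}" "\<And>u v. u \<in> V \<Longrightarrow> v \<in> V \<Longrightarrow> vxor u v \<in> V"
    and zero: "zeros (2 * n) \<in> V"
  shows "card V * card {w. length w = 2 * n \<and> (\<forall>v\<in>V. comm_sign n v w = 1)} = 2 ^ (2 * n)"
proof -
  \<comment> \<open>Evaluate the sum of \<^term>\<open>comm_sign n v w\<close> over \<^term>\<open>v \<in> V\<close> and all \<^term>\<open>w\<close> in both orders.\<close>
  let ?U = "{w :: bool list. length w = 2 * n}"
  let ?C = "{w. length w = 2 * n \<and> (\<forall>v\<in>V. comm_sign n v w = 1)}"
  have finV: "finite V" by (rule finite_subset[OF V(1)]) simp
  have "(\<Sum>w\<in>?U. \<Sum>v\<in>V. comm_sign n v w) =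
      (\<Sum>w\<in>?U. if w \<in> ?C then of_nat (card V) else (0 :: complex))"
    by (rule sum.cong) (use sum_comm_sign[OF V] in auto)
  also have "\<dots> = of_nat (card V * card ?C)"
    by (subst sum.inter_restrict[symmetric]) (auto intro!: arg_cong[where f = card] disjI2)
  finally have 1: "(\<Sum>w\<in>?U. \<Sum>v\<in>V. comm_sign n v w) = of_nat (card V * card ?C)" .
  have "(\<Sum>v\<in>V. \<Sum>w\<in>?U. comm_sign n v w) = (\<Sum>v\<in>V. if v = zeros (2 * n) then 2 ^ (2 * n) else 0)"
  proof (rule sum.cong[OF refl])
    fix v assume "v \<in> V"
    then have v: "length v = 2 * n" using V by auto
    have "(\<Sum>w\<in>?U. comm_sign n v w) = (\<Sum>w\<in>?U. comm_sign n w v)"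
      by (rule sum.cong) (auto simp: comm_sign_commute)
    also have "\<dots> = (if \<forall>w\<in>?U. comm_sign n w v = 1 then of_nat (card ?U) else 0)"
      by (rule sum_comm_sign) auto
    also have "(\<forall>w\<in>?U. comm_sign n w v = 1) \<longleftrightarrow> v = zeros (2 * n)"
    proof
      assume *: "\<forall>w\<in>?U. comm_sign n w v = 1"
      show "v = zeros (2 * n)"
      proof (rule ccontr)
        assume "v \<noteq> zeros (2 * n)"
        then obtain w where "length w = 2 * n" "comm_sign n v w = -1"
          using comm_sign_nondegenerate[OF v] by blast
        then have "comm_sign n w v = -1" using comm_sign_commute by metis
        with * \<open>length w = 2 * n\<close> show False by auto
      qed
    next
      assume "v = zeros (2 * n)"
      then show "\<forall>w\<in>?U. comm_sign n w v = 1"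
        by (auto simp: comm_sign_def comm1_def intro!: prod.neutral)
    qed
    finally show "(\<Sum>w\<in>?U. comm_sign n v w) = (if v = zeros (2 * n) then 2 ^ (2 * n) else 0)"
      by (simp add: card_bool_lists)
  qed
  also have "\<dots> = 2 ^ (2 * n)" using zero finV by simp
  finally have "(\<Sum>w\<in>?U. \<Sum>v\<in>V. comm_sign n v w) = of_nat (2 ^ (2 * n))"
    by (subst sum.swap) simp
  with 1 have "complex_of_nat (card V * card ?C) = of_nat (2 ^ (2 * n))" by (simp only:)
  then show ?thesis by (simp only: of_nat_eq_iff)
qed

lemma pauli_vectors_group:
  assumes "stabilizer_group n H"
  shows "pauli_vectors n H \<subseteq> {v. length v = 2 * n}"
    "\<And>u v. u \<in> pauli_vectors n H \<Longrightarrow> v \<in> pauli_vectors n H \<Longrightarrow> vxor u v \<in> pauli_vectors n H"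
    "zeros (2 * n) \<in> pauli_vectors n H"
    "card (pauli_vectors n H) = card H"
    "\<And>u v. u \<in> pauli_vectors n H \<Longrightarrow> v \<in> pauli_vectors n H \<Longrightarrow> comm_sign n u v = 1"
proof -
  note D = stabilizer_groupD[OF assms]
  show "pauli_vectors n H \<subseteq> {v. length v = 2 * n}" by (auto simp: pauli_vectors_def)
  show "zeros (2 * n) \<in> pauli_vectors n H"
    using D(2) by (simp add: pauli_vectors_def scaled_pauli_one)
  show "card (pauli_vectors n H) = card H"
    by (rule card_pauli_vectors[OF D(1) stabilizer_group_uminus[OF assms]])
  fix u v assume "u \<in> pauli_vectors n H" "v \<in> pauli_vectors n H"
  then obtain c d where u: "length u = 2 * n" "c = 1 \<or> c = -1" "scaled_pauli n u c \<in> H"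
    and v: "length v = 2 * n" "d = 1 \<or> d = -1" "scaled_pauli n v d \<in> H"
    by (elim pauli_vectorsE)
  show "comm_sign n u v = 1"
    using scaled_pauli_commute_iff[of u n v c d] D(5)[OF u(3) v(3)] u v by auto
  have uv: "scaled_pauli n u c * scaled_pauli n v d \<in> H" using D(4) u v by blast
  obtain w e where w: "length w = 2 * n" "e = 1 \<or> e = -1"
    "scaled_pauli n u c * scaled_pauli n v d = scaled_pauli n w e"
    using D(6)[OF uv] by (rule hermitian_pauliE)
  then have "scaled_pauli n w e = scaled_pauli n (vxor u v) (c * d * phase n u v)"
    using u v by (simp add: scaled_pauli_mult)
  then have "w = vxor u v" using scaled_pauli_inject[of n w e] u v w by auto
  with w uv show "vxor u v \<in> pauli_vectors n H" by (intro pauli_vectorsI[of _ n e]) simp_all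
qed

text \<open>An isotropic space lies in its own commutant, so \<open>card_commutant\<close> bounds
  the square of its order by \<open>2 ^ (2 * n)\<close>.\<close>

lemma stabilizer_group_card_le:
  assumes "stabilizer_group n H"
  shows "card H \<le> 2 ^ n"
proof -
  note V = pauli_vectors_group[OF assms]
  let ?C = "{w. length w = 2 * n \<and> (\<forall>v\<in>pauli_vectors n H. comm_sign n v w = 1)}"
  have "finite ?C" by (rule finite_subset[OF _ finite_bool_lists[of "2 * n"]]) auto
  then have "card (pauli_vectors n H) \<le> card ?C"
    by (rule card_mono) (use V(1,5) in auto)
  then have "card H * card H \<le> card H * card ?C" unfolding V(4) by (rule mult_le_mono2)
  also have "\<dots> = 2 ^ (2 * n)" using card_commutant[OF V(1-3)] unfolding V(4) .
  finally have "(card H) ^ 2 \<le> (2 ^ n) ^ 2"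
    by (simp only: power2_eq_square mult_2 power_add)
  then show ?thesis by (rule power2_le_imp_le) simp
qed

text \<open>If the group is too small, its commutant has too many elements to be contained in the
  set of its vectors; any vector in the difference gives \<open>N\<close>.\<close>

lemma stabilizer_group_extension:
  assumes H: "stabilizer_group n H" and less: "card H < 2 ^ n"
  obtains N where "N \<in> hermitian_paulis n" "\<And>M. M \<in> H \<Longrightarrow> N * M = M * N" "N \<notin> H" "- N \<notin> H"
proof -
  note V = pauli_vectors_group[OF H]
  let ?C = "{w. length w = 2 * n \<and> (\<forall>v\<in>pauli_vectors n H. comm_sign n v w = 1)}"
  have "\<not> ?C \<subseteq> pauli_vectors n H"
  proof
    assume "?C \<subseteq> pauli_vectors n H"
    from card_mono[OF finite_pauli_vectors this] have "card ?C \<le> card H" unfolding V(4) .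
    then have "card H * card ?C \<le> card H * card H" by (rule mult_le_mono2)
    then have "2 ^ (2 * n) \<le> card H * card H" using card_commutant[OF V(1-3)] unfolding V(4) by (simp only:)
    moreover have "card H * card H < 2 ^ n * 2 ^ n" by (rule mult_strict_mono) (use less in auto)
    ultimately show False unfolding mult_2 power_add using leD by blast
  qed
  then obtain w where w: "length w = 2 * n" "w \<notin> pauli_vectors n H"
    "\<forall>v\<in>pauli_vectors n H. comm_sign n v w = 1" by blast
  show ?thesis
  proof (rule that)
    show "scaled_pauli n w 1 \<in> hermitian_paulis n" by (rule hermitian_pauliI) (use w in auto)
    show "scaled_pauli n w 1 \<notin> H" "- scaled_pauli n w 1 \<notin> H"
      using w by (auto simp: pauli_vectors_def scaled_pauli_uminus)
    fix M assume M: "M \<in> H"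
    obtain v c where v: "length v = 2 * n" "c = 1 \<or> c = -1" "M = scaled_pauli n v c"
      using stabilizer_groupD(6)[OF H M] by (rule hermitian_pauliE)
    then have "v \<in> pauli_vectors n H" using M by (intro pauli_vectorsI[of _ n c]) simp_all
    with v show "scaled_pauli n w 1 * M = M * scaled_pauli n w 1"
      using scaled_pauli_commute_iff[of v n w c 1] w by auto
  qed
qed

text \<open>Pure stabilizer states are defined through lists of generators, while extension
  arguments produce groups. Generators are picked greedily: \<open>m < n\<close> of them generate
  only \<open>2 ^ m\<close> elements, so a further element exists.\<close>

lemma maximal_group_generators:
  assumes H: "stabilizer_group n H" "card H = 2 ^ n"
  shows "\<exists>gs. stabilizer_generators n gs \<and> length gs = n \<and> stab_group n gs = H"
proof -
  note D = stabilizer_groupD[OF H(1)]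
  have "\<exists>gs. stabilizer_generators n gs \<and> length gs = m \<and> stab_group n gs \<subseteq> H" if "m \<le> n" for m
    using that
  proof (induction m)
    case 0
    then show ?case using stabilizer_generators_Nil D(2) stab_group_Nil by (intro exI[of _ "[]"]) auto
  next
    case (Suc m)
    then obtain gs where gs: "stabilizer_generators n gs" "length gs = m" "stab_group n gs \<subseteq> H" by auto
    have "card (stab_group n gs) < card H"
      using card_stab_group[OF gs(1)] gs(2) H(2) Suc.prems by simp
    then have "stab_group n gs \<noteq> H" by auto
    then obtain h where h: "h \<in> H" "h \<notin> stab_group n gs" using gs(3) by blast
    then obtain p where p: "valid_pauli n p" "h = pauli_op n p"
      using D(6)[OF h(1)] unfolding hermitian_paulis_def by blast
    have comm: "pauli_op n p * M = M * pauli_op n p" if "M \<in> stab_group n gs" for M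
      using D(5)[OF h(1)] gs(3) that p(2) by blast
    have m: "- pauli_op n p \<notin> stab_group n gs"
      using stabilizer_group_uminus[OF H(1) h(1)] gs(3) p(2) by blast
    have "stabilizer_generators n (p # gs)"
      by (rule stabilizer_generators_Cons[OF gs(1) p(1) _ m comm]) (use h p in auto)
    moreover have "stab_group n (p # gs) \<subseteq> H"
      using stab_group_Cons[OF gs(1) pauli_op_hermitian[OF p(1)] comm] gs(3) D(4)[OF h(1)] p(2) by auto
    ultimately show ?case using gs(2) by (intro exI[of _ "p # gs"]) simp
  qed
  then obtain gs where gs: "stabilizer_generators n gs" "length gs = n" "stab_group n gs \<subseteq> H" by blast
  then have "stab_group n gs = H"
    using card_subset_eq[OF D(8) gs(3)] card_stab_group[OF gs(1)] H(2) by simp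
  with gs show ?thesis by blast
qed

section \<open>Stabilizer states as normalised group sums, and their affine combinations\<close>

section \<open>Stabilizer states\<close>

definition mat_sum :: "nat \<Rightarrow> complex mat set \<Rightarrow> complex mat" where
  "mat_sum d S = mat d d (\<lambda>(i, j). \<Sum>M\<in>S. M $$ (i, j))"

text \<open>For a stabilizer group this is the maximally mixed state on its common \<open>+1\<close>
  eigenspace, which is pure exactly when the group has \<open>2 ^ n\<close> elements.\<close>

definition stab_state :: "nat \<Rightarrow> complex mat set \<Rightarrow> complex mat" where
  "stab_state n H = (1 / 2 ^ n) \<cdot>\<^sub>m mat_sum (2 ^ n) H"

lemma mat_sum_carrier [simp]: "mat_sum d S \<in> carrier_mat d d"
  by (simp add: mat_sum_def)

lemma mat_sum_entry [simp]: "i < d \<Longrightarrow> j < d \<Longrightarrow> mat_sum d S $$ (i, j) = (\<Sum>M\<in>S. M $$ (i, j))"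
  by (simp add: mat_sum_def)

lemma mat_sum_dim [simp]: "dim_row (mat_sum d S) = d" "dim_col (mat_sum d S) = d"
  by (simp_all add: mat_sum_def)

lemma stab_state_carrier [simp]: "stab_state n H \<in> carrier_mat (2 ^ n) (2 ^ n)"
  by (simp add: stab_state_def)

lemma stab_state_dim [simp]: "dim_row (stab_state n H) = 2 ^ n" "dim_col (stab_state n H) = 2 ^ n"
  by (simp_all add: stab_state_def)

lemma mat_mult_entry:
  "A \<in> carrier_mat d d \<Longrightarrow> B \<in> carrier_mat d d \<Longrightarrow> i < d \<Longrightarrow> j < d \<Longrightarrow>
    (A * B) $$ (i, j) = (\<Sum>k<d. A $$ (i, k) * B $$ (k, j))"
  by (auto simp: scalar_prod_def atLeast0LessThan)

lemma mult_mat_sum: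
  assumes "N \<in> carrier_mat d d" "S \<subseteq> carrier_mat d d" "inj_on ((*) N) S"
  shows "N * mat_sum d S = mat_sum d ((*) N ` S)"
proof (rule eq_matI)
  fix i j assume "i < dim_row (mat_sum d ((*) N ` S))" "j < dim_col (mat_sum d ((*) N ` S))"
  then have ij: "i < d" "j < d" by simp_all
  have "(N * mat_sum d S) $$ (i, j) = (\<Sum>k<d. \<Sum>M\<in>S. N $$ (i, k) * M $$ (k, j))"
    using ij by (simp add: mat_mult_entry[OF assms(1) mat_sum_carrier] sum_distrib_left)
  also have "\<dots> = (\<Sum>M\<in>S. \<Sum>k<d. N $$ (i, k) * M $$ (k, j))" by (rule sum.swap)
  also have "\<dots> = (\<Sum>M\<in>S. (N * M) $$ (i, j))"
    by (rule sum.cong[OF refl]) (use assms(2) ij in \<open>subst mat_mult_entry[OF assms(1)], auto\<close>)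
  also have "\<dots> = mat_sum d ((*) N ` S) $$ (i, j)"
    using ij assms(3) by (simp add: sum.reindex)
  finally show "(N * mat_sum d S) $$ (i, j) = mat_sum d ((*) N ` S) $$ (i, j)" .
qed (use assms in auto)

lemma mat_sum_Un:
  "finite S \<Longrightarrow> finite T \<Longrightarrow> S \<inter> T = {} \<Longrightarrow> mat_sum d (S \<union> T) = mat_sum d S + mat_sum d T"
  by (rule eq_matI) (simp_all add: sum.union_disjoint)

lemma mat_trace_mat_sum_mult:
  assumes "S \<subseteq> carrier_mat d d" "N \<in> carrier_mat d d"
  shows "mat_trace (mat_sum d S * N) = (\<Sum>M\<in>S. mat_trace (M * N))"
proof -
  have "mat_trace (mat_sum d S * N) = (\<Sum>i<d. \<Sum>k<d. \<Sum>M\<in>S. M $$ (i, k) * N $$ (k, i))"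
    by (simp add: mat_trace_def mat_mult_entry[OF mat_sum_carrier assms(2)] sum_distrib_right)
  also have "\<dots> = (\<Sum>i<d. \<Sum>M\<in>S. \<Sum>k<d. M $$ (i, k) * N $$ (k, i))"
    by (rule sum.cong[OF refl]) (rule sum.swap)
  also have "\<dots> = (\<Sum>M\<in>S. \<Sum>i<d. \<Sum>k<d. M $$ (i, k) * N $$ (k, i))" by (rule sum.swap)
  also have "\<dots> = (\<Sum>M\<in>S. mat_trace (M * N))"
  proof (rule sum.cong[OF refl])
    fix M assume "M \<in> S"
    then have M: "M \<in> carrier_mat d d" using assms(1) by blast
    then show "(\<Sum>i<d. \<Sum>k<d. M $$ (i, k) * N $$ (k, i)) = mat_trace (M * N)"
      using mat_mult_entry[OF M assms(2)] by (auto simp: mat_trace_def)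
  qed
  finally show ?thesis .
qed

lemma mult_cnj_norm: "z * cnj z = (complex_of_real (cmod z))\<^sup>2"
  using complex_norm_square[of z] by simp

lemma rank_one_unique:
  fixes M :: "nat \<Rightarrow> nat \<Rightarrow> complex" and \<psi> :: "nat \<Rightarrow> complex"
  assumes herm: "\<And>i j. i < d \<Longrightarrow> j < d \<Longrightarrow> cnj (M i j) = M j i"
    and idem: "\<And>i j. i < d \<Longrightarrow> j < d \<Longrightarrow> (\<Sum>k<d. M i k * M k j) = M i j"
    and trace: "(\<Sum>i<d. M i i) = 1"
    and fix_psi: "\<And>i. i < d \<Longrightarrow> (\<Sum>j<d. M i j * \<psi> j) = \<psi> i"
    and unit: "(\<Sum>i<d. \<psi> i * cnj (\<psi> i)) = 1"
    and ij: "i < d" "j < d"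
  shows "M i j = \<psi> i * cnj (\<psi> j)"
proof -
  \<comment> \<open>The Hilbert-Schmidt norm of \<open>M - \<psi> \<psi>\<^sup>*\<close> vanishes.\<close>
  define X where "X i j = M i j - \<psi> i * cnj (\<psi> j)" for i j
  have fix_psi': "(\<Sum>i<d. M j i * cnj (\<psi> j) * \<psi> i) = cnj (\<psi> j) * \<psi> j" if "j < d" for j
    using fix_psi[OF that] by (simp add: sum_distrib_left[symmetric] mult.assoc mult.left_commute)
  \<comment> \<open>Each of the four sums in the expansion equals 1: the trace of the square of
    \<open>M\<close>, twice the expectation value of \<open>M\<close> in the unit vector, and a
    product of two squared norms. With their signs they cancel.\<close>
  have "X i j * cnj (X i j) = M i j * M j i - M i j * cnj (\<psi> i) * \<psi> j
      - M j i * cnj (\<psi> j) * \<psi> i + (\<psi> i * cnj (\<psi> i)) * (\<psi> j * cnj (\<psi> j))"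
    if "i < d" "j < d" for i j
    using herm[OF that] by (simp add: X_def algebra_simps)
  then have "(\<Sum>i<d. \<Sum>j<d. X i j * cnj (X i j)) =
      (\<Sum>i<d. \<Sum>j<d. M i j * M j i) - (\<Sum>i<d. \<Sum>j<d. M i j * cnj (\<psi> i) * \<psi> j)
      - (\<Sum>i<d. \<Sum>j<d. M j i * cnj (\<psi> j) * \<psi> i)
      + (\<Sum>i<d. \<Sum>j<d. (\<psi> i * cnj (\<psi> i)) * (\<psi> j * cnj (\<psi> j)))"
    by (simp add: sum.distrib sum_subtractf)
  also have "(\<Sum>i<d. \<Sum>j<d. M i j * M j i) = 1" using idem trace by simp
  also have "(\<Sum>i<d. \<Sum>j<d. M i j * cnj (\<psi> i) * \<psi> j) = 1"
    using fix_psi' unit by (simp add: mult.commute)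
  also have "(\<Sum>i<d. \<Sum>j<d. M j i * cnj (\<psi> j) * \<psi> i) = 1"
    by (subst sum.swap) (use fix_psi' unit in \<open>simp add: mult.commute\<close>)
  also have "(\<Sum>i<d. \<Sum>j<d. (\<psi> i * cnj (\<psi> i)) * (\<psi> j * cnj (\<psi> j))) = 1"
    by (simp only: sum_distrib_left[symmetric] sum_distrib_right[symmetric] unit) simp
  finally have "(\<Sum>i<d. \<Sum>j<d. X i j * cnj (X i j)) = 0" by simp
  then have "complex_of_real (\<Sum>i<d. \<Sum>j<d. (cmod (X i j))\<^sup>2) = 0"
    by (simp add: mult_cnj_norm)
  then have "(\<Sum>i<d. \<Sum>j<d. (cmod (X i j))\<^sup>2) = 0" by (simp only: of_real_eq_0_iff)
  then have "(\<Sum>j<d. (cmod (X i j))\<^sup>2) = 0"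
    using ij(1) by (subst (asm) sum_nonneg_eq_0_iff) (auto intro: sum_nonneg)
  then have "(cmod (X i j))\<^sup>2 = 0"
    using ij(2) by (subst (asm) sum_nonneg_eq_0_iff) auto
  then show ?thesis by (simp add: X_def)
qed

text \<open>Every column of an idempotent matrix is fixed by it, and trace 1 provides a nonzero
  diagonal entry. Idempotence and Hermiticity make \<open>M j j\<close> the squared norm of column
  \<open>j\<close>, which serves to normalise it.\<close>

lemma rank_one_exists:
  fixes M :: "nat \<Rightarrow> nat \<Rightarrow> complex"
  assumes herm: "\<And>i j. i < d \<Longrightarrow> j < d \<Longrightarrow> cnj (M i j) = M j i"
    and idem: "\<And>i j. i < d \<Longrightarrow> j < d \<Longrightarrow> (\<Sum>k<d. M i k * M k j) = M i j"
    and trace: "(\<Sum>i<d. M i i) = 1"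
  obtains \<psi> where "(\<Sum>i<d. \<psi> i * cnj (\<psi> i)) = 1" "\<And>i. i < d \<Longrightarrow> (\<Sum>j<d. M i j * \<psi> j) = \<psi> i"
proof -
  obtain j where j: "j < d" "M j j \<noteq> 0"
    using trace by (metis (no_types, lifting) lessThan_iff sum.neutral zero_neq_one)
  have "M j j = (\<Sum>k<d. M j k * M k j)" using idem j by simp
  also have "\<dots> = (\<Sum>k<d. M k j * cnj (M k j))"
    by (rule sum.cong) (use herm j in \<open>auto simp: mult.commute\<close>)
  finally have Mjj: "M j j = (\<Sum>k<d. M k j * cnj (M k j))" .
  also have "\<dots> = complex_of_real (\<Sum>k<d. (cmod (M k j))\<^sup>2)" by (simp add: mult_cnj_norm)
  finally have real: "M j j = complex_of_real (\<Sum>k<d. (cmod (M k j))\<^sup>2)" .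
  define r where "r = (\<Sum>k<d. (cmod (M k j))\<^sup>2)"
  have r: "M j j = complex_of_real r" "r \<ge> 0" unfolding r_def using real by (auto intro: sum_nonneg)
  then have r0: "r > 0" using j by (cases "r = 0") auto
  define \<psi> where "\<psi> i = M i j / complex_of_real (sqrt r)" for i
  have sq: "complex_of_real (sqrt r) * complex_of_real (sqrt r) = complex_of_real r"
    using r0 by (simp flip: of_real_mult)
  have "(\<Sum>i<d. \<psi> i * cnj (\<psi> i)) = (\<Sum>i<d. M i j * cnj (M i j)) / complex_of_real r"
    by (simp add: \<psi>_def sq sum_divide_distrib)
  also have "\<dots> = 1" unfolding Mjj[symmetric] r(1) using r0 by simp
  finally have 1: "(\<Sum>i<d. \<psi> i * cnj (\<psi> i)) = 1" .
  have 2: "(\<Sum>k<d. M i k * \<psi> k) = \<psi> i" if "i < d" for i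
    using idem[OF that j(1)] by (simp add: \<psi>_def sum_divide_distrib[symmetric])
  show ?thesis by (rule that[OF 1 2])
qed

lemma coset_self:
  assumes "stabilizer_group n H" "N \<in> H"
  shows "(*) N ` H = H"
proof
  show "(*) N ` H \<subseteq> H" using stabilizer_groupD(4)[OF assms(1,2)] by blast
  show "H \<subseteq> (*) N ` H"
    using coset_mem_iff[OF assms(1) stabilizer_groupD(6)[OF assms]] stabilizer_groupD(4)[OF assms]
      stabilizer_groupD(7)[OF assms(1)] by blast
qed

lemma mult_stab_sum:
  assumes "stabilizer_group n H" "N \<in> H"
  shows "N * mat_sum (2 ^ n) H = mat_sum (2 ^ n) H"
proof -
  note D = stabilizer_groupD[OF assms(1)]
  have "N * mat_sum (2 ^ n) H = mat_sum (2 ^ n) ((*) N ` H)"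
    by (rule mult_mat_sum) (use D assms inj_on_coset in auto)
  then show ?thesis by (simp add: coset_self[OF assms])
qed

text \<open>Stated entrywise to match the hypotheses of the two rank-one lemmas. Each group element
  fixes the group sum, which gives idempotence, and in the group only the identity has nonzero
  trace.\<close>

lemma stab_state_projector:
  assumes H: "stabilizer_group n H" "card H = 2 ^ n"
  defines "M \<equiv> \<lambda>i j. stab_state n H $$ (i, j)"
  shows "\<And>i j. i < 2 ^ n \<Longrightarrow> j < 2 ^ n \<Longrightarrow> cnj (M i j) = M j i"
    and "\<And>i j. i < 2 ^ n \<Longrightarrow> j < 2 ^ n \<Longrightarrow> (\<Sum>k<2 ^ n. M i k * M k j) = M i j"
    and "(\<Sum>i<2 ^ n. M i i) = 1"
proof -
  note D = stabilizer_groupD[OF H(1)]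
  have M: "M i j = (\<Sum>N\<in>H. N $$ (i, j)) / 2 ^ n" if "i < 2 ^ n" "j < 2 ^ n" for i j
    using that by (simp add: M_def stab_state_def)
  show "cnj (M i j) = M j i" if ij: "i < 2 ^ n" "j < 2 ^ n" for i j
  proof -
    have "cnj (N $$ (i, j)) = N $$ (j, i)" if "N \<in> H" for N
      by (rule hermitian_pauliE[OF D(6)[OF that]]) (use scaled_pauli_hermitian ij in simp)
    then show ?thesis using ij by (simp add: M)
  qed
  show "(\<Sum>k<2 ^ n. M i k * M k j) = M i j" if ij: "i < 2 ^ n" "j < 2 ^ n" for i j
  proof -
    let ?S = "mat_sum (2 ^ n) H"
    have "(\<Sum>k<2 ^ n. M i k * M k j) = (\<Sum>k<2 ^ n. \<Sum>N\<in>H. N $$ (i, k) * ?S $$ (k, j)) / (2 ^ n * 2 ^ n)"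
      using ij by (simp add: M sum_divide_distrib[symmetric] sum_distrib_right[symmetric])
    also have "(\<Sum>k<2 ^ n. \<Sum>N\<in>H. N $$ (i, k) * ?S $$ (k, j)) =
      (\<Sum>N\<in>H. \<Sum>k<2 ^ n. N $$ (i, k) * ?S $$ (k, j))" by (rule sum.swap)
    also have "\<dots> = (\<Sum>N\<in>H. (N * ?S) $$ (i, j))"
      by (rule sum.cong[OF refl], rule mat_mult_entry[symmetric, OF D(7) mat_sum_carrier ij])
    also have "\<dots> = (\<Sum>N\<in>H. ?S $$ (i, j))"
      by (rule sum.cong[OF refl]) (simp only: mult_stab_sum[OF H(1)])
    also have "\<dots> = 2 ^ n * ?S $$ (i, j)" using H(2) by simp
    finally show ?thesis using ij by (simp add: M)
  qed
  have "(\<Sum>i<2 ^ n. \<Sum>N\<in>H. N $$ (i, i)) = (\<Sum>N\<in>H. mat_trace N)"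
    by (subst sum.swap, rule sum.cong[OF refl]) (use carrier_matD(1)[OF D(7)] in \<open>simp add: mat_trace_def\<close>)
  also have "\<dots> = (\<Sum>N\<in>H. if N = 1\<^sub>m (2 ^ n) then 2 ^ n else 0)"
  proof (rule sum.cong[OF refl])
    fix N assume N: "N \<in> H"
    have "mat_trace N = mat_trace (N * 1\<^sub>m (2 ^ n))"
      by (simp only: right_mult_one_mat[OF D(7)[OF N]])
    moreover have "N \<noteq> - 1\<^sub>m (2 ^ n)" using N D(3) by blast
    ultimately show "mat_trace N = (if N = 1\<^sub>m (2 ^ n) then 2 ^ n else 0)"
      using hermitian_pauli_trace[OF D(6)[OF N] one_hermitian_pauli] by simp
  qed
  also have "\<dots> = 2 ^ n" using D(2,8) by simp
  finally show "(\<Sum>i<2 ^ n. M i i) = 1"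
    by (simp add: M sum_divide_distrib[symmetric])
qed

lemma mult_mat_vec_entry:
  "A \<in> carrier_mat d d \<Longrightarrow> \<psi> \<in> carrier_vec d \<Longrightarrow> i < d \<Longrightarrow>
    (A *\<^sub>v \<psi>) $ i = (\<Sum>j<d. A $$ (i, j) * \<psi> $ j)"
  by (auto simp: scalar_prod_def atLeast0LessThan)

text \<open>The vector is fixed by each group element, hence by their average; this is a Hermitian
  projector of trace 1, which is determined by a unit vector it fixes.\<close>

lemma pure_stabilizer_stateD:
  assumes "\<sigma> \<in> pure_stabilizer_states n"
  obtains H where "stabilizer_group n H" "card H = 2 ^ n" "\<sigma> = stab_state n H"
proof -
  from assms obtain \<psi> gs where psi: "\<psi> \<in> carrier_vec (2 ^ n)" "(\<Sum>i<2 ^ n. (cmod (\<psi> $ i))\<^sup>2) = 1"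
    and gs: "stabilizer_generators n gs" "length gs = n"
    and fix_psi: "\<forall>g\<in>stab_group n gs. g *\<^sub>v \<psi> = \<psi>"
    and sigma: "\<sigma> = mat (2 ^ n) (2 ^ n) (\<lambda>(i, j). \<psi> $ i * cnj (\<psi> $ j))"
    unfolding pure_stabilizer_states_def by blast
  let ?H = "stab_group n gs"
  note H = stabilizer_generators_group[OF gs(1)]
  have card: "card ?H = 2 ^ n" using card_stab_group[OF gs(1)] gs(2) by simp
  note D = stabilizer_groupD[OF H]
  have f: "(\<Sum>j<2 ^ n. stab_state n ?H $$ (i, j) * \<psi> $ j) = \<psi> $ i" if i: "i < 2 ^ n" for i
  proof -
    have "(\<Sum>j<2 ^ n. stab_state n ?H $$ (i, j) * \<psi> $ j) =
        (\<Sum>j<2 ^ n. \<Sum>N\<in>?H. N $$ (i, j) * \<psi> $ j) / 2 ^ n"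
      using i by (simp add: stab_state_def sum_divide_distrib sum_distrib_right)
    also have "(\<Sum>j<2 ^ n. \<Sum>N\<in>?H. N $$ (i, j) * \<psi> $ j) = (\<Sum>N\<in>?H. \<Sum>j<2 ^ n. N $$ (i, j) * \<psi> $ j)"
      by (rule sum.swap)
    also have "\<dots> = (\<Sum>N\<in>?H. (N *\<^sub>v \<psi>) $ i)"
      by (rule sum.cong[OF refl], rule mult_mat_vec_entry[symmetric, OF D(7) psi(1) i])
    also have "\<dots> = (\<Sum>N\<in>?H. \<psi> $ i)" by (rule sum.cong[OF refl]) (use fix_psi in simp)
    finally show ?thesis using card by simp
  qed
  have "(\<Sum>i<2 ^ n. \<psi> $ i * cnj (\<psi> $ i)) = complex_of_real (\<Sum>i<2 ^ n. (cmod (\<psi> $ i))\<^sup>2)"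
    by (simp add: mult_cnj_norm)
  then have u: "(\<Sum>i<2 ^ n. \<psi> $ i * cnj (\<psi> $ i)) = 1" using psi(2) by simp
  have "\<sigma> = stab_state n ?H"
  proof (rule eq_matI)
    fix i j assume "i < dim_row (stab_state n ?H)" "j < dim_col (stab_state n ?H)"
    then have ij: "i < 2 ^ n" "j < 2 ^ n" using stab_state_carrier[of n ?H] by auto
    show "\<sigma> $$ (i, j) = stab_state n ?H $$ (i, j)"
      using rank_one_unique[where M = "\<lambda>i j. stab_state n ?H $$ (i, j)" and \<psi> = "\<lambda>i. \<psi> $ i",
          OF stab_state_projector[OF H card] f u ij] ij sigma by simp
  qed (use sigma stab_state_carrier[of n ?H] in auto)
  with H card show ?thesis by (rule that)
qed

lemma pure_stabilizer_stateI:
  assumes H: "stabilizer_group n H" "card H = 2 ^ n"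
  shows "stab_state n H \<in> pure_stabilizer_states n"
proof -
  note P = stab_state_projector[OF H]
  note D = stabilizer_groupD[OF H(1)]
  obtain f where u: "(\<Sum>i<2 ^ n. f i * cnj (f i)) = 1"
    and f: "\<And>i. i < 2 ^ n \<Longrightarrow> (\<Sum>j<2 ^ n. stab_state n H $$ (i, j) * f j) = f i"
    using rank_one_exists[OF P] by blast
  obtain gs where gs: "stabilizer_generators n gs" "length gs = n" "stab_group n gs = H"
    using maximal_group_generators[OF H] by blast
  define \<psi> where "\<psi> = vec (2 ^ n) f"
  have psi: "\<psi> \<in> carrier_vec (2 ^ n)" by (simp add: \<psi>_def)
  have "complex_of_real (\<Sum>i<2 ^ n. (cmod (\<psi> $ i))\<^sup>2) = (\<Sum>i<2 ^ n. f i * cnj (f i))"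
    by (simp add: \<psi>_def mult_cnj_norm)
  then have norm: "(\<Sum>i<2 ^ n. (cmod (\<psi> $ i))\<^sup>2) = 1" using u by (metis of_real_1 of_real_eq_iff)
  have state: "stab_state n H = mat (2 ^ n) (2 ^ n) (\<lambda>(i, j). \<psi> $ i * cnj (\<psi> $ j))"
  proof (rule eq_matI)
    fix i j assume "i < dim_row (mat (2 ^ n) (2 ^ n) (\<lambda>(i, j). \<psi> $ i * cnj (\<psi> $ j)))"
      "j < dim_col (mat (2 ^ n) (2 ^ n) (\<lambda>(i, j). \<psi> $ i * cnj (\<psi> $ j)))"
    then have ij: "i < 2 ^ n" "j < 2 ^ n" by auto
    then show "stab_state n H $$ (i, j) = mat (2 ^ n) (2 ^ n) (\<lambda>(i, j). \<psi> $ i * cnj (\<psi> $ j)) $$ (i, j)"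
      using rank_one_unique[where M = "\<lambda>i j. stab_state n H $$ (i, j)" and \<psi> = f, OF P f u ij]
      by (simp add: \<psi>_def)
  qed (use stab_state_carrier[of n H] in auto)
  have psi_eq: "stab_state n H *\<^sub>v \<psi> = \<psi>"
  proof (rule eq_vecI)
    fix i assume "i < dim_vec \<psi>"
    then have i: "i < 2 ^ n" by (simp add: \<psi>_def)
    show "(stab_state n H *\<^sub>v \<psi>) $ i = \<psi> $ i"
      using f[OF i] i by (simp add: mult_mat_vec_entry[OF stab_state_carrier psi i]) (simp add: \<psi>_def)
  qed (use stab_state_carrier[of n H] in \<open>auto simp: \<psi>_def\<close>)
  have "N *\<^sub>v \<psi> = \<psi>" if "N \<in> H" for N
  proof -
    have "N * stab_state n H = stab_state n H"
      unfolding stab_state_def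
      by (simp add: mult_smult_distrib[OF D(7)[OF that] mat_sum_carrier] mult_stab_sum[OF H(1) that])
    then show ?thesis
      using assoc_mult_mat_vec[OF D(7)[OF that] stab_state_carrier psi] psi_eq by metis
  qed
  then show ?thesis
    unfolding pure_stabilizer_states_def using psi norm gs state by blast
qed

section \<open>Decompositions into pure stabilizer states\<close>

text \<open>Total weight and norm are separate parameters so that decompositions can be scaled and
  added. The norm is only bounded because coefficients of a common state may cancel in a
  sum.\<close>

definition decomposable :: "nat \<Rightarrow> complex mat \<Rightarrow> real \<Rightarrow> real \<Rightarrow> bool" where
  "decomposable n M c r \<longleftrightarrow> (\<exists>S (x :: complex mat \<Rightarrow> real).
     finite S \<and> S \<subseteq> pure_stabilizer_states n \<and>
     M = mat (2 ^ n) (2 ^ n) (\<lambda>(i, j). \<Sum>\<sigma>\<in>S. of_real (x \<sigma>) * \<sigma> $$ (i, j)) \<and>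
     (\<Sum>\<sigma>\<in>S. x \<sigma>) = c \<and> (\<Sum>\<sigma>\<in>S. \<bar>x \<sigma>\<bar>) \<le> r)"

lemma decomposable_pure:
  assumes "\<sigma> \<in> pure_stabilizer_states n"
  shows "decomposable n \<sigma> 1 1"
proof -
  have "\<sigma> \<in> carrier_mat (2 ^ n) (2 ^ n)"
    using assms stab_state_carrier by (metis pure_stabilizer_stateD)
  then have "\<sigma> = mat (2 ^ n) (2 ^ n) (\<lambda>(i, j). \<Sum>\<tau>\<in>{\<sigma>}. of_real 1 * \<tau> $$ (i, j))"
    by (intro eq_matI) auto
  then show ?thesis
    unfolding decomposable_def using assms
    by (intro exI[of _ "{\<sigma>}"] exI[of _ "\<lambda>_. 1"]) simp
qed

lemma decomposable_smult:
  assumes "decomposable n M c r"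
  shows "decomposable n (complex_of_real a \<cdot>\<^sub>m M) (a * c) (\<bar>a\<bar> * r)"
proof -
  from assms obtain S x where S: "finite S" "S \<subseteq> pure_stabilizer_states n"
    "M = mat (2 ^ n) (2 ^ n) (\<lambda>(i, j). \<Sum>\<sigma>\<in>S. of_real (x \<sigma>) * \<sigma> $$ (i, j))"
    "(\<Sum>\<sigma>\<in>S. x \<sigma>) = c" "(\<Sum>\<sigma>\<in>S. \<bar>x \<sigma>\<bar>) \<le> r"
    unfolding decomposable_def by blast
  have "complex_of_real a \<cdot>\<^sub>m M = mat (2 ^ n) (2 ^ n) (\<lambda>(i, j). \<Sum>\<sigma>\<in>S. of_real (a * x \<sigma>) * \<sigma> $$ (i, j))"
    unfolding S(3) by (intro eq_matI) (simp_all add: sum_distrib_left mult.assoc)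
  moreover have "(\<Sum>\<sigma>\<in>S. a * x \<sigma>) = a * c" using S(4) by (simp add: sum_distrib_left[symmetric])
  moreover have "(\<Sum>\<sigma>\<in>S. \<bar>a * x \<sigma>\<bar>) \<le> \<bar>a\<bar> * r"
    using S(5) by (simp add: abs_mult sum_distrib_left[symmetric] mult_left_mono)
  ultimately show ?thesis
    unfolding decomposable_def
    by (intro exI[of _ S] exI[of _ "\<lambda>\<sigma>. a * x \<sigma>"] conjI S(1,2)) assumption+
qed

text \<open>The two-argument \<open>f\<close> covers matrix entries, weights and absolute values at
  once.\<close>

lemma sum_extend_by_zero:
  fixes f :: "real \<Rightarrow> 'b \<Rightarrow> 'a :: comm_monoid_add"
  assumes "finite S" "finite T" "\<And>\<sigma>. f 0 \<sigma> = 0"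
  shows "(\<Sum>\<sigma>\<in>S \<union> T. f (if \<sigma> \<in> S then x \<sigma> else 0) \<sigma>) = (\<Sum>\<sigma>\<in>S. f (x \<sigma>) \<sigma>)"
    "(\<Sum>\<sigma>\<in>T \<union> S. f (if \<sigma> \<in> S then x \<sigma> else 0) \<sigma>) = (\<Sum>\<sigma>\<in>S. f (x \<sigma>) \<sigma>)"
  by (rule sum.mono_neutral_cong_right; use assms in auto)+

lemma decomposable_add:
  assumes "decomposable n M c r" "decomposable n N d s"
  shows "decomposable n (M + N) (c + d) (r + s)"
proof -
  from assms(1) obtain S x where S: "finite S" "S \<subseteq> pure_stabilizer_states n"
    "M = mat (2 ^ n) (2 ^ n) (\<lambda>(i, j). \<Sum>\<sigma>\<in>S. of_real (x \<sigma>) * \<sigma> $$ (i, j))"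
    "(\<Sum>\<sigma>\<in>S. x \<sigma>) = c" "(\<Sum>\<sigma>\<in>S. \<bar>x \<sigma>\<bar>) \<le> r"
    unfolding decomposable_def by blast
  from assms(2) obtain T y where T: "finite T" "T \<subseteq> pure_stabilizer_states n"
    "N = mat (2 ^ n) (2 ^ n) (\<lambda>(i, j). \<Sum>\<sigma>\<in>T. of_real (y \<sigma>) * \<sigma> $$ (i, j))"
    "(\<Sum>\<sigma>\<in>T. y \<sigma>) = d" "(\<Sum>\<sigma>\<in>T. \<bar>y \<sigma>\<bar>) \<le> s"
    unfolding decomposable_def by blast
  define x' y' where "x' \<sigma> = (if \<sigma> \<in> S then x \<sigma> else 0)" and "y' \<sigma> = (if \<sigma> \<in> T then y \<sigma> else 0)" for \<sigma>
  note extS = sum_extend_by_zero(1)[OF S(1) T(1), where x = x, folded x'_def]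
    and extT = sum_extend_by_zero(2)[OF T(1) S(1), where x = y, folded y'_def]
  have "M + N = mat (2 ^ n) (2 ^ n) (\<lambda>(i, j). \<Sum>\<sigma>\<in>S \<union> T. of_real (x' \<sigma> + y' \<sigma>) * \<sigma> $$ (i, j))"
    unfolding S(3) T(3)
    using extS[where f = "\<lambda>a \<sigma>. complex_of_real a * \<sigma> $$ _"]
      extT[where f = "\<lambda>a \<sigma>. complex_of_real a * \<sigma> $$ _"]
    by (intro eq_matI) (simp_all add: distrib_right sum.distrib)
  moreover have "(\<Sum>\<sigma>\<in>S \<union> T. x' \<sigma> + y' \<sigma>) = c + d"
    using extS[where f = "\<lambda>a \<sigma>. a"] extT[where f = "\<lambda>a \<sigma>. a"] S(4) T(4) by (simp add: sum.distrib)
  moreover have "(\<Sum>\<sigma>\<in>S \<union> T. \<bar>x' \<sigma> + y' \<sigma>\<bar>) \<le> r + s"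
  proof -
    have "(\<Sum>\<sigma>\<in>S \<union> T. \<bar>x' \<sigma> + y' \<sigma>\<bar>) \<le> (\<Sum>\<sigma>\<in>S \<union> T. \<bar>x' \<sigma>\<bar> + \<bar>y' \<sigma>\<bar>)"
      by (rule sum_mono) (rule abs_triangle_ineq)
    also have "\<dots> \<le> r + s"
      using extS[where f = "\<lambda>a \<sigma>. \<bar>a\<bar>"] extT[where f = "\<lambda>a \<sigma>. \<bar>a\<bar>"] S(5) T(5) by (simp add: sum.distrib)
    finally show ?thesis .
  qed
  ultimately show ?thesis
    unfolding decomposable_def
    by (intro exI[of _ "S \<union> T"] exI[of _ "\<lambda>\<sigma>. x' \<sigma> + y' \<sigma>"] conjI finite_UnI Un_least S(1,2) T(1,2))
      assumption+
qed

lemma stab_state_extend_entry: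
  assumes H: "stabilizer_group n H" and N: "N \<in> hermitian_paulis n" "N \<notin> H" "- N \<notin> H"
    and ij: "i < 2 ^ n" "j < 2 ^ n"
  shows "stab_state n (H \<union> (*) N ` H) $$ (i, j) =
      ((\<Sum>M\<in>H. M $$ (i, j)) + (\<Sum>M\<in>(*) N ` H. M $$ (i, j))) / 2 ^ n"
    and "stab_state n (H \<union> (*) (- N) ` H) $$ (i, j) =
      ((\<Sum>M\<in>H. M $$ (i, j)) - (\<Sum>M\<in>(*) N ` H. M $$ (i, j))) / 2 ^ n"
proof -
  note D = stabilizer_groupD[OF H]
  have Nc: "N \<in> carrier_mat (2 ^ n) (2 ^ n)" using hermitian_pauli_carrier[OF N(1)] .
  show "stab_state n (H \<union> (*) N ` H) $$ (i, j) =
      ((\<Sum>M\<in>H. M $$ (i, j)) + (\<Sum>M\<in>(*) N ` H. M $$ (i, j))) / 2 ^ n"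
    unfolding stab_state_def mat_sum_Un[OF D(8) finite_imageI[OF D(8)] coset_disjoint[OF H N(1,2)]]
    using ij by simp
  have "(\<Sum>M\<in>(*) (- N) ` H. M $$ (i, j)) = (\<Sum>M\<in>H. (- N * M) $$ (i, j))"
    using inj_on_coset[OF H hermitian_pauli_uminus[OF N(1)]] by (simp add: sum.reindex)
  also have "\<dots> = (\<Sum>M\<in>H. - (N * M) $$ (i, j))"
  proof (rule sum.cong[OF refl])
    fix M assume M: "M \<in> H"
    show "(- N * M) $$ (i, j) = - (N * M) $$ (i, j)"
      unfolding mult_uminus_left[OF Nc D(7)[OF M]] using Nc D(7)[OF M] ij by auto
  qed
  also have "\<dots> = - (\<Sum>M\<in>(*) N ` H. M $$ (i, j))"
    using inj_on_coset[OF H N(1)] by (simp add: sum.reindex sum_negf)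
  finally show "stab_state n (H \<union> (*) (- N) ` H) $$ (i, j) =
      ((\<Sum>M\<in>H. M $$ (i, j)) - (\<Sum>M\<in>(*) N ` H. M $$ (i, j))) / 2 ^ n"
    unfolding stab_state_def
      mat_sum_Un[OF D(8) finite_imageI[OF D(8)] coset_disjoint[OF H hermitian_pauli_uminus[OF N(1)] N(3)]]
    using ij by simp
qed

lemma decomposable_stab_state:
  assumes "stabilizer_group n H"
  shows "decomposable n (stab_state n H) 1 1"
  using assms
proof (induction "2 ^ n - card H" arbitrary: H rule: less_induct)
  case less
  note D = stabilizer_groupD[OF less.prems]
  show ?case
  proof (cases "card H = 2 ^ n")
    case True
    then show ?thesis using decomposable_pure pure_stabilizer_stateI less.prems by blast
  next
    case False
    then have lt: "card H < 2 ^ n" using stabilizer_group_card_le[OF less.prems] by simp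
    obtain N where N: "N \<in> hermitian_paulis n" "\<And>M. M \<in> H \<Longrightarrow> N * M = M * N" "N \<notin> H" "- N \<notin> H"
      using stabilizer_group_extension[OF less.prems lt] by blast
    have Nc: "N \<in> carrier_mat (2 ^ n) (2 ^ n)" using hermitian_pauli_carrier[OF N(1)] .
    have m: "- N * M = M * - N" if "M \<in> H" for M
      using N(2)[OF that] mult_uminus_left[OF Nc D(7)[OF that]] mult_uminus_right[OF D(7)[OF that] Nc] by simp
    let ?P = "H \<union> (*) N ` H" and ?Q = "H \<union> (*) (- N) ` H"
    have mN: "- (- N) \<notin> H" using N(3) by simp
    note P = stabilizer_group_extend[OF less.prems N(1,3,4,2)]
    note Q = stabilizer_group_extend[OF less.prems hermitian_pauli_uminus[OF N(1)] N(4) mN m]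
    have "0 < card H" using D(2,8) by (auto simp: card_gt_0_iff)
    then have "decomposable n (stab_state n ?P) 1 1" "decomposable n (stab_state n ?Q) 1 1"
      using less.hyps[OF _ P(1)] less.hyps[OF _ Q(1)] P(2) Q(2) lt by simp_all
    from decomposable_add[OF decomposable_smult[OF this(1), of "1 / 2"] decomposable_smult[OF this(2), of "1 / 2"]]
    have dec: "decomposable n (complex_of_real (1 / 2) \<cdot>\<^sub>m stab_state n ?P +
      complex_of_real (1 / 2) \<cdot>\<^sub>m stab_state n ?Q) 1 1" by simp
    have "complex_of_real (1 / 2) \<cdot>\<^sub>m stab_state n ?P + complex_of_real (1 / 2) \<cdot>\<^sub>m stab_state n ?Q =
      stab_state n H"
    proof (rule eq_matI)
      fix i j assume "i < dim_row (stab_state n H)" "j < dim_col (stab_state n H)"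
      then have ij: "i < 2 ^ n" "j < 2 ^ n" by simp_all
      then show "(complex_of_real (1 / 2) \<cdot>\<^sub>m stab_state n ?P +
          complex_of_real (1 / 2) \<cdot>\<^sub>m stab_state n ?Q) $$ (i, j) = stab_state n H $$ (i, j)"
        by (simp add: stab_state_extend_entry[OF less.prems N(1,3,4) ij])
          (simp add: stab_state_def field_simps)
    qed simp_all
    with dec show ?thesis by simp
  qed
qed

section \<open>The partial trace on Pauli operators, groups and cosets\<close>

section \<open>Partial traces of Pauli operators\<close>

lemma nths_conv_map: "nths xs I = map ((!) xs) (filter (\<lambda>k. k \<in> I) [0..<length xs])"
proof (induction xs rule: rev_induct)
  case (snoc x xs)
  have "map ((!) (xs @ [x])) (filter (\<lambda>k. k \<in> I) [0..<length xs]) =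
    map ((!) xs) (filter (\<lambda>k. k \<in> I) [0..<length xs])"
    by (rule map_cong) (auto simp: nth_append)
  with snoc show ?case by (auto simp: nths_append nths_singleton)
qed simp

locale qubit_subset =
  fixes L :: nat and A :: "nat set"
  assumes A_subset: "A \<subseteq> {0..<L}"
begin

abbreviation n :: nat where "n \<equiv> card A"

text \<open>The list is increasing, so \<open>sites ! m\<close> is the original label of qubit
  \<open>m\<close> of the reduced state, in the order fixed by \<open>nths\<close> in
  \<open>reduced_state\<close>.\<close>

definition sites :: "nat list" where
  "sites = filter (\<lambda>k. k \<in> A) [0..<L]"

definition restrict :: "bool list \<Rightarrow> bool list" where
  "restrict v = map ((!) v) sites @ map (\<lambda>k. v ! (L + k)) sites"

definition supported :: "bool list \<Rightarrow> bool" where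
  "supported v \<longleftrightarrow> (\<forall>k<L. k \<notin> A \<longrightarrow> \<not> v ! k \<and> \<not> v ! (L + k))"

lemma finite_A: "finite A"
  using A_subset finite_subset by blast

lemma set_sites: "set sites = A"
  using A_subset by (auto simp: sites_def)

lemma distinct_sites: "distinct sites"
  by (simp add: sites_def)

lemma length_sites [simp]: "length sites = n"
  using distinct_card[OF distinct_sites] set_sites by simp

lemma bij_sites: "bij_betw ((!) sites) {..<n} A"
  using bij_betw_nth[OF distinct_sites] set_sites by simp

lemma sites_in_A: "m < n \<Longrightarrow> sites ! m \<in> A"
  using set_sites by (metis length_sites nth_mem)

lemma sites_less: "m < n \<Longrightarrow> sites ! m < L"
  using sites_in_A A_subset by fastforce

lemma site_index:
  assumes "k \<in> A"
  obtains m where "m < n" "sites ! m = k"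
  using assms set_sites by (metis in_set_conv_nth length_sites)

lemma n_le_L: "n \<le> L"
  using card_mono[OF _ A_subset] by simp

lemma length_restrict [simp]: "length (restrict v) = 2 * n"
  by (simp add: restrict_def)

lemma restrict_nth:
  "m < n \<Longrightarrow> restrict v ! m = v ! (sites ! m)" "m < n \<Longrightarrow> restrict v ! (n + m) = v ! (L + sites ! m)"
  by (simp_all add: restrict_def nth_append)

lemma restrict_vxor:
  assumes "length v = 2 * L" "length w = 2 * L"
  shows "restrict (vxor v w) = vxor (restrict v) (restrict w)"
proof (rule nth_equalityI)
  fix i assume "i < length (restrict (vxor v w))"
  then have i: "i < 2 * n" by simp
  show "restrict (vxor v w) ! i = vxor (restrict v) (restrict w) ! i"
  proof (cases "i < n")
    case True
    then show ?thesis using assms sites_less[OF True] by (simp add: restrict_nth)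
  next
    case False
    define m where "m = i - n"
    have m: "i = n + m" "m < n" using i False by (auto simp: m_def)
    then show ?thesis using assms sites_less[OF m(2)] by (simp add: restrict_nth)
  qed
qed simp

lemma supported_vxor:
  "length v = 2 * L \<Longrightarrow> length w = 2 * L \<Longrightarrow> supported v \<Longrightarrow> supported w \<Longrightarrow> supported (vxor v w)"
  by (auto simp: supported_def)

lemma restrict_inject:
  assumes "restrict v = restrict w" "supported v" "supported w" "length v = 2 * L" "length w = 2 * L"
  shows "v = w"
proof (rule nth_equalityI)
  show "length v = length w" using assms by simp
  have *: "v ! k = w ! k \<and> v ! (L + k) = w ! (L + k)" if "k < L" for k
  proof (cases "k \<in> A")
    case True
    then obtain m where "m < n" "sites ! m = k" by (rule site_index)
    then show ?thesis using restrict_nth[of m v] restrict_nth[of m w] assms(1) by simp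
  qed (use assms that in \<open>auto simp: supported_def\<close>)
  fix i assume "i < length v"
  then show "v ! i = w ! i"
    using *[of i] *[of "i - L"] assms(4) by (cases "i < L") auto
qed

lemma prod_sites: "(\<Prod>m<n. f (sites ! m)) = (\<Prod>k\<in>A. f k)"
  using prod.reindex_bij_betw[OF bij_sites, of f] by simp

lemma prod_split_A: "(\<Prod>k<L. f k) = (\<Prod>k\<in>A. f k) * (\<Prod>k\<in>{..<L} - A. f k :: 'a :: comm_monoid_mult)"
proof -
  have "{..<L} = A \<union> ({..<L} - A)" using A_subset by auto
  then show ?thesis by (metis Diff_disjoint finite_A finite_Diff finite_lessThan prod.union_disjoint)
qed

text \<open>On a qubit where one of the operators is the identity the phase is 1, so the qubits
  outside the support of \<open>v\<close> contribute nothing.\<close>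

lemma phase_restrict:
  assumes "supported v"
  shows "phase L v w = phase n (restrict v) (restrict w)"
proof -
  let ?f = "\<lambda>k. phase1 (v ! k) (v ! (L + k)) (w ! k) (w ! (L + k))"
  have "phase L v w = (\<Prod>k\<in>A. ?f k) * (\<Prod>k\<in>{..<L} - A. ?f k)"
    unfolding phase_def by (rule prod_split_A)
  also have "(\<Prod>k\<in>{..<L} - A. ?f k) = 1"
    by (rule prod.neutral) (use assms in \<open>auto simp: supported_def phase1_def\<close>)
  also have "(\<Prod>k\<in>A. ?f k) = phase n (restrict v) (restrict w)"
    unfolding phase_def prod_sites[symmetric] by (rule prod.cong) (auto simp: restrict_nth)
  finally show ?thesis by simp
qed

lemma restrict_zeros: "restrict (zeros (2 * L)) = zeros (2 * n)"
proof (rule nth_equalityI)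
  fix i assume "i < length (restrict (zeros (2 * L)))"
  then have i: "i < 2 * n" by simp
  show "restrict (zeros (2 * L)) ! i = zeros (2 * n) ! i"
  proof (cases "i < n")
    case True
    then show ?thesis using sites_less[OF True] by (simp add: restrict_nth)
  next
    case False
    define m where "m = i - n"
    have m: "i = n + m" "m < n" using i False by (auto simp: m_def)
    then show ?thesis using sites_less[OF m(2)] by (simp add: restrict_nth)
  qed
qed simp

definition matching :: "nat \<Rightarrow> nat \<Rightarrow> nat \<Rightarrow> nat \<Rightarrow> bool" where
  "matching a a' i j \<longleftrightarrow>
     nths (index_bits L i) A = index_bits n a \<and> nths (index_bits L j) A = index_bits n a' \<and>
     nths (index_bits L i) (- A) = nths (index_bits L j) (- A)"

lemma matching_iff:
  "matching a a' i j \<longleftrightarrow> (\<forall>m<n. bit i (sites ! m) = bit a m) \<and> (\<forall>m<n. bit j (sites ! m) = bit a' m) \<and>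
    (\<forall>k<L. k \<notin> A \<longrightarrow> bit i k = bit j k)"
proof -
  have 1: "nths (index_bits L i) A = index_bits n a \<longleftrightarrow> (\<forall>m<n. bit i (sites ! m) = bit a m)" for i a
  proof -
    have "nths (index_bits L i) A = map (\<lambda>k. bit i k) sites"
      unfolding nths_conv_map by (auto simp: index_bits_def sites_def intro!: map_cong)
    then show ?thesis by (auto simp: index_bits_def list_eq_iff_nth_eq)
  qed
  have "nths (index_bits L i) (- A) = map (\<lambda>k. bit i k) (filter (\<lambda>k. k \<notin> A) [0..<L])" for i
    unfolding nths_conv_map by (auto simp: index_bits_def intro!: map_cong)
  then have 2: "nths (index_bits L i) (- A) = nths (index_bits L j) (- A) \<longleftrightarrow>
      (\<forall>k<L. k \<notin> A \<longrightarrow> bit i k = bit j k)"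
    by auto
  show ?thesis unfolding matching_def 1 2 by blast
qed

text \<open>The selection of index pairs becomes a factor 0 or 1, which can then be distributed over
  the qubits.\<close>

lemma reduced_state_entry:
  assumes "a < 2 ^ n" "a' < 2 ^ n"
  shows "reduced_state L A M $$ (a, a') =
    (\<Sum>i<2 ^ L. \<Sum>j<2 ^ L. of_bool (matching a a' i j) * M $$ (i, j))"
proof -
  have "reduced_state L A M $$ (a, a') =
      (\<Sum>(i, j)\<in>{p \<in> {..<2 ^ L} \<times> {..<2 ^ L}. matching a a' (fst p) (snd p)}. M $$ (i, j))"
    using assms unfolding reduced_state_def matching_def
    by (auto intro!: sum.cong)
  also have "\<dots> = (\<Sum>p\<in>{..<2 ^ L} \<times> {..<2 ^ L}. if matching a a' (fst p) (snd p) then M $$ (fst p, snd p) else 0)"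
    by (subst sum.inter_filter) (auto intro!: sum.cong)
  also have "\<dots> = (\<Sum>i<2 ^ L. \<Sum>j<2 ^ L. if matching a a' i j then M $$ (i, j) else 0)"
    by (simp add: sum.cartesian_product split_beta)
  also have "\<dots> = (\<Sum>i<2 ^ L. \<Sum>j<2 ^ L. of_bool (matching a a' i j) * M $$ (i, j))"
    by (intro sum.cong) auto
  finally show ?thesis .
qed

lemma reduced_state_carrier [simp]: "reduced_state L A M \<in> carrier_mat (2 ^ n) (2 ^ n)"
  by (simp add: reduced_state_def)

lemma sum_prod_bits2:
  fixes F :: "nat \<Rightarrow> bool \<Rightarrow> bool \<Rightarrow> complex"
  shows "(\<Sum>i<(2 :: nat) ^ m. \<Sum>j<(2 :: nat) ^ m. \<Prod>k<m. F k (bit i k) (bit j k)) =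
    (\<Prod>k<m. F k False False + F k False True + (F k True False + F k True True))"
proof -
  have "(\<Sum>i<(2 :: nat) ^ m. \<Sum>j<(2 :: nat) ^ m. \<Prod>k<m. F k (bit i k) (bit j k)) =
      (\<Sum>i<(2 :: nat) ^ m. \<Prod>k<m. F k (bit i k) False + F k (bit i k) True)"
    by (rule sum.cong[OF refl]) (rule sum_prod_bits)
  also have "\<dots> = (\<Prod>k<m. F k False False + F k False True + (F k True False + F k True True))"
    by (rule sum_prod_bits)
  finally show ?thesis .
qed

text \<open>The double sum factors over the qubits: a kept qubit selects one entry, and a traced
  qubit contributes the trace of its factor, 2 for the identity and 0 otherwise. This is the origin
  of \<open>2 ^ (L - n)\<close>.\<close>

lemma reduced_pauli_string:
  assumes "a < 2 ^ n" "a' < 2 ^ n"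
  shows "reduced_state L A (pauli_string L v) $$ (a, a') =
    (if supported v then 2 ^ (L - n) else 0) * pauli_string n (restrict v) $$ (a, a')"
proof -
  \<comment> \<open>\<open>pos\<close> inverts \<open>sites\<close>, so that the matching condition
    can be stated for qubits of the large system.\<close>
  define pos where "pos k = (THE m. m < n \<and> sites ! m = k)" for k
  have pos: "pos (sites ! m) = m" if "m < n" for m
    unfolding pos_def using that distinct_sites
    by (intro the_equality) (auto simp: nth_eq_iff_index_eq)
  define F where "F k x y = pauli_entry (v ! k) (v ! (L + k)) x y *
    of_bool (if k \<in> A then x = bit a (pos k) \<and> y = bit a' (pos k) else x = y)" for k x y
  have match: "matching a a' i j \<longleftrightarrow> (\<forall>k\<in>{..<L}. if k \<in> A then bit i k = bit a (pos k) \<and>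
      bit j k = bit a' (pos k) else bit i k = bit j k)" for i j
  proof
    assume m: "matching a a' i j"
    show "\<forall>k\<in>{..<L}. if k \<in> A then bit i k = bit a (pos k) \<and>
      bit j k = bit a' (pos k) else bit i k = bit j k"
    proof
      fix k assume "k \<in> {..<L}"
      then show "if k \<in> A then bit i k = bit a (pos k) \<and>
        bit j k = bit a' (pos k) else bit i k = bit j k"
        using m unfolding matching_iff by (auto elim!: site_index simp: pos)
    qed
  next
    assume *: "\<forall>k\<in>{..<L}. if k \<in> A then bit i k = bit a (pos k) \<and>
      bit j k = bit a' (pos k) else bit i k = bit j k"
    show "matching a a' i j"
      unfolding matching_iff
    proof (intro conjI allI impI)
      fix m assume m: "m < n"
      show "bit i (sites ! m) = bit a m" "bit j (sites ! m) = bit a' m"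
        using *[rule_format, of "sites ! m"] sites_in_A[OF m] sites_less[OF m] pos[OF m] by auto
    next
      fix k assume "k < L" "k \<notin> A"
      then show "bit i k = bit j k" using *[rule_format, of k] by auto
    qed
  qed
  have "reduced_state L A (pauli_string L v) $$ (a, a') =
      (\<Sum>i<2 ^ L. \<Sum>j<2 ^ L. of_bool (matching a a' i j) * pauli_string L v $$ (i, j))"
    by (rule reduced_state_entry[OF assms])
  also have "\<dots> = (\<Sum>i<(2 :: nat) ^ L. \<Sum>j<(2 :: nat) ^ L. \<Prod>k<L. F k (bit i k) (bit j k))"
  proof (intro sum.cong refl)
    fix i j :: nat assume "i \<in> {..<2 ^ L}" "j \<in> {..<2 ^ L}"
    then have "pauli_string L v $$ (i, j) =
        (\<Prod>k<L. pauli_entry (v ! k) (v ! (L + k)) (bit i k) (bit j k))"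
      by (simp add: pauli_string_entry)
    then show "of_bool (matching a a' i j) * pauli_string L v $$ (i, j) = (\<Prod>k<L. F k (bit i k) (bit j k))"
      unfolding match F_def prod.distrib prod_of_bool[OF finite_lessThan, symmetric]
      by (simp only: mult.commute)
  qed
  also have "\<dots> = (\<Prod>k<L. F k False False + F k False True + (F k True False + F k True True))"
    by (rule sum_prod_bits2)
  also have "\<dots> = (\<Prod>k<L. if k \<in> A then pauli_entry (v ! k) (v ! (L + k)) (bit a (pos k)) (bit a' (pos k))
      else if v ! k \<or> v ! (L + k) then 0 else 2)"
  proof (rule prod.cong[OF refl])
    fix k
    show "F k False False + F k False True + (F k True False + F k True True) =
      (if k \<in> A then pauli_entry (v ! k) (v ! (L + k)) (bit a (pos k)) (bit a' (pos k))
       else if v ! k \<or> v ! (L + k) then 0 else 2)"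
      by (cases "bit a (pos k)"; cases "bit a' (pos k)"; cases "k \<in> A"; cases "v ! k"; cases "v ! (L + k)")
        (simp_all add: F_def pauli_entry_def)
  qed
  also have "\<dots> = (\<Prod>k\<in>A. pauli_entry (v ! k) (v ! (L + k)) (bit a (pos k)) (bit a' (pos k))) *
      (\<Prod>k\<in>{..<L} - A. if v ! k \<or> v ! (L + k) then 0 else 2)"
    unfolding prod_split_A by (intro arg_cong2[where f = "(*)"] prod.cong) auto
  also have "(\<Prod>k\<in>{..<L} - A. if v ! k \<or> v ! (L + k) then 0 else (2 :: complex)) =
      (if supported v then 2 ^ (L - n) else 0)"
  proof (cases "supported v")
    case True
    then have "(\<Prod>k\<in>{..<L} - A. if v ! k \<or> v ! (L + k) then 0 else (2 :: complex)) = (\<Prod>k\<in>{..<L} - A. 2)"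
      by (intro prod.cong) (auto simp: supported_def)
    moreover have "card ({..<L} - A) = L - n"
      using A_subset finite_A by (subst card_Diff_subset) auto
    ultimately show ?thesis using True by simp
  next
    case False
    then have "\<exists>k\<in>{..<L} - A. (if v ! k \<or> v ! (L + k) then 0 else (2 :: complex)) = 0"
      by (auto simp: supported_def)
    then have "(\<Prod>k\<in>{..<L} - A. if v ! k \<or> v ! (L + k) then 0 else (2 :: complex)) = 0"
      by (intro prod_zero) auto
    with False show ?thesis by simp
  qed
  also have "(\<Prod>k\<in>A. pauli_entry (v ! k) (v ! (L + k)) (bit a (pos k)) (bit a' (pos k))) =
      pauli_string n (restrict v) $$ (a, a')"
    unfolding pauli_string_entry[OF assms] prod_sites[symmetric]
    by (rule prod.cong) (auto simp: restrict_nth pos)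
  finally show ?thesis by (simp add: mult.commute)
qed

text \<open>A relation, since only operators supported on the subset have an image; the factor
  \<open>2 ^ (L - n)\<close> of the partial trace is left out.\<close>

definition reduces_to :: "complex mat \<Rightarrow> complex mat \<Rightarrow> bool" where
  "reduces_to M M' \<longleftrightarrow> (\<exists>v c. length v = 2 * L \<and> (c = 1 \<or> c = -1) \<and> supported v \<and>
     M = scaled_pauli L v c \<and> M' = scaled_pauli n (restrict v) c)"

definition reduction :: "complex mat set \<Rightarrow> complex mat set" where
  "reduction X = {M'. \<exists>M\<in>X. reduces_to M M'}"

lemma reduces_toE:
  assumes "reduces_to M M'"
  obtains v c where "length v = 2 * L" "c = 1 \<or> c = -1" "supported v"
    "M = scaled_pauli L v c" "M' = scaled_pauli n (restrict v) c"
  using assms unfolding reduces_to_def by blast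

lemma reduces_to_unique:
  assumes "reduces_to M M'" "reduces_to M M''"
  shows "M' = M''"
proof -
  obtain v c where v: "length v = 2 * L" "c = 1 \<or> c = -1"
    "M = scaled_pauli L v c" "M' = scaled_pauli n (restrict v) c" using assms(1) by (rule reduces_toE)
  obtain w d where w: "length w = 2 * L" "d = 1 \<or> d = -1"
    "M = scaled_pauli L w d" "M'' = scaled_pauli n (restrict w) d" using assms(2) by (rule reduces_toE)
  have "c \<noteq> 0" using v(2) by auto
  with scaled_pauli_inject[of L v c w d] v w show ?thesis by simp
qed

lemma reduces_to_inject:
  assumes "reduces_to M M'" "reduces_to N M'"
  shows "M = N"
proof -
  obtain v c where v: "length v = 2 * L" "c = 1 \<or> c = -1" "supported v"
    "M = scaled_pauli L v c" "M' = scaled_pauli n (restrict v) c" using assms(1) by (rule reduces_toE)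
  obtain w d where w: "length w = 2 * L" "d = 1 \<or> d = -1" "supported w"
    "N = scaled_pauli L w d" "M' = scaled_pauli n (restrict w) d" using assms(2) by (rule reduces_toE)
  have "c \<noteq> 0" using v(2) by auto
  then have "restrict v = restrict w" "c = d"
    using scaled_pauli_inject[of n "restrict v" c "restrict w" d] v w by simp_all
  with restrict_inject[of v w] v w show ?thesis by simp
qed

lemma reduces_to_hermitian:
  "reduces_to M M' \<Longrightarrow> M \<in> hermitian_paulis L" "reduces_to M M' \<Longrightarrow> M' \<in> hermitian_paulis n"
  by (auto elim!: reduces_toE intro!: hermitian_pauliI)

lemma reduces_to_one: "reduces_to (1\<^sub>m (2 ^ L)) (1\<^sub>m (2 ^ n))"
  unfolding reduces_to_def scaled_pauli_one[symmetric]
  by (intro exI[of _ "zeros (2 * L)"] exI[of _ 1]) (simp add: supported_def restrict_zeros)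

lemma reduces_to_uminus: "reduces_to M M' \<Longrightarrow> reduces_to (- M) (- M')"
proof (elim reduces_toE)
  fix v c assume "length v = 2 * L" "c = 1 \<or> c = -1" "supported v"
    "M = scaled_pauli L v c" "M' = scaled_pauli n (restrict v) c"
  then show ?thesis
    unfolding reduces_to_def by (intro exI[of _ v] exI[of _ "- c"]) (auto simp: scaled_pauli_uminus)
qed

lemma reduces_to_mult:
  assumes "reduces_to M M'" "reduces_to N N'" "M * N \<in> hermitian_paulis L"
  shows "reduces_to (M * N) (M' * N')"
proof -
  obtain v c where v: "length v = 2 * L" "c = 1 \<or> c = -1" "supported v"
    "M = scaled_pauli L v c" "M' = scaled_pauli n (restrict v) c" using assms(1) by (rule reduces_toE)
  obtain w d where w: "length w = 2 * L" "d = 1 \<or> d = -1" "supported w"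
    "N = scaled_pauli L w d" "N' = scaled_pauli n (restrict w) d" using assms(2) by (rule reduces_toE)
  have MN: "M * N = scaled_pauli L (vxor v w) (c * d * phase L v w)"
    using v w by (simp add: scaled_pauli_mult)
  have MN': "M' * N' = scaled_pauli n (restrict (vxor v w)) (c * d * phase L v w)"
    using v w by (simp add: scaled_pauli_mult restrict_vxor phase_restrict[OF v(3)])
  obtain u e where u: "length u = 2 * L" "e = 1 \<or> e = -1" "M * N = scaled_pauli L u e"
    using assms(3) by (rule hermitian_pauliE)
  then have "e \<noteq> 0" by auto
  then have "e = c * d * phase L v w"
    using scaled_pauli_inject[of L u e "vxor v w" "c * d * phase L v w"] u MN v w by simp
  then show ?thesis
    unfolding reduces_to_def MN MN' using u(2) v w supported_vxor
    by (intro exI[of _ "vxor v w"] exI[of _ "c * d * phase L v w"]) simp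
qed

lemma reduces_to_commute:
  assumes "reduces_to M M'" "reduces_to N N'"
  shows "M' * N' = N' * M' \<longleftrightarrow> M * N = N * M"
proof -
  obtain v c where v: "length v = 2 * L" "c = 1 \<or> c = -1" "supported v"
    "M = scaled_pauli L v c" "M' = scaled_pauli n (restrict v) c" using assms(1) by (rule reduces_toE)
  obtain w d where w: "length w = 2 * L" "d = 1 \<or> d = -1" "supported w"
    "N = scaled_pauli L w d" "N' = scaled_pauli n (restrict w) d" using assms(2) by (rule reduces_toE)
  have "comm_sign n (restrict v) (restrict w) = comm_sign L v w"
    using phase_comm_sign[of L v w] phase_comm_sign[of n "restrict v" "restrict w"]
      phase_restrict[OF v(3)] phase_restrict[OF w(3)] phase_nonzero[of L w v] by simp
  then show ?thesis
    using scaled_pauli_commute_iff[of v L w c d] scaled_pauli_commute_iff[of "restrict v" n "restrict w" c d]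
      v w by auto
qed

lemma reduction_stabilizer_group:
  assumes "stabilizer_group L G"
  shows "stabilizer_group n (reduction G)"
  unfolding stabilizer_group_def
proof (intro conjI ballI subsetI)
  note D = stabilizer_groupD[OF assms]
  fix M' assume "M' \<in> reduction G"
  then show "M' \<in> hermitian_paulis n" using reduces_to_hermitian(2) by (auto simp: reduction_def)
next
  show "1\<^sub>m (2 ^ n) \<in> reduction G"
    using stabilizer_groupD(2)[OF assms] reduces_to_one by (auto simp: reduction_def)
  show "- 1\<^sub>m (2 ^ n) \<notin> reduction G"
  proof
    assume "- 1\<^sub>m (2 ^ n) \<in> reduction G"
    then obtain M where "M \<in> G" "reduces_to M (- 1\<^sub>m (2 ^ n))" by (auto simp: reduction_def)
    with reduces_to_inject[OF _ reduces_to_uminus[OF reduces_to_one]] stabilizer_groupD(3)[OF assms]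
    show False by blast
  qed
  fix M' N' assume "M' \<in> reduction G" "N' \<in> reduction G"
  then obtain M N where MN: "M \<in> G" "N \<in> G" "reduces_to M M'" "reduces_to N N'" by (auto simp: reduction_def)
  then show "M' * N' \<in> reduction G"
    using reduces_to_mult[OF MN(3,4)] stabilizer_groupD(4,6)[OF assms] by (auto simp: reduction_def)
  show "M' * N' = N' * M'"
    using reduces_to_commute[OF MN(3,4)] stabilizer_groupD(5)[OF assms] MN by blast
qed

text \<open>The representative itself is supported on the subset. Multiplication by it then commutes
  with reduction, and it can be undone on both sides because the operators are involutions.\<close>

lemma reduction_coset:
  assumes G: "stabilizer_group L G" and N: "reduces_to N N'" and comm: "\<And>M. M \<in> G \<Longrightarrow> N * M = M * N"
  shows "reduction ((*) N ` G) = (*) N' ` reduction G"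
proof
  note D = stabilizer_groupD[OF G]
  have NH: "N \<in> hermitian_paulis L" using reduces_to_hermitian(1)[OF N] .
  show "(*) N' ` reduction G \<subseteq> reduction ((*) N ` G)"
  proof
    fix K assume "K \<in> (*) N' ` reduction G"
    then obtain M M' where M: "M \<in> G" "reduces_to M M'" "K = N' * M'" by (auto simp: reduction_def)
    then have "reduces_to (N * M) K"
      using reduces_to_mult[OF N M(2)] hermitian_pauli_mult[OF NH D(6)[OF M(1)] comm[OF M(1)]] by simp
    with M(1) show "K \<in> reduction ((*) N ` G)" by (auto simp: reduction_def)
  qed
  show "reduction ((*) N ` G) \<subseteq> (*) N' ` reduction G"
  proof
    fix K' assume "K' \<in> reduction ((*) N ` G)"
    then obtain M where M: "M \<in> G" "reduces_to (N * M) K'" by (auto simp: reduction_def)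
    have eq: "N * (N * M) = M" by (rule hermitian_pauli_cancel[OF NH D(7)[OF M(1)]])
    have "reduces_to M (N' * K')"
      using reduces_to_mult[OF N M(2)] D(6)[OF M(1)] unfolding eq by blast
    then have "N' * K' \<in> reduction G" using M(1) by (auto simp: reduction_def)
    moreover have "K' = N' * (N' * K')"
      using hermitian_pauli_cancel[OF reduces_to_hermitian(2)[OF N]
          hermitian_pauli_carrier[OF reduces_to_hermitian(2)[OF M(2)]]] by simp
    ultimately show "K' \<in> (*) N' ` reduction G" by blast
  qed
qed

text \<open>Linearity, with unsupported operators contributing zero. Distinct operators have
  distinct images, so the sum over the set \<open>reduction X\<close> loses no terms.\<close>

lemma reduced_mat_sum:
  assumes X: "X \<subseteq> hermitian_paulis L" and a: "a < 2 ^ n" "a' < 2 ^ n"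
  shows "reduced_state L A (mat_sum (2 ^ L) X) $$ (a, a') = 2 ^ (L - n) * mat_sum (2 ^ n) (reduction X) $$ (a, a')"
proof -
  have finX: "finite X" using finite_subset[OF X] by simp
  let ?Y = "{M \<in> X. \<exists>M'. reduces_to M M'}"
  define r where "r M = (THE M'. reduces_to M M')" for M
  have r: "r M = M'" if "reduces_to M M'" for M M'
    unfolding r_def using that reduces_to_unique by blast
  have red: "reduced_state L A M $$ (a, a') = (if M \<in> ?Y then 2 ^ (L - n) * r M $$ (a, a') else 0)"
    if M: "M \<in> X" for M
  proof -
    obtain v c where v: "length v = 2 * L" "c = 1 \<or> c = -1" "M = scaled_pauli L v c"
      using X M by (meson hermitian_pauliE subsetD)
    have "reduced_state L A M $$ (a, a') = c * reduced_state L A (pauli_string L v) $$ (a, a')"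
      unfolding reduced_state_entry[OF a] sum_distrib_left
      by (intro sum.cong) (auto simp: v(3) scaled_pauli_def)
    also have "\<dots> = c * ((if supported v then 2 ^ (L - n) else 0) * pauli_string n (restrict v) $$ (a, a'))"
      unfolding reduced_pauli_string[OF a] ..
    finally have eq: "reduced_state L A M $$ (a, a') =
      (if supported v then 2 ^ (L - n) * scaled_pauli n (restrict v) c $$ (a, a') else 0)"
      using a by (simp add: scaled_pauli_def)
    show ?thesis
    proof (cases "supported v")
      case True
      then have "reduces_to M (scaled_pauli n (restrict v) c)"
        unfolding reduces_to_def using v by blast
      with r[OF this] eq True M show ?thesis by auto
    next
      case False
      have "M \<notin> ?Y"
      proof
        assume "M \<in> ?Y"
        then obtain M' where "reduces_to M M'" by blast
        then obtain w d where "length w = 2 * L" "supported w" "M = scaled_pauli L w d" by (rule reduces_toE)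
        with scaled_pauli_inject[of L v c w d] v False show False by auto
      qed
      with eq False show ?thesis by (simp only: if_False)
    qed
  qed
  have "reduced_state L A (mat_sum (2 ^ L) X) $$ (a, a') =
      (\<Sum>i<2 ^ L. \<Sum>j<2 ^ L. \<Sum>M\<in>X. of_bool (matching a a' i j) * M $$ (i, j))"
    unfolding reduced_state_entry[OF a] by (intro sum.cong) (auto simp: sum_distrib_left)
  also have "\<dots> = (\<Sum>i<2 ^ L. \<Sum>M\<in>X. \<Sum>j<2 ^ L. of_bool (matching a a' i j) * M $$ (i, j))"
    by (rule sum.cong[OF refl]) (rule sum.swap)
  also have "\<dots> = (\<Sum>M\<in>X. \<Sum>i<2 ^ L. \<Sum>j<2 ^ L. of_bool (matching a a' i j) * M $$ (i, j))"
    by (rule sum.swap)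
  also have "\<dots> = (\<Sum>M\<in>X. if M \<in> ?Y then 2 ^ (L - n) * r M $$ (a, a') else 0)"
    by (rule sum.cong[OF refl]) (use red in \<open>simp add: reduced_state_entry[OF a]\<close>)
  also have "\<dots> = (\<Sum>M\<in>?Y. 2 ^ (L - n) * r M $$ (a, a'))"
    by (rule sum.mono_neutral_cong_right[OF finX]) auto
  also have "\<dots> = 2 ^ (L - n) * (\<Sum>M'\<in>r ` ?Y. M' $$ (a, a'))"
  proof -
    have "inj_on r ?Y"
    proof (rule inj_onI)
      fix M N assume "M \<in> ?Y" "N \<in> ?Y" and eq: "r M = r N"
      then obtain M' N' where M': "reduces_to M M'" and N': "reduces_to N N'" by blast
      with eq r have "M' = N'" by metis
      with reduces_to_inject[OF M'] N' show "M = N" by blast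
    qed
    then show ?thesis by (simp add: sum.reindex sum_distrib_left)
  qed
  also have "r ` ?Y = reduction X"
  proof
    show "r ` ?Y \<subseteq> reduction X"
    proof
      fix M' assume "M' \<in> r ` ?Y"
      then obtain M K where "M \<in> X" "reduces_to M K" "M' = r M" by blast
      with r[of M K] show "M' \<in> reduction X" by (auto simp: reduction_def)
    qed
    show "reduction X \<subseteq> r ` ?Y"
    proof
      fix M' assume "M' \<in> reduction X"
      then obtain M where "M \<in> X" "reduces_to M M'" by (auto simp: reduction_def)
      with r[of M M'] show "M' \<in> r ` ?Y" by (intro image_eqI[of _ _ M]) auto
    qed
  qed
  finally show ?thesis using a by simp
qed

end

section \<open>Expectation values and robustness of states built from a group and two cosets\<close>

section \<open>Magic states of stabilizer form\<close>

text \<open>The common form of the code state and its reductions: in the applications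
  \<open>S0\<close> is a group and the other two sets are cosets of it or empty.\<close>

definition magic_sum :: "nat \<Rightarrow> complex mat set \<Rightarrow> complex mat set \<Rightarrow> complex mat set \<Rightarrow> complex mat" where
  "magic_sum n S0 S1 S2 = mat (2 ^ n) (2 ^ n) (\<lambda>(i, j). ((\<Sum>M\<in>S0. M $$ (i, j)) +
     complex_of_real (1 / sqrt 2) * ((\<Sum>M\<in>S1. M $$ (i, j)) - (\<Sum>M\<in>S2. M $$ (i, j)))) / 2 ^ n)"

text \<open>By orthogonality, the expectation value of \<open>P\<close> in the sum over
  \<open>S\<close> divided by \<open>2 ^ n\<close>.\<close>

definition signed_indicator :: "complex mat set \<Rightarrow> complex mat \<Rightarrow> real" where
  "signed_indicator S P = of_bool (P \<in> S) - of_bool (- P \<in> S)"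

lemma magic_sum_carrier [simp]: "magic_sum n S0 S1 S2 \<in> carrier_mat (2 ^ n) (2 ^ n)"
  by (simp add: magic_sum_def)

lemma mat_trace_sum:
  assumes S: "S \<subseteq> hermitian_paulis n" and P: "P \<in> hermitian_paulis n"
  shows "(\<Sum>M\<in>S. mat_trace (M * P)) = complex_of_real (2 ^ n * signed_indicator S P)"
proof -
  have fin: "finite S" using finite_subset[OF S] by simp
  have "(\<Sum>M\<in>S. mat_trace (M * P)) = (\<Sum>M\<in>S. (if M = P then 2 ^ n else 0) - (if M = - P then 2 ^ n else 0))"
  proof (rule sum.cong[OF refl])
    fix M assume "M \<in> S"
    then have "M \<in> hermitian_paulis n" using S by blast
    then show "mat_trace (M * P) = (if M = P then 2 ^ n else 0) - (if M = - P then 2 ^ n else 0)"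
      using hermitian_pauli_trace[OF _ P] hermitian_pauli_neq_uminus[OF P] by auto
  qed
  also have "\<dots> = complex_of_real (2 ^ n * signed_indicator S P)"
    using fin by (simp add: sum_subtractf signed_indicator_def)
  finally show ?thesis .
qed

definition expectation :: "complex mat \<Rightarrow> complex mat \<Rightarrow> real" where
  "expectation M P = Re (mat_trace (M * P))"

lemma mat_trace_mult:
  "A \<in> carrier_mat d d \<Longrightarrow> B \<in> carrier_mat d d \<Longrightarrow>
    mat_trace (A * B) = (\<Sum>i<d. \<Sum>k<d. A $$ (i, k) * B $$ (k, i))"
  using mat_mult_entry[of A d B] by (auto simp: mat_trace_def)

lemma expectation_magic_sum:
  assumes S: "S0 \<subseteq> hermitian_paulis n" "S1 \<subseteq> hermitian_paulis n" "S2 \<subseteq> hermitian_paulis n"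
    and P: "P \<in> hermitian_paulis n"
  shows "expectation (magic_sum n S0 S1 S2) P =
    signed_indicator S0 P + (signed_indicator S1 P - signed_indicator S2 P) / sqrt 2"
proof -
  note Pc = hermitian_pauli_carrier[OF P]
  have tr: "mat_trace (mat_sum (2 ^ n) S * P) = complex_of_real (2 ^ n * signed_indicator S P)"
    if "S \<subseteq> hermitian_paulis n" for S
    using mat_trace_mat_sum_mult[OF _ Pc, of S] mat_trace_sum[OF that P] that hermitian_pauli_carrier by auto
  let ?d = "(2 :: nat) ^ n" and ?s = "complex_of_real (1 / sqrt 2)"
  have "mat_trace (magic_sum n S0 S1 S2 * P) =
      (\<Sum>i<?d. \<Sum>k<?d. (mat_sum ?d S0 $$ (i, k) * P $$ (k, i) +
        ?s * (mat_sum ?d S1 $$ (i, k) * P $$ (k, i) - mat_sum ?d S2 $$ (i, k) * P $$ (k, i))) / 2 ^ n)"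
    unfolding mat_trace_mult[OF magic_sum_carrier Pc]
    by (intro sum.cong refl) (simp add: magic_sum_def algebra_simps add_divide_distrib diff_divide_distrib)
  also have "\<dots> = (mat_trace (mat_sum ?d S0 * P) +
      ?s * (mat_trace (mat_sum ?d S1 * P) - mat_trace (mat_sum ?d S2 * P))) / 2 ^ n"
    unfolding mat_trace_mult[OF mat_sum_carrier Pc]
    by (simp only: sum_divide_distrib[symmetric] sum.distrib sum_distrib_left[symmetric] sum_subtractf)
  also have "\<dots> = complex_of_real (signed_indicator S0 P +
      (signed_indicator S1 P - signed_indicator S2 P) / sqrt 2)"
    unfolding tr[OF S(1)] tr[OF S(2)] tr[OF S(3)]
    by (simp add: field_simps)
  finally show ?thesis unfolding expectation_def by simp
qed

text \<open>\<open>LEAST\<close> on the reals asks for an attained minimum. The lower bound turns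
  the inequality in \<open>decomposable\<close> into an equality, so \<open>r\<close> itself is a
  value of the norm.\<close>

lemma decomposable_robustness:
  assumes dec: "decomposable n \<rho> 1 r"
    and lower: "\<And>S x. finite S \<Longrightarrow> S \<subseteq> pure_stabilizer_states n \<Longrightarrow>
      \<rho> = mat (2 ^ n) (2 ^ n) (\<lambda>(i, j). \<Sum>\<sigma>\<in>S. of_real (x \<sigma>) * \<sigma> $$ (i, j)) \<Longrightarrow>
      (\<Sum>\<sigma>\<in>S. x \<sigma>) = 1 \<Longrightarrow> r \<le> (\<Sum>\<sigma>\<in>S. \<bar>x \<sigma>\<bar>)"
  shows "robustness n \<rho> = r"
  unfolding robustness_def
proof (rule Least_equality)
  from dec obtain S x where S: "finite S" "S \<subseteq> pure_stabilizer_states n"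
    "\<rho> = mat (2 ^ n) (2 ^ n) (\<lambda>(i, j). \<Sum>\<sigma>\<in>S. of_real (x \<sigma>) * \<sigma> $$ (i, j))"
    "(\<Sum>\<sigma>\<in>S. x \<sigma>) = 1" "(\<Sum>\<sigma>\<in>S. \<bar>x \<sigma>\<bar>) \<le> r"
    unfolding decomposable_def by blast
  have "r = (\<Sum>\<sigma>\<in>S. \<bar>x \<sigma>\<bar>)" using lower[OF S(1-4)] S(5) by simp
  then show "\<exists>S x. finite S \<and> S \<subseteq> pure_stabilizer_states n \<and>
     \<rho> = mat (2 ^ n) (2 ^ n) (\<lambda>(i, j). \<Sum>\<sigma>\<in>S. of_real (x \<sigma>) * \<sigma> $$ (i, j)) \<and>
     (\<Sum>\<sigma>\<in>S. x \<sigma>) = 1 \<and> r = (\<Sum>\<sigma>\<in>S. \<bar>x \<sigma>\<bar>)"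
    by (intro exI[of _ S] exI[of _ x] conjI S(1-4))
next
  fix r' assume "\<exists>S x. finite S \<and> S \<subseteq> pure_stabilizer_states n \<and>
     \<rho> = mat (2 ^ n) (2 ^ n) (\<lambda>(i, j). \<Sum>\<sigma>\<in>S. of_real (x \<sigma>) * \<sigma> $$ (i, j)) \<and>
     (\<Sum>\<sigma>\<in>S. x \<sigma>) = 1 \<and> r' = (\<Sum>\<sigma>\<in>S. \<bar>x \<sigma>\<bar>)"
  then obtain S x where S: "finite S" "S \<subseteq> pure_stabilizer_states n"
    "\<rho> = mat (2 ^ n) (2 ^ n) (\<lambda>(i, j). \<Sum>\<sigma>\<in>S. of_real (x \<sigma>) * \<sigma> $$ (i, j))"
    "(\<Sum>\<sigma>\<in>S. x \<sigma>) = 1" "r' = (\<Sum>\<sigma>\<in>S. \<bar>x \<sigma>\<bar>)" by blast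
  show "r \<le> r'" using lower[OF S(1-4)] S(5) by simp
qed

lemma robustness_one:
  assumes "decomposable n \<rho> 1 1"
  shows "robustness n \<rho> = 1"
proof (rule decomposable_robustness[OF assms])
  fix S and x :: "complex mat \<Rightarrow> real" assume "(\<Sum>\<sigma>\<in>S. x \<sigma>) = 1"
  then show "1 \<le> (\<Sum>\<sigma>\<in>S. \<bar>x \<sigma>\<bar>)" using sum_abs[of x S] by linarith
qed

lemma decomposable_extend:
  assumes H: "stabilizer_group n H" and N: "N \<in> hermitian_paulis n" "N \<notin> H" "- N \<notin> H"
    and comm: "\<And>M. M \<in> H \<Longrightarrow> N * M = M * N"
  shows "decomposable n (stab_state n (H \<union> (*) N ` H)) 1 1"
    "decomposable n (stab_state n (H \<union> (*) (- N) ` H)) 1 1"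
proof -
  note D = stabilizer_groupD[OF H]
  have Nc: "N \<in> carrier_mat (2 ^ n) (2 ^ n)" using hermitian_pauli_carrier[OF N(1)] .
  have m: "- N * M = M * - N" if "M \<in> H" for M
    using comm[OF that] mult_uminus_left[OF Nc D(7)[OF that]] mult_uminus_right[OF D(7)[OF that] Nc] by simp
  have mN: "- (- N) \<notin> H" using N(2) by simp
  show "decomposable n (stab_state n (H \<union> (*) N ` H)) 1 1"
    by (rule decomposable_stab_state[OF stabilizer_group_extend(1)[OF H N comm]])
  show "decomposable n (stab_state n (H \<union> (*) (- N) ` H)) 1 1"
    by (rule decomposable_stab_state[OF stabilizer_group_extend(1)[OF H hermitian_pauli_uminus[OF N(1)] N(3) mN m]])
qed

text \<open>The weights \<open>(1 + t) / 2\<close> and \<open>(1 - t) / 2\<close> on the two sign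
  extensions are nonnegative. The lemma is applied with \<open>t = 1 / sqrt 2\<close> or its
  negative, according to which logical coset survives.\<close>

lemma decomposable_mixed:
  assumes H: "stabilizer_group n H" and N: "N \<in> hermitian_paulis n" "N \<notin> H" "- N \<notin> H"
    and comm: "\<And>M. M \<in> H \<Longrightarrow> N * M = M * N" and t: "\<bar>t\<bar> \<le> 1"
    and \<rho>: "\<rho> \<in> carrier_mat (2 ^ n) (2 ^ n)"
    and entry: "\<And>i j. i < 2 ^ n \<Longrightarrow> j < 2 ^ n \<Longrightarrow> \<rho> $$ (i, j) =
      ((\<Sum>M\<in>H. M $$ (i, j)) + complex_of_real t * (\<Sum>M\<in>(*) N ` H. M $$ (i, j))) / 2 ^ n"
  shows "decomposable n \<rho> 1 1"
proof -
  let ?P = "stab_state n (H \<union> (*) N ` H)" and ?Q = "stab_state n (H \<union> (*) (- N) ` H)"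
  note dec = decomposable_extend[OF H N comm]
  from decomposable_add[OF decomposable_smult[OF dec(1), of "(1 + t) / 2"]
      decomposable_smult[OF dec(2), of "(1 - t) / 2"]]
  have "decomposable n (complex_of_real ((1 + t) / 2) \<cdot>\<^sub>m ?P + complex_of_real ((1 - t) / 2) \<cdot>\<^sub>m ?Q) 1 1"
    using t by (simp add: add_divide_distrib[symmetric])
  moreover have "complex_of_real ((1 + t) / 2) \<cdot>\<^sub>m ?P + complex_of_real ((1 - t) / 2) \<cdot>\<^sub>m ?Q = \<rho>"
  proof (rule eq_matI)
    fix i j assume "i < dim_row \<rho>" "j < dim_col \<rho>"
    then have ij: "i < 2 ^ n" "j < 2 ^ n" using \<rho> by auto
    show "(complex_of_real ((1 + t) / 2) \<cdot>\<^sub>m ?P + complex_of_real ((1 - t) / 2) \<cdot>\<^sub>m ?Q) $$ (i, j) = \<rho> $$ (i, j)"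
      using ij by (simp add: entry stab_state_extend_entry[OF H N]) (simp add: field_simps)
  qed (use \<rho> in auto)
  ultimately show ?thesis by simp
qed

lemma expectation_pure:
  assumes "\<sigma> \<in> pure_stabilizer_states n"
  obtains H where "stabilizer_group n H"
    "\<forall>P\<in>hermitian_paulis n. expectation \<sigma> P = signed_indicator H P"
proof -
  obtain H where H: "stabilizer_group n H" "\<sigma> = stab_state n H"
    using assms by (rule pure_stabilizer_stateD)
  have "stab_state n H = magic_sum n H {} {}"
    by (intro eq_matI) (simp_all add: stab_state_def magic_sum_def)
  then have "\<forall>P\<in>hermitian_paulis n. expectation \<sigma> P = signed_indicator H P"
    using expectation_magic_sum[of H n "{}" "{}"] stabilizer_groupD(1)[OF H(1)] H(2)
    by (simp add: signed_indicator_def[of "{}"])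
  with H(1) show ?thesis by (rule that)
qed

text \<open>If both operators occurred up to sign, they would commute as elements of an abelian
  group.\<close>

lemma anticommuting_signed_indicator:
  assumes H: "stabilizer_group n H" and P: "P \<in> hermitian_paulis n" "Q \<in> hermitian_paulis n"
    and anti: "P * Q \<noteq> Q * P"
  shows "\<bar>signed_indicator H P - signed_indicator H Q\<bar> \<le> 1"
proof -
  note D = stabilizer_groupD[OF H]
  have Pc: "P \<in> carrier_mat (2 ^ n) (2 ^ n)" and Qc: "Q \<in> carrier_mat (2 ^ n) (2 ^ n)"
    using P hermitian_pauli_carrier by auto
  have neg: "- P * Q = - (P * Q)" "P * - Q = - (P * Q)" "- Q * P = - (Q * P)" "Q * - P = - (Q * P)"
    "- P * - Q = P * Q" "- Q * - P = Q * P"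
    using mult_uminus_left[OF Pc Qc] mult_uminus_right[OF Pc Qc] mult_uminus_left[OF Qc Pc]
      mult_uminus_right[OF Qc Pc] mult_uminus_left[OF Pc, of "- Q"] mult_uminus_left[OF Qc, of "- P"] Pc Qc
    by simp_all
  have inj: "- (P * Q) = - (Q * P) \<Longrightarrow> P * Q = Q * P" by (metis uminus_uminus_mat)
  have no: "\<not> ((P \<in> H \<or> - P \<in> H) \<and> (Q \<in> H \<or> - Q \<in> H))"
    using D(5)[of P Q] D(5)[of "- P" Q] D(5)[of P "- Q"] D(5)[of "- P" "- Q"] anti inj neg by auto
  have "\<bar>signed_indicator H R\<bar> \<le> 1" for R by (simp add: signed_indicator_def)
  moreover have "signed_indicator H R = 0" if "R \<notin> H" "- R \<notin> H" for R
    using that by (simp add: signed_indicator_def)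
  ultimately show ?thesis using no by (metis abs_minus_commute diff_0_right)
qed

lemma expectation_linear:
  assumes S: "S \<subseteq> pure_stabilizer_states n" and P: "P \<in> carrier_mat (2 ^ n) (2 ^ n)"
  shows "expectation (mat (2 ^ n) (2 ^ n) (\<lambda>(i, j). \<Sum>\<sigma>\<in>S. of_real (x \<sigma>) * \<sigma> $$ (i, j))) P =
    (\<Sum>\<sigma>\<in>S. x \<sigma> * expectation \<sigma> P)"
proof -
  let ?d = "(2 :: nat) ^ n"
  have c: "\<sigma> \<in> carrier_mat ?d ?d" if "\<sigma> \<in> S" for \<sigma>
    using that S by (auto simp: pure_stabilizer_states_def)
  have "mat_trace (mat ?d ?d (\<lambda>(i, j). \<Sum>\<sigma>\<in>S. of_real (x \<sigma>) * \<sigma> $$ (i, j)) * P) =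
      (\<Sum>i<?d. \<Sum>k<?d. \<Sum>\<sigma>\<in>S. of_real (x \<sigma>) * (\<sigma> $$ (i, k) * P $$ (k, i)))"
    by (subst mat_trace_mult[OF _ P]) (simp_all add: sum_distrib_right mult.assoc)
  also have "\<dots> = (\<Sum>i<?d. \<Sum>\<sigma>\<in>S. \<Sum>k<?d. of_real (x \<sigma>) * (\<sigma> $$ (i, k) * P $$ (k, i)))"
    by (rule sum.cong[OF refl]) (rule sum.swap)
  also have "\<dots> = (\<Sum>\<sigma>\<in>S. \<Sum>i<?d. \<Sum>k<?d. of_real (x \<sigma>) * (\<sigma> $$ (i, k) * P $$ (k, i)))"
    by (rule sum.swap)
  also have "\<dots> = (\<Sum>\<sigma>\<in>S. of_real (x \<sigma>) * mat_trace (\<sigma> * P))"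
    by (rule sum.cong[OF refl]) (simp add: mat_trace_mult[OF c P] sum_distrib_left)
  finally show ?thesis by (simp add: expectation_def)
qed

lemma robustness_sqrt2:
  assumes H: "stabilizer_group n H"
    and N: "N1 \<in> hermitian_paulis n" "N1 \<notin> H" "- N1 \<notin> H" "\<And>M. M \<in> H \<Longrightarrow> N1 * M = M * N1"
      "N2 \<in> hermitian_paulis n" "N2 \<notin> H" "- N2 \<notin> H" "\<And>M. M \<in> H \<Longrightarrow> N2 * M = M * N2"
    and anti: "N1 * N2 \<noteq> N2 * N1"
    and e: "expectation (magic_sum n H ((*) N1 ` H) ((*) N2 ` H)) N1 = 1 / sqrt 2"
      "expectation (magic_sum n H ((*) N1 ` H) ((*) N2 ` H)) N2 = - (1 / sqrt 2)"
  shows "robustness n (magic_sum n H ((*) N1 ` H) ((*) N2 ` H)) = sqrt 2"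
proof (rule decomposable_robustness)
  let ?\<rho> = "magic_sum n H ((*) N1 ` H) ((*) N2 ` H)"
  have sq: "sqrt 2 * sqrt 2 = (2 :: real)" by simp
  have half: "1 / sqrt 2 = sqrt 2 / 2" by (simp add: field_simps)
  show "decomposable n ?\<rho> 1 (sqrt 2)"
  proof -
    let ?P = "stab_state n (H \<union> (*) N1 ` H)" and ?P' = "stab_state n (H \<union> (*) (- N1) ` H)"
    let ?Q = "stab_state n (H \<union> (*) N2 ` H)" and ?Q' = "stab_state n (H \<union> (*) (- N2) ` H)"
    note d1 = decomposable_extend[OF H N(1-4)] and d2 = decomposable_extend[OF H N(5-8)]
    \<comment> \<open>\<open>1 + (N1 - N2) / sqrt 2 = p (1 + N1) + p (1 - N2) + m (1 - N1) + m (1 + N2)\<close>\<close>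
    define p m where "p = (sqrt 2 + 1) / 4" and "m = - ((sqrt 2 - 1) / 4 :: real)"
    let ?S = "(complex_of_real p \<cdot>\<^sub>m ?P + complex_of_real p \<cdot>\<^sub>m ?Q') +
      (complex_of_real m \<cdot>\<^sub>m ?P' + complex_of_real m \<cdot>\<^sub>m ?Q)"
    from decomposable_add[OF
        decomposable_add[OF decomposable_smult[OF d1(1), of p] decomposable_smult[OF d2(2), of p]]
        decomposable_add[OF decomposable_smult[OF d1(2), of m] decomposable_smult[OF d2(1), of m]]]
    have dec: "decomposable n ?S ((p * 1 + p * 1) + (m * 1 + m * 1))
        ((\<bar>p\<bar> * 1 + \<bar>p\<bar> * 1) + (\<bar>m\<bar> * 1 + \<bar>m\<bar> * 1))" .
    \<comment> \<open>\<open>m\<close> is negative, so the norm is \<open>2 * (p - m)\<close>. The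
      values of \<open>p\<close> and \<open>m\<close> solve \<open>2 * p + 2 * m = 1\<close>, the
      condition on the group part, and \<open>p - m = 1 / sqrt 2\<close>, the condition on the coset
      parts.\<close>
    have abs: "\<bar>p\<bar> = p" "\<bar>m\<bar> = - m" by (simp_all add: p_def m_def)
    have sums: "(p * 1 + p * 1) + (m * 1 + m * 1) = 1"
      "(\<bar>p\<bar> * 1 + \<bar>p\<bar> * 1) + (\<bar>m\<bar> * 1 + \<bar>m\<bar> * 1) = sqrt 2"
      unfolding abs by (simp_all add: p_def m_def field_simps)
    have pm: "complex_of_real p + complex_of_real p + complex_of_real m + complex_of_real m = 1"
      "complex_of_real p - complex_of_real m = complex_of_real (1 / sqrt 2)"
    proof -
      show "complex_of_real p + complex_of_real p + complex_of_real m + complex_of_real m = 1"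
        using arg_cong[OF sums(1), of complex_of_real] by (simp add: add.commute)
      have "p - m = 1 / sqrt 2" unfolding half by (simp add: p_def m_def field_simps)
      then show "complex_of_real p - complex_of_real m = complex_of_real (1 / sqrt 2)"
        by (simp only: of_real_diff[symmetric])
    qed
    have "?S = ?\<rho>"
    proof (rule eq_matI)
      fix i j assume "i < dim_row ?\<rho>" "j < dim_col ?\<rho>"
      then have ij: "i < 2 ^ n" "j < 2 ^ n" by (auto simp: magic_sum_def)
      define a b c where "a = (\<Sum>M\<in>H. M $$ (i, j))" "b = (\<Sum>M\<in>(*) N1 ` H. M $$ (i, j))"
        "c = (\<Sum>M\<in>(*) N2 ` H. M $$ (i, j))"
      let ?p = "complex_of_real p" and ?m = "complex_of_real m"
      have "?S $$ (i, j) = ?p * ((a + b) / 2 ^ n) + ?p * ((a - c) / 2 ^ n) + (?m * ((a - b) / 2 ^ n) + ?m * ((a + c) / 2 ^ n))"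
        using ij by (simp add: stab_state_extend_entry[OF H N(1-3) ij] stab_state_extend_entry[OF H N(5-7) ij]
            a_b_c_def)
      also have "\<dots> = ((?p + ?p + ?m + ?m) * a + (?p - ?m) * (b - c)) / 2 ^ n"
        by (simp add: field_simps)
      also have "\<dots> = ?\<rho> $$ (i, j)"
        unfolding pm using ij by (simp add: magic_sum_def a_b_c_def)
      finally show "?S $$ (i, j) = ?\<rho> $$ (i, j)" .
    qed (auto simp: magic_sum_def)
    with dec sums show ?thesis by simp
  qed
  fix S and x :: "complex mat \<Rightarrow> real"
  assume S: "finite S" "S \<subseteq> pure_stabilizer_states n"
    "?\<rho> = mat (2 ^ n) (2 ^ n) (\<lambda>(i, j). \<Sum>\<sigma>\<in>S. of_real (x \<sigma>) * \<sigma> $$ (i, j))"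
  \<comment> \<open>The witness has value \<open>2 / sqrt 2\<close> on the state and at most 1 in
    modulus on each pure stabilizer state.\<close>
  have "sqrt 2 = expectation ?\<rho> N1 - expectation ?\<rho> N2"
    unfolding e half by simp
  also have "\<dots> = (\<Sum>\<sigma>\<in>S. x \<sigma> * expectation \<sigma> N1) - (\<Sum>\<sigma>\<in>S. x \<sigma> * expectation \<sigma> N2)"
    unfolding S(3) expectation_linear[OF S(2) hermitian_pauli_carrier[OF N(1)]]
      expectation_linear[OF S(2) hermitian_pauli_carrier[OF N(5)]] ..
  also have "\<dots> = (\<Sum>\<sigma>\<in>S. x \<sigma> * (expectation \<sigma> N1 - expectation \<sigma> N2))"
    by (simp add: right_diff_distrib sum_subtractf)
  also have "\<dots> \<le> (\<Sum>\<sigma>\<in>S. \<bar>x \<sigma>\<bar>)"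
  proof (rule sum_mono)
    fix \<sigma> assume "\<sigma> \<in> S"
    then have "\<sigma> \<in> pure_stabilizer_states n" using S(2) by blast
    then obtain K where "stabilizer_group n K"
      "\<forall>P\<in>hermitian_paulis n. expectation \<sigma> P = signed_indicator K P"
      by (rule expectation_pure)
    then have "\<bar>expectation \<sigma> N1 - expectation \<sigma> N2\<bar> \<le> 1"
      using anticommuting_signed_indicator[OF _ N(1,5) anti] N(1,5) by simp
    then have "\<bar>x \<sigma>\<bar> * \<bar>expectation \<sigma> N1 - expectation \<sigma> N2\<bar> \<le> \<bar>x \<sigma>\<bar> * 1"
      by (intro mult_left_mono) auto
    then show "x \<sigma> * (expectation \<sigma> N1 - expectation \<sigma> N2) \<le> \<bar>x \<sigma>\<bar>"
      using abs_ge_self[of "x \<sigma> * (expectation \<sigma> N1 - expectation \<sigma> N2)"] by (simp add: abs_mult)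
  qed
  finally show "sqrt 2 \<le> (\<Sum>\<sigma>\<in>S. \<bar>x \<sigma>\<bar>)" .
qed

section \<open>Orders of reduced groups and cosets as combination counts\<close>

section \<open>Counting operators supported on the subset\<close>

context qubit_subset
begin

definition kept :: "bool list" where
  "kept = map (\<lambda>k. k \<in> A) [0..<L]"

definition supported_op :: "complex mat \<Rightarrow> bool" where
  "supported_op M \<longleftrightarrow> (\<exists>v c. length v = 2 * L \<and> c \<noteq> 0 \<and> supported v \<and> M = scaled_pauli L v c)"

lemma length_kept [simp]: "length kept = L"
  by (simp add: kept_def)

lemma masked_nth: "length v = 2 * L \<Longrightarrow> i < 2 * L \<Longrightarrow> masked kept v ! i \<longleftrightarrow> v ! i \<and> \<not> (if i < L then i \<in> A else i - L \<in> A)"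
proof -
  assume a: "length v = 2 * L" "i < 2 * L"
  then have "\<not> i < L \<Longrightarrow> i - L < L" by arith
  with a show ?thesis by (cases "i < L") (simp_all add: masked_def kept_def nth_append)
qed

lemma masked_vxor:
  "length v = 2 * L \<Longrightarrow> length w = 2 * L \<Longrightarrow> masked kept (vxor v w) = vxor (masked kept v) (masked kept w)"
  by (rule nth_equalityI) (auto simp: masked_nth)

lemma masked_zeros: "masked kept (zeros (2 * L)) = zeros (2 * L)"
  by (rule nth_equalityI) (auto simp: masked_nth)

lemma supported_iff_masked:
  assumes "length v = 2 * L"
  shows "supported v \<longleftrightarrow> True \<notin> set (masked kept v)"
proof
  assume s: "supported v"
  show "True \<notin> set (masked kept v)"
  proof
    assume "True \<in> set (masked kept v)"
    then obtain i where i: "i < 2 * L" "masked kept v ! i" using assms by (auto simp: in_set_conv_nth)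
    show False
    proof (cases "i < L")
      case True
      then show ?thesis using i assms s by (auto simp: masked_nth supported_def)
    next
      case False
      then have "i - L < L" "i = L + (i - L)" using i by auto
      then show ?thesis using i assms s False unfolding supported_def by (metis masked_nth)
    qed
  qed
next
  assume *: "True \<notin> set (masked kept v)"
  have m: "\<not> masked kept v ! i" if "i < 2 * L" for i
    using * that assms by (metis (full_types) length_kept length_masked min.idem nth_mem)
  show "supported v"
    unfolding supported_def
  proof (intro allI impI conjI)
    fix k assume k: "k < L" "k \<notin> A"
    then show "\<not> v ! k" using m[of k] assms by (simp add: masked_nth)
    show "\<not> v ! (L + k)" using m[of "L + k"] k assms by (simp add: masked_nth)
  qed
qed

lemma supported_op_scaled:
  assumes "length v = 2 * L" "c \<noteq> 0"
  shows "supported_op (scaled_pauli L v c) \<longleftrightarrow> supported v"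
proof
  assume "supported_op (scaled_pauli L v c)"
  then obtain w d where w: "length w = 2 * L" "supported w" "scaled_pauli L v c = scaled_pauli L w d"
    unfolding supported_op_def by blast
  with scaled_pauli_inject[OF w(3) assms(1) w(1) assms(2)] show "supported v" by simp
qed (use assms supported_op_def in blast)

lemma supported_op_iff:
  assumes "M \<in> hermitian_paulis L"
  shows "supported_op M \<longleftrightarrow> (\<exists>M'. reduces_to M M')"
proof -
  obtain v c where v: "length v = 2 * L" "c = 1 \<or> c = -1" "M = scaled_pauli L v c"
    using assms by (rule hermitian_pauliE)
  have c: "c \<noteq> 0" using v(2) by auto
  show ?thesis
  proof
    assume "supported_op M"
    then have "supported v" using supported_op_scaled[OF v(1) c] v(3) by simp
    with v show "\<exists>M'. reduces_to M M'" unfolding reduces_to_def by blast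
  next
    assume "\<exists>M'. reduces_to M M'"
    then obtain M' where "reduces_to M M'" by blast
    then obtain w d where w: "length w = 2 * L" "d = 1 \<or> d = -1" "supported w" "M = scaled_pauli L w d"
      by (rule reduces_toE)
    then have "d \<noteq> 0" by auto
    with w show "supported_op M" unfolding supported_op_def by blast
  qed
qed

text \<open>The group splits into the group of the remaining generators and its coset by
  \<open>g\<close>, which is the recursion of \<open>combination_count\<close>. Both
  \<open>w\<close> and \<open>c\<close> are arbitrary because passing to the coset multiplies by
  \<open>g\<close>. Independence of the generators enters through the disjointness of the
  coset.\<close>

lemma card_supported:
  assumes "stabilizer_generators L gs" "length w = 2 * L" "c \<noteq> 0"
  shows "card {M \<in> stab_group L gs. supported_op (scaled_pauli L w c * M)} =
    combination_count (map (\<lambda>g. masked kept (snd g)) gs) (masked kept w)"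
  using assms
proof (induction gs arbitrary: w c)
  case Nil
  have "scaled_pauli L w c * 1\<^sub>m (2 ^ L) = scaled_pauli L w c"
    by (rule right_mult_one_mat[OF scaled_pauli_carrier])
  then have "{M \<in> {1\<^sub>m (2 ^ L)}. supported_op (scaled_pauli L w c * M)} =
      (if supported w then {1\<^sub>m (2 ^ L)} else {})"
    using supported_op_scaled[OF Nil.prems(2,3)] by auto
  then show ?case
    using supported_iff_masked[OF Nil.prems(2)] by (simp add: stab_group_Nil)
next
  case (Cons g gs)
  note D = stabilizer_generators_ConsD[OF Cons.prems(1)]
  let ?G = "stab_group L gs" and ?g = "pauli_op L g"
  let ?S = "\<lambda>M. supported_op (scaled_pauli L w c * M)"
  note G = stabilizer_generators_group[OF D(1)]
  have G': "stab_group L (g # gs) = ?G \<union> (*) ?g ` ?G" by (rule stab_group_Cons[OF D(1,2,5)])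
  have disj: "?G \<inter> (*) ?g ` ?G = {}" by (rule coset_disjoint[OF G D(2,3)])
  have fin: "finite ?G" using stabilizer_groupD(8)[OF G] .
  have gc: "?g \<in> carrier_mat (2 ^ L) (2 ^ L)" using hermitian_pauli_carrier[OF D(2)] .
  have "valid_pauli L g" using Cons.prems(1) unfolding stabilizer_generators_def by simp
  then have len: "length (snd g) = 2 * L" by (simp add: valid_pauli_def)
  define d where "d = c * (if fst g then -1 else 1) * phase L w (snd g)"
  have d: "d \<noteq> 0" using Cons.prems(3) by (simp add: d_def)
  have wg: "scaled_pauli L w c * ?g = scaled_pauli L (vxor w (snd g)) d"
    unfolding pauli_op_scaled d_def by (rule scaled_pauli_mult[OF Cons.prems(2) len])
  have shift: "?S (?g * M) \<longleftrightarrow> supported_op (scaled_pauli L (vxor w (snd g)) d * M)" if "M \<in> ?G" for M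
    using assoc_mult_mat[OF scaled_pauli_carrier gc stabilizer_groupD(7)[OF G that], of w c] wg by simp
  have "{M \<in> stab_group L (g # gs). ?S M} = {M \<in> ?G. ?S M} \<union> {M \<in> (*) ?g ` ?G. ?S M}"
    unfolding G' by blast
  moreover have "card ({M \<in> ?G. ?S M} \<union> {M \<in> (*) ?g ` ?G. ?S M}) =
      card {M \<in> ?G. ?S M} + card {M \<in> (*) ?g ` ?G. ?S M}"
    by (rule card_Un_disjoint) (use fin disj in auto)
  moreover have "{M \<in> (*) ?g ` ?G. ?S M} =
      (*) ?g ` {M \<in> ?G. supported_op (scaled_pauli L (vxor w (snd g)) d * M)}"
    using shift by auto
  moreover have "card ((*) ?g ` {M \<in> ?G. supported_op (scaled_pauli L (vxor w (snd g)) d * M)}) =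
      card {M \<in> ?G. supported_op (scaled_pauli L (vxor w (snd g)) d * M)}"
    by (rule card_image[OF inj_on_subset[OF inj_on_coset[OF G D(2)]]]) auto
  moreover have "length (vxor w (snd g)) = 2 * L" using Cons.prems(2) len by simp
  ultimately show ?case
    using Cons.IH[OF D(1) Cons.prems(2,3)] Cons.IH[OF D(1) _ d, of "vxor w (snd g)"]
      masked_vxor[OF Cons.prems(2) len] by (simp add: vxor_commute)
qed

text \<open>Reduction is a bijection from the supported elements of the coset onto its image. The
  identity is a possible \<open>p\<close>, and this case gives the order of the reduced
  group.\<close>

lemma card_reduction_coset:
  assumes gs: "stabilizer_generators L gs" and p: "valid_pauli L p"
    and comm: "\<And>M. M \<in> stab_group L gs \<Longrightarrow> pauli_op L p * M = M * pauli_op L p"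
  shows "card (reduction ((*) (pauli_op L p) ` stab_group L gs)) =
    combination_count (map (\<lambda>g. masked kept (snd g)) gs) (masked kept (snd p))"
proof -
  let ?G = "stab_group L gs" and ?p = "pauli_op L p"
  note G = stabilizer_generators_group[OF gs]
  have ph: "?p \<in> hermitian_paulis L" by (rule pauli_op_hermitian[OF p])
  have herm: "?p * M \<in> hermitian_paulis L" if "M \<in> ?G" for M
    by (rule hermitian_pauli_mult[OF ph stabilizer_groupD(6)[OF G that] comm[OF that]])
  define r where "r M = (THE M'. reduces_to (?p * M) M')" for M
  have r: "r M = M'" if "reduces_to (?p * M) M'" for M M'
    unfolding r_def using that reduces_to_unique by blast
  let ?S = "{M \<in> ?G. supported_op (?p * M)}"
  have rS: "reduces_to (?p * M) (r M)" if M: "M \<in> ?S" for M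
  proof -
    obtain M' where "reduces_to (?p * M) M'" using M supported_op_iff[OF herm] by blast
    with r[OF this] show ?thesis by simp
  qed
  have "inj_on r ?S"
  proof (rule inj_onI)
    fix M N assume MN: "M \<in> ?S" "N \<in> ?S" "r M = r N"
    then have "reduces_to (?p * M) (r N)" using rS[OF MN(1)] by simp
    with reduces_to_inject[OF _ rS[OF MN(2)]] have "?p * M = ?p * N" by blast
    with inj_on_coset[OF G ph] MN(1,2) show "M = N" by (auto dest: inj_onD)
  qed
  moreover have "r ` ?S = reduction ((*) ?p ` ?G)"
  proof
    show "r ` ?S \<subseteq> reduction ((*) ?p ` ?G)"
    proof
      fix M' assume "M' \<in> r ` ?S"
      then obtain M where M: "M \<in> ?S" "M' = r M" by blast
      with rS[OF M(1)] show "M' \<in> reduction ((*) ?p ` ?G)" by (auto simp: reduction_def)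
    qed
    show "reduction ((*) ?p ` ?G) \<subseteq> r ` ?S"
    proof
      fix M' assume "M' \<in> reduction ((*) ?p ` ?G)"
      then obtain M where M: "M \<in> ?G" "reduces_to (?p * M) M'" by (auto simp: reduction_def)
      then have "M \<in> ?S" using supported_op_iff[OF herm[OF M(1)]] by blast
      with r[OF M(2)] show "M' \<in> r ` ?S" by blast
    qed
  qed
  ultimately have "card (reduction ((*) ?p ` ?G)) = card ?S" by (metis card_image)
  also have "\<dots> = combination_count (map (\<lambda>g. masked kept (snd g)) gs) (masked kept (snd p))"
    using card_supported[OF gs, of "snd p" "if fst p then -1 else 1"] p
    by (simp add: pauli_op_scaled valid_pauli_def)
  finally show ?thesis .
qed

lemma card_reduction_group:
  assumes gs: "stabilizer_generators L gs"
  shows "card (reduction (stab_group L gs)) =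
    combination_count (map (\<lambda>g. masked kept (snd g)) gs) (zeros (2 * L))"
proof -
  let ?p = "(False, zeros (2 * L))"
  note G = stabilizer_generators_group[OF gs]
  have p: "valid_pauli L ?p" "pauli_op L ?p = 1\<^sub>m (2 ^ L)"
    by (simp_all add: valid_pauli_def pauli_op_scaled scaled_pauli_one)
  have l: "1\<^sub>m (2 ^ L) * M = M" "M * 1\<^sub>m (2 ^ L) = M" if "M \<in> stab_group L gs" for M
    using stabilizer_groupD(7)[OF G that] by simp_all
  have "(*) (pauli_op L ?p) ` stab_group L gs = stab_group L gs"
    unfolding p(2) using l(1) by force
  with card_reduction_coset[OF gs p(1)] l show ?thesis by (simp add: p(2) masked_zeros)
qed

section \<open>The reduced code state\<close>

lemma reduced_magic_sum:
  assumes X: "X0 \<subseteq> hermitian_paulis L" "X1 \<subseteq> hermitian_paulis L" "X2 \<subseteq> hermitian_paulis L"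
  shows "reduced_state L A (magic_sum L X0 X1 X2) = magic_sum n (reduction X0) (reduction X1) (reduction X2)"
proof (rule eq_matI)
  fix a a' assume "a < dim_row (magic_sum n (reduction X0) (reduction X1) (reduction X2))"
    "a' < dim_col (magic_sum n (reduction X0) (reduction X1) (reduction X2))"
  then have a: "a < 2 ^ n" "a' < 2 ^ n" by (simp_all add: magic_sum_def)
  let ?s = "complex_of_real (1 / sqrt 2)"
  let ?m = "\<lambda>i j. of_bool (matching a a' i j) :: complex"
  let ?X = "\<lambda>X i j. mat_sum (2 ^ L) X $$ (i, j)"
  let ?R = "\<lambda>X. mat_sum (2 ^ n) (reduction X) $$ (a, a')"
  have "reduced_state L A (magic_sum L X0 X1 X2) $$ (a, a') =
      (\<Sum>i<2 ^ L. \<Sum>j<2 ^ L. (?m i j * ?X X0 i j + ?s * (?m i j * ?X X1 i j - ?m i j * ?X X2 i j)) / 2 ^ L)"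
    unfolding reduced_state_entry[OF a]
    by (intro sum.cong refl) (simp add: magic_sum_def algebra_simps)
  also have "\<dots> = (reduced_state L A (mat_sum (2 ^ L) X0) $$ (a, a') +
      ?s * (reduced_state L A (mat_sum (2 ^ L) X1) $$ (a, a') - reduced_state L A (mat_sum (2 ^ L) X2) $$ (a, a'))) / 2 ^ L"
    unfolding reduced_state_entry[OF a]
    by (simp only: sum_divide_distrib[symmetric] sum.distrib sum_distrib_left[symmetric] sum_subtractf)
  also have "\<dots> = 2 ^ (L - n) * (?R X0 + ?s * (?R X1 - ?R X2)) / 2 ^ L"
    unfolding reduced_mat_sum[OF X(1) a] reduced_mat_sum[OF X(2) a] reduced_mat_sum[OF X(3) a]
    by (simp add: algebra_simps)
  also have "\<dots> = (?R X0 + ?s * (?R X1 - ?R X2)) / 2 ^ n"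
  proof -
    have "(2 :: complex) ^ L = 2 ^ (L - n) * 2 ^ n" using n_le_L by (simp add: power_add[symmetric])
    then show ?thesis by simp
  qed
  also have "\<dots> = magic_sum n (reduction X0) (reduction X1) (reduction X2) $$ (a, a')"
    using a by (simp add: magic_sum_def)
  finally show "reduced_state L A (magic_sum L X0 X1 X2) $$ (a, a') =
    magic_sum n (reduction X0) (reduction X1) (reduction X2) $$ (a, a')" .
qed (simp_all add: magic_sum_def reduced_state_def)

end

lemma foldr_generators:
  assumes "stabilizer_generators L gs"
  shows "foldr (\<lambda>g M. (1\<^sub>m (2 ^ L) + pauli_op L g) * M) gs (1\<^sub>m (2 ^ L)) = mat_sum (2 ^ L) (stab_group L gs)"
  using assms
proof (induction gs)
  case Nil
  show ?case by (rule eq_matI) (simp_all add: stab_group_Nil)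
next
  case (Cons g gs)
  note D = stabilizer_generators_ConsD[OF Cons.prems]
  note G = stabilizer_generators_group[OF D(1)]
  note E = stabilizer_groupD[OF G]
  let ?S = "mat_sum (2 ^ L) (stab_group L gs)" and ?g = "pauli_op L g"
  have gc: "?g \<in> carrier_mat (2 ^ L) (2 ^ L)" using hermitian_pauli_carrier[OF D(2)] .
  have G': "stab_group L (g # gs) = stab_group L gs \<union> (*) ?g ` stab_group L gs"
    by (rule stab_group_Cons[OF D(1,2,5)])
  have "(1\<^sub>m (2 ^ L) + ?g) * ?S = 1\<^sub>m (2 ^ L) * ?S + ?g * ?S"
    by (rule add_mult_distrib_mat[OF one_carrier_mat gc mat_sum_carrier])
  also have "\<dots> = ?S + mat_sum (2 ^ L) ((*) ?g ` stab_group L gs)"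
    using mult_mat_sum[OF gc _ inj_on_coset[OF G D(2)]] E(7) by (simp add: left_mult_one_mat[OF mat_sum_carrier] subsetI)
  also have "\<dots> = mat_sum (2 ^ L) (stab_group L (g # gs))"
    unfolding G'
    by (rule mat_sum_Un[symmetric, OF E(8) finite_imageI[OF E(8)] coset_disjoint[OF G D(2,3)]])
  finally show ?case using Cons.IH[OF D(1)] by simp
qed

lemma code_magic_state_eq:
  assumes gs: "stabilizer_generators L gs" and z: "valid_pauli L zb" and y: "valid_pauli L yb"
  shows "code_magic_state L gs zb yb = magic_sum L (stab_group L gs)
    ((*) (pauli_op L zb) ` stab_group L gs) ((*) (pauli_op L yb) ` stab_group L gs)"
proof (rule eq_matI)
  let ?G = "stab_group L gs" and ?Z = "pauli_op L zb" and ?Y = "pauli_op L yb"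
  let ?S = "mat_sum (2 ^ L) ?G" and ?s = "complex_of_real (1 / sqrt 2)"
  let ?C = "1\<^sub>m (2 ^ L) + ?s \<cdot>\<^sub>m (?Z - ?Y)"
  note G = stabilizer_generators_group[OF gs]
  have Zh: "?Z \<in> hermitian_paulis L" and Yh: "?Y \<in> hermitian_paulis L"
    using pauli_op_hermitian z y by auto
  note Zc = hermitian_pauli_carrier[OF Zh] and Yc = hermitian_pauli_carrier[OF Yh]
  have C: "?C \<in> carrier_mat (2 ^ L) (2 ^ L)" using Zc Yc by auto
  fix i j assume "i < dim_row (magic_sum L ?G ((*) ?Z ` ?G) ((*) ?Y ` ?G))"
    "j < dim_col (magic_sum L ?G ((*) ?Z ` ?G) ((*) ?Y ` ?G))"
  then have ij: "i < 2 ^ L" "j < 2 ^ L" by (simp_all add: magic_sum_def)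
  have sub: "?G \<subseteq> carrier_mat (2 ^ L) (2 ^ L)" using stabilizer_groupD(7)[OF G] by blast
  have "(?C * ?S) $$ (i, j) = (\<Sum>k<2 ^ L. 1\<^sub>m (2 ^ L) $$ (i, k) * ?S $$ (k, j) +
      ?s * (?Z $$ (i, k) * ?S $$ (k, j) - ?Y $$ (i, k) * ?S $$ (k, j)))"
    unfolding mat_mult_entry[OF C mat_sum_carrier ij]
    by (intro sum.cong refl) (use ij Zc Yc in \<open>auto simp: algebra_simps\<close>)
  also have "\<dots> = (1\<^sub>m (2 ^ L) * ?S) $$ (i, j) + ?s * ((?Z * ?S) $$ (i, j) - (?Y * ?S) $$ (i, j))"
    unfolding mat_mult_entry[OF one_carrier_mat mat_sum_carrier ij] mat_mult_entry[OF Zc mat_sum_carrier ij]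
      mat_mult_entry[OF Yc mat_sum_carrier ij]
    by (simp only: sum.distrib sum_distrib_left[symmetric] sum_subtractf)
  also have "\<dots> = ?S $$ (i, j) + ?s * (mat_sum (2 ^ L) ((*) ?Z ` ?G) $$ (i, j) -
      mat_sum (2 ^ L) ((*) ?Y ` ?G) $$ (i, j))"
    by (simp only: left_mult_one_mat[OF mat_sum_carrier] mult_mat_sum[OF Zc sub inj_on_coset[OF G Zh]]
        mult_mat_sum[OF Yc sub inj_on_coset[OF G Yh]])
  finally have "(?C * ?S) $$ (i, j) = ?S $$ (i, j) + ?s * (mat_sum (2 ^ L) ((*) ?Z ` ?G) $$ (i, j) -
      mat_sum (2 ^ L) ((*) ?Y ` ?G) $$ (i, j))" .
  moreover have "code_magic_state L gs zb yb $$ (i, j) = 1 / 2 ^ L * (?C * ?S) $$ (i, j)"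
    unfolding code_magic_state_def foldr_generators[OF gs] using ij carrier_matD[OF Yc]
    by (subst index_smult_mat) simp_all
  ultimately show "code_magic_state L gs zb yb $$ (i, j) =
      magic_sum L ?G ((*) ?Z ` ?G) ((*) ?Y ` ?G) $$ (i, j)"
    using ij by (simp add: magic_sum_def)
next
  have "pauli_op L zb \<in> carrier_mat (2 ^ L) (2 ^ L)" "pauli_op L yb \<in> carrier_mat (2 ^ L) (2 ^ L)"
    using hermitian_pauli_carrier pauli_op_hermitian z y by auto
  then show "dim_row (code_magic_state L gs zb yb) = dim_row (magic_sum L (stab_group L gs)
      ((*) (pauli_op L zb) ` stab_group L gs) ((*) (pauli_op L yb) ` stab_group L gs))"
    "dim_col (code_magic_state L gs zb yb) = dim_col (magic_sum L (stab_group L gs)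
      ((*) (pauli_op L zb) ` stab_group L gs) ((*) (pauli_op L yb) ` stab_group L gs))"
    unfolding code_magic_state_def foldr_generators[OF gs] by (auto simp: magic_sum_def)
qed

section \<open>The quantities of the reduced state as functions of \<open>k\<close> and
  \<open>c\<close>\<close>

section \<open>Spectrum, entropy and robustness of the reduced state\<close>

definition logical_coset :: "nat \<Rightarrow> complex mat set \<Rightarrow> complex mat set \<Rightarrow> complex mat \<Rightarrow> bool" where
  "logical_coset n H S N \<longleftrightarrow> N \<in> hermitian_paulis n \<and> N \<notin> H \<and> - N \<notin> H \<and>
     (\<forall>M\<in>H. N * M = M * N) \<and> S = (*) N ` H"

text \<open>All facts are read off from the stabilizer group formed by \<open>H\<close> and the
  coset together.\<close>

lemma logical_cosetD:
  assumes "stabilizer_group n H" "logical_coset n H S N"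
  shows "S \<subseteq> hermitian_paulis n" "\<And>M. M \<in> S \<Longrightarrow> - M \<notin> S" "\<And>M. M \<in> S \<Longrightarrow> M \<notin> H \<and> - M \<notin> H"
    "card S = card H" "N \<in> S" "\<And>M. M \<in> S \<Longrightarrow> M * N = N * M"
proof -
  have N: "N \<in> hermitian_paulis n" "N \<notin> H" "- N \<notin> H" and comm: "\<And>M. M \<in> H \<Longrightarrow> N * M = M * N"
    and S: "S = (*) N ` H"
    using assms(2) unfolding logical_coset_def by blast+
  have E: "stabilizer_group n (H \<union> S)" unfolding S by (rule stabilizer_group_extend(1)[OF assms(1) N comm])
  have disj: "H \<inter> S = {}" unfolding S by (rule coset_disjoint[OF assms(1) N(1,2)])
  note D = stabilizer_groupD[OF assms(1)]
  show "S \<subseteq> hermitian_paulis n" using stabilizer_groupD(1)[OF E] by blast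
  show "- M \<notin> S" if "M \<in> S" for M using stabilizer_group_uminus[OF E, of M] that by blast
  show "M \<notin> H \<and> - M \<notin> H" if "M \<in> S" for M
    using stabilizer_group_uminus[OF E, of M] that disj by blast
  show "card S = card H" unfolding S by (rule card_image[OF inj_on_coset[OF assms(1) N(1)]])
  show NS: "N \<in> S" unfolding S
    using D(2) right_mult_one_mat[OF hermitian_pauli_carrier[OF N(1)]] by (metis image_eqI)
  show "M * N = N * M" if "M \<in> S" for M
    using stabilizer_groupD(5)[OF E, of M N] that NS by blast
qed

lemma pauli_vectors_disjoint:
  assumes "\<And>M. M \<in> S \<Longrightarrow> M \<notin> T \<and> - M \<notin> T"
  shows "pauli_vectors n S \<inter> pauli_vectors n T = {}"
proof -
  have "- scaled_pauli n v 1 = scaled_pauli n v (-1)" "- scaled_pauli n v (-1) = scaled_pauli n v 1" for v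
    by (simp_all add: scaled_pauli_uminus)
  then show ?thesis using assms unfolding pauli_vectors_def by (auto, metis+)
qed

text \<open>An element of \<open>S\<close> is \<open>N\<close> times an element commuting with
  \<open>K\<close>, so it fails to commute with \<open>K\<close>, whereas every element of
  \<open>T\<close> commutes with \<open>K\<close>. Hence the two cosets share no operator even up to
  sign, and their terms cannot interfere.\<close>

lemma anticommuting_cosets:
  assumes H: "stabilizer_group n H" and S: "logical_coset n H S N" and T: "logical_coset n H T K"
    and anti: "N * K \<noteq> K * N"
  shows "\<And>M. M \<in> S \<Longrightarrow> M \<notin> T \<and> - M \<notin> T"
proof -
  fix M assume M: "M \<in> S"
  note DS = logical_cosetD[OF H S] and DT = logical_cosetD[OF H T]
  have N: "N \<in> hermitian_paulis n" and K: "K \<in> hermitian_paulis n"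
    using S T unfolding logical_coset_def by blast+
  note Nc = hermitian_pauli_carrier[OF N] and Kc = hermitian_pauli_carrier[OF K]
  obtain P where P: "P \<in> H" "M = N * P" using S M unfolding logical_coset_def by blast
  have Pc: "P \<in> carrier_mat (2 ^ n) (2 ^ n)" using stabilizer_groupD(7)[OF H P(1)] .
  have PK: "P * K = K * P" using T P(1) unfolding logical_coset_def by metis
  have PP: "P * P = 1\<^sub>m (2 ^ n)" using hermitian_pauli_square[OF stabilizer_groupD(6)[OF H P(1)]] .
  have NM: "N = M * P"
    using assoc_mult_mat[OF Nc Pc Pc] PP right_mult_one_mat[OF Nc] P(2) by simp
  have Mc: "M \<in> carrier_mat (2 ^ n) (2 ^ n)" using P(2) Nc Pc by simp
  have no: "M * K \<noteq> K * M"
  proof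
    assume MK: "M * K = K * M"
    have "N * K = M * (P * K)" using assoc_mult_mat[OF Mc Pc Kc] NM by simp
    also have "\<dots> = (M * K) * P" using assoc_mult_mat[OF Mc Kc Pc] PK by simp
    also have "\<dots> = K * N" using assoc_mult_mat[OF Kc Mc Pc] MK NM by simp
    finally show False using anti by simp
  qed
  have "M \<notin> T" using DT(6)[of M] no by blast
  moreover have "- M \<notin> T"
  proof
    assume "- M \<in> T"
    then have "- M * K = K * - M" by (rule DT(6))
    then have "- (M * K) = - (K * M)" by (simp add: mult_uminus_left[OF Mc Kc] mult_uminus_right[OF Kc Mc])
    with no show False by (metis uminus_uminus_mat)
  qed
  ultimately show "M \<notin> T \<and> - M \<notin> T" by blast
qed

lemma signed_indicator_cases:
  assumes "\<And>M. M \<in> S \<Longrightarrow> - M \<notin> S" "length v = 2 * n"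
  shows "v \<in> pauli_vectors n S \<Longrightarrow> (signed_indicator S (scaled_pauli n v 1))\<^sup>2 = 1"
    "v \<notin> pauli_vectors n S \<Longrightarrow> signed_indicator S (scaled_pauli n v 1) = 0"
  using assms(2) assms(1)[of "scaled_pauli n v 1"]
  by (auto simp: pauli_vectors_def signed_indicator_def scaled_pauli_uminus)

text \<open>For each vector at most one of the three sets contributes, so squaring produces no cross
  terms; the weight \<open>1 / sqrt 2\<close> squares to \<open>1 / 2\<close>.\<close>

lemma pauli_expectation_square:
  assumes S: "S0 \<subseteq> hermitian_paulis n" "S1 \<subseteq> hermitian_paulis n" "S2 \<subseteq> hermitian_paulis n"
    and neg: "\<And>M. M \<in> S0 \<Longrightarrow> - M \<notin> S0" "\<And>M. M \<in> S1 \<Longrightarrow> - M \<notin> S1" "\<And>M. M \<in> S2 \<Longrightarrow> - M \<notin> S2"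
    and disj: "pauli_vectors n S0 \<inter> pauli_vectors n S1 = {}" "pauli_vectors n S0 \<inter> pauli_vectors n S2 = {}"
      "pauli_vectors n S1 \<inter> pauli_vectors n S2 = {}"
    and v: "length v = 2 * n"
  shows "(pauli_expectation n (magic_sum n S0 S1 S2) v)\<^sup>2 =
    (if v \<in> pauli_vectors n S0 then 1 else if v \<in> pauli_vectors n S1 \<union> pauli_vectors n S2 then 1 / 2 else 0)"
proof -
  let ?e = "\<lambda>S. signed_indicator S (scaled_pauli n v 1)"
  have "scaled_pauli n v 1 \<in> hermitian_paulis n" by (rule hermitian_pauliI) (use v in auto)
  moreover have "scaled_pauli n v 1 = pauli_string n v" by (auto simp: scaled_pauli_def intro!: eq_matI)
  ultimately have e: "pauli_expectation n (magic_sum n S0 S1 S2) v = ?e S0 + (?e S1 - ?e S2) / sqrt 2"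
    using expectation_magic_sum[OF S, of "scaled_pauli n v 1"] by (simp add: pauli_expectation_def expectation_def)
  note c0 = signed_indicator_cases[where S = S0, OF neg(1) v] and c1 = signed_indicator_cases[where S = S1, OF neg(2) v]
    and c2 = signed_indicator_cases[where S = S2, OF neg(3) v]
  consider "v \<in> pauli_vectors n S0" "v \<notin> pauli_vectors n S1" "v \<notin> pauli_vectors n S2"
    | "v \<notin> pauli_vectors n S0" "v \<in> pauli_vectors n S1" "v \<notin> pauli_vectors n S2"
    | "v \<notin> pauli_vectors n S0" "v \<notin> pauli_vectors n S1" "v \<in> pauli_vectors n S2"
    | "v \<notin> pauli_vectors n S0" "v \<notin> pauli_vectors n S1" "v \<notin> pauli_vectors n S2"
    using disj by blast
  then show ?thesis
    by cases (simp_all add: e c0 c1 c2 power_divide)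
qed

lemma spectrum_and_entropy:
  fixes V W :: "bool list set"
  assumes sub: "V \<subseteq> {v. length v = 2 * n}" "W \<subseteq> {v. length v = 2 * n}" and disj: "V \<inter> W = {}"
    and sq: "\<And>v. length v = 2 * n \<Longrightarrow> (pauli_expectation n \<rho> v)\<^sup>2 =
      (if v \<in> V then 1 else if v \<in> W then 1 / 2 else 0)"
    and card: "card V = 2 ^ k" "card W = c * 2 ^ k" and c: "c \<le> 2"
  shows "represents_spectrum (spectrum_output n k c) (pauli_spectrum n \<rho>)"
    and "represents_entropy (if c = 0 then 1 else if c = 1 then 5 / 6 else 3 / 4) (stabilizer_entropy n \<rho>)"
proof -
  let ?U = "{v :: bool list. length v = 2 * n}" and ?E = "pauli_expectation n \<rho>"
  have fin: "finite V" "finite W" using sub finite_subset[OF _ finite_bool_lists] by blast+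
  have count: "count (pauli_spectrum n \<rho>) x = card {v \<in> ?U. (?E v)\<^sup>2 / 2 ^ n = x}" for x
    unfolding pauli_spectrum_def count_image_mset
    by (simp add: vimage_def Int_def conj_commute)
  have EV: "(?E v)\<^sup>2 = 1" if "v \<in> V" for v using that sub(1) sq by auto
  have EW: "(?E v)\<^sup>2 = 1 / 2" if "v \<in> W" for v
  proof -
    have "length v = 2 * n" "v \<notin> V" using that sub(2) disj by auto
    with that show ?thesis by (simp add: sq)
  qed
  have V: "{v \<in> ?U. (?E v)\<^sup>2 / 2 ^ n = 1 / 2 ^ n} = V"
    using sub(1) EV by (auto simp: sq split: if_splits)
  have W: "{v \<in> ?U. (?E v)\<^sup>2 / 2 ^ n = 1 / 2 ^ Suc n} = W"
  proof
    show "{v \<in> ?U. (?E v)\<^sup>2 / 2 ^ n = 1 / 2 ^ Suc n} \<subseteq> W"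
      by (auto simp: sq split: if_splits)
    show "W \<subseteq> {v \<in> ?U. (?E v)\<^sup>2 / 2 ^ n = 1 / 2 ^ Suc n}"
    proof
      fix v assume v: "v \<in> W"
      show "v \<in> {v \<in> ?U. (?E v)\<^sup>2 / 2 ^ n = 1 / 2 ^ Suc n}"
        unfolding mem_Collect_eq EW[OF v] using v sub(2) by auto
    qed
  qed
  have set: "set_mset (pauli_spectrum n \<rho>) - {0} = (\<lambda>v. (?E v)\<^sup>2 / 2 ^ n) ` (V \<union> W)"
  proof
    have mset: "set_mset (pauli_spectrum n \<rho>) = (\<lambda>v. (?E v)\<^sup>2 / 2 ^ n) ` ?U"
      by (simp add: pauli_spectrum_def)
    show "set_mset (pauli_spectrum n \<rho>) - {0} \<subseteq> (\<lambda>v. (?E v)\<^sup>2 / 2 ^ n) ` (V \<union> W)"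
    proof
      fix x assume "x \<in> set_mset (pauli_spectrum n \<rho>) - {0}"
      then obtain v where v: "length v = 2 * n" "x = (?E v)\<^sup>2 / 2 ^ n" "x \<noteq> 0" unfolding mset by blast
      then have "v \<in> V \<union> W" using sq[OF v(1)] by (auto split: if_splits)
      then show "x \<in> (\<lambda>v. (?E v)\<^sup>2 / 2 ^ n) ` (V \<union> W)" unfolding v(2) by (rule imageI)
    qed
    show "(\<lambda>v. (?E v)\<^sup>2 / 2 ^ n) ` (V \<union> W) \<subseteq> set_mset (pauli_spectrum n \<rho>) - {0}"
    proof
      fix x assume "x \<in> (\<lambda>v. (?E v)\<^sup>2 / 2 ^ n) ` (V \<union> W)"
      then obtain v where v: "v \<in> V \<or> v \<in> W" "x = (?E v)\<^sup>2 / 2 ^ n" by blast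
      then have "x \<noteq> 0" using EV[of v] EW[of v] by fastforce
      moreover have "v \<in> ?U" using v(1) sub by blast
      ultimately show "x \<in> set_mset (pauli_spectrum n \<rho>) - {0}" unfolding mset v(2) by blast
    qed
  qed
  also have "\<dots> = insert (1 / 2 ^ n) (if c = 0 then {} else {1 / 2 ^ Suc n})"
  proof -
    have "V \<noteq> {}" using card(1) by auto
    moreover have "W = {} \<longleftrightarrow> c = 0" using card(2) fin(2) by (metis card_0_eq mult_eq_0_iff power_eq_0_iff zero_neq_numeral)
    moreover have "(?E v)\<^sup>2 / 2 ^ n = 1 / 2 ^ n" if "v \<in> V" for v using that V by blast
    moreover have "(?E v)\<^sup>2 / 2 ^ n = 1 / 2 ^ Suc n" if "v \<in> W" for v using that W by blast
    ultimately show ?thesis by (auto simp: image_Un)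
  qed
  finally have set': "set_mset (pauli_spectrum n \<rho>) - {0} =
    insert (1 / 2 ^ n) (if c = 0 then {} else {1 / 2 ^ Suc n})" .
  have rat: "real_of_rat (1 / 2 ^ m) = 1 / 2 ^ m" for m by (simp add: of_rat_divide of_rat_power)
  show "represents_spectrum (spectrum_output n k c) (pauli_spectrum n \<rho>)"
    unfolding represents_spectrum_def set'
  proof (intro conjI)
    show "distinct (map fst (spectrum_output n k c))" by (simp add: spectrum_output_def)
    show "(\<lambda>(v, m). real_of_rat v) ` set (spectrum_output n k c) =
      insert (1 / 2 ^ n) (if c = 0 then {} else {1 / 2 ^ Suc n})"
      unfolding spectrum_output_def using rat[of n] rat[of "Suc n"] by auto
    show "\<forall>(v, m)\<in>set (spectrum_output n k c). m = count (pauli_spectrum n \<rho>) (real_of_rat v)"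
      unfolding spectrum_output_def
      using count[of "1 / 2 ^ n"] count[of "1 / 2 ^ Suc n"] rat[of n] rat[of "Suc n"] card V W by auto
  qed
  have sum: "(\<Sum>v\<in>?U. f v) = (\<Sum>v\<in>V. f v) + (\<Sum>v\<in>W. f v)"
    if "\<And>v. v \<in> ?U \<Longrightarrow> v \<notin> V \<Longrightarrow> v \<notin> W \<Longrightarrow> f v = 0" for f :: "bool list \<Rightarrow> real"
  proof -
    have "(\<Sum>v\<in>?U. f v) = (\<Sum>v\<in>V \<union> W. f v)"
      by (rule sum.mono_neutral_right) (use sub that in auto)
    then show ?thesis using sum.union_disjoint[OF fin disj, of f] by simp
  qed
  have p4: "(?E v) ^ 4 = ((?E v)\<^sup>2)\<^sup>2" for v by simp
  have E0: "(?E v)\<^sup>2 = 0" if "v \<in> ?U" "v \<notin> V" "v \<notin> W" for v using that sq by simp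
  have "(\<Sum>v\<in>?U. (?E v) ^ 4) = (\<Sum>v\<in>V. (?E v) ^ 4) + (\<Sum>v\<in>W. (?E v) ^ 4)"
  proof (rule sum)
    fix v assume "v \<in> ?U" "v \<notin> V" "v \<notin> W"
    then have "(?E v)\<^sup>2 = 0" by (rule E0)
    then show "(?E v) ^ 4 = 0" by simp
  qed
  also have "\<dots> = (\<Sum>v\<in>V. 1) + (\<Sum>v\<in>W. 1 / 4)"
  proof (intro arg_cong2[where f = "(+)"] sum.cong refl)
    fix v assume "v \<in> V"
    then show "(?E v) ^ 4 = 1" unfolding p4 by (simp only: EV) simp
  next
    fix v assume "v \<in> W"
    then show "(?E v) ^ 4 = 1 / 4" unfolding p4 by (simp only: EW) (simp add: power_divide)
  qed
  also have "\<dots> = 2 ^ k + of_nat c * 2 ^ k / 4" using card by simp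
  finally have s4: "(\<Sum>v\<in>?U. (?E v) ^ 4) = 2 ^ k + of_nat c * 2 ^ k / 4" .
  have "(\<Sum>v\<in>?U. (?E v)\<^sup>2) = (\<Sum>v\<in>V. (?E v)\<^sup>2) + (\<Sum>v\<in>W. (?E v)\<^sup>2)"
    by (rule sum) (rule E0)
  also have "\<dots> = (\<Sum>v\<in>V. 1) + (\<Sum>v\<in>W. 1 / 2)"
    by (intro arg_cong2[where f = "(+)"] sum.cong refl) (rule EV EW, assumption)+
  also have "\<dots> = 2 ^ k + of_nat c * 2 ^ k / 2" using card by simp
  finally have s2: "(\<Sum>v\<in>?U. (?E v)\<^sup>2) = 2 ^ k + of_nat c * 2 ^ k / 2" .
  \<comment> \<open>The common factor \<open>2 ^ k\<close> cancels, so the entropy depends on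
    \<open>c\<close> alone.\<close>
  have ratio: "(\<Sum>v\<in>?U. (?E v) ^ 4) / (\<Sum>v\<in>?U. (?E v)\<^sup>2) = (1 + of_nat c / 4) / (1 + of_nat c / 2)"
  proof -
    have "2 ^ k + of_nat c * 2 ^ k / 4 = 2 ^ k * (1 + of_nat c / 4 :: real)"
      "2 ^ k + of_nat c * 2 ^ k / 2 = 2 ^ k * (1 + of_nat c / 2 :: real)" by (simp_all add: algebra_simps)
    then show ?thesis unfolding s4 s2 by simp
  qed
  consider "c = 0" | "c = 1" | "c = 2" using c by linarith
  then have "real_of_rat (if c = 0 then 1 else if c = 1 then 5 / 6 else 3 / 4) =
      (1 + of_nat c / 4) / (1 + of_nat c / 2)"
    by cases (simp_all add: of_rat_divide)
  then show "represents_entropy (if c = 0 then 1 else if c = 1 then 5 / 6 else 3 / 4) (stabilizer_entropy n \<rho>)"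
    unfolding represents_entropy_def stabilizer_entropy_def ratio by simp
qed

text \<open>\<open>N1\<close> and \<open>N2\<close> are constrained only when their sets are
  nonempty, so all four cases of surviving cosets are covered by one statement.\<close>

lemma robustness_magic_sum:
  assumes H: "stabilizer_group n H"
    and S1: "S1 = {} \<or> logical_coset n H S1 N1" and S2: "S2 = {} \<or> logical_coset n H S2 N2"
    and anti: "S1 \<noteq> {} \<Longrightarrow> S2 \<noteq> {} \<Longrightarrow> N1 * N2 \<noteq> N2 * N1"
  shows "robustness n (magic_sum n H S1 S2) = (if S1 = {} \<or> S2 = {} then 1 else sqrt 2)"
proof -
  have t: "\<bar>1 / sqrt 2\<bar> \<le> (1 :: real)" "\<bar>- (1 / sqrt 2)\<bar> \<le> (1 :: real)" by simp_all
  consider "S1 = {}" "S2 = {}" | "S1 \<noteq> {}" "S2 = {}" | "S1 = {}" "S2 \<noteq> {}" | "S1 \<noteq> {}" "S2 \<noteq> {}" by blast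
  then show ?thesis
  proof cases
    case 1
    have "magic_sum n H {} {} = stab_state n H"
      by (intro eq_matI) (simp_all add: stab_state_def magic_sum_def)
    then show ?thesis using 1 robustness_one[OF decomposable_stab_state[OF H]] by simp
  next
    case 2
    then have c: "N1 \<in> hermitian_paulis n" "N1 \<notin> H" "- N1 \<notin> H" "\<And>M. M \<in> H \<Longrightarrow> N1 * M = M * N1"
      "S1 = (*) N1 ` H" using S1 unfolding logical_coset_def by blast+
    have "decomposable n (magic_sum n H S1 S2) 1 1"
      by (rule decomposable_mixed[OF H c(1-4) t(1)]) (simp_all add: magic_sum_def 2(2) c(5))
    then show ?thesis using 2 robustness_one by simp
  next
    case 3
    then have c: "N2 \<in> hermitian_paulis n" "N2 \<notin> H" "- N2 \<notin> H" "\<And>M. M \<in> H \<Longrightarrow> N2 * M = M * N2"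
      "S2 = (*) N2 ` H" using S2 unfolding logical_coset_def by blast+
    have "decomposable n (magic_sum n H S1 S2) 1 1"
      by (rule decomposable_mixed[OF H c(1-4) t(2)]) (simp_all add: magic_sum_def 3(1) c(5))
    then show ?thesis using 3 robustness_one by simp
  next
    case 4
    then have L: "logical_coset n H S1 N1" "logical_coset n H S2 N2" using S1 S2 by auto
    have c: "N1 \<in> hermitian_paulis n" "N1 \<notin> H" "- N1 \<notin> H" "\<And>M. M \<in> H \<Longrightarrow> N1 * M = M * N1"
      "N2 \<in> hermitian_paulis n" "N2 \<notin> H" "- N2 \<notin> H" "\<And>M. M \<in> H \<Longrightarrow> N2 * M = M * N2"
      "S1 = (*) N1 ` H" "S2 = (*) N2 ` H"
      using L unfolding logical_coset_def by blast+
    note D1 = logical_cosetD[OF H L(1)] and D2 = logical_cosetD[OF H L(2)]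
    have no12: "N1 \<notin> S2 \<and> - N1 \<notin> S2"
      by (rule anticommuting_cosets[OF H L anti[OF 4] D1(5)])
    have no21: "N2 \<notin> S1 \<and> - N2 \<notin> S1"
      by (rule anticommuting_cosets[OF H L(2,1) anti[OF 4, symmetric] D2(5)])
    have e: "expectation (magic_sum n H S1 S2) N1 = 1 / sqrt 2"
      "expectation (magic_sum n H S1 S2) N2 = - (1 / sqrt 2)"
      using expectation_magic_sum[OF stabilizer_groupD(1)[OF H] D1(1) D2(1) c(1)]
        expectation_magic_sum[OF stabilizer_groupD(1)[OF H] D1(1) D2(1) c(5)]
        no12 no21 c(2,3,6,7) D1(2,5) D2(2,5)
      by (simp_all add: signed_indicator_def)
    show ?thesis
      using robustness_sqrt2[OF H c(1-8) anti[OF 4]] e 4 unfolding c(9,10) by simp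
  qed
qed

context qubit_subset
begin

text \<open>The logical operator itself may act outside the subset. Its product with the group
  element \<open>M\<close> is a supported representative of the same coset, and the image of this
  product represents the reduced coset.\<close>

lemma logical_reduction:
  assumes gs: "stabilizer_generators L gs" and p: "logical_operator L gs p"
    and M: "M \<in> stab_group L gs" and N: "reduces_to (pauli_op L p * M) N"
  shows "logical_coset n (reduction (stab_group L gs)) (reduction ((*) (pauli_op L p) ` stab_group L gs)) N"
proof -
  let ?G = "stab_group L gs" and ?p = "pauli_op L p"
  note G = stabilizer_generators_group[OF gs]
  note D = stabilizer_groupD[OF G]
  have ph: "?p \<in> hermitian_paulis L" and comm: "\<And>K. K \<in> ?G \<Longrightarrow> ?p * K = K * ?p"
    and notin: "?p \<notin> ?G" "- ?p \<notin> ?G"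
    using p pauli_op_hermitian unfolding logical_operator_def by blast+
  have L: "logical_coset L ?G ((*) ?p ` ?G) ?p"
    unfolding logical_coset_def using ph comm notin by blast
  note C = logical_cosetD[OF G L]
  have pc: "?p \<in> carrier_mat (2 ^ L) (2 ^ L)" using hermitian_pauli_carrier[OF ph] .
  let ?q = "?p * M"
  have q: "?q \<in> (*) ?p ` ?G" using M by blast
  have qh: "?q \<in> hermitian_paulis L" using C(1) q by blast
  have qcomm: "?q * K = K * ?q" if K: "K \<in> ?G" for K
  proof -
    have "?q * K = ?p * (K * M)" using assoc_mult_mat[OF pc D(7)[OF M] D(7)[OF K]] D(5)[OF M K] by simp
    also have "\<dots> = (?p * K) * M" using assoc_mult_mat[OF pc D(7)[OF K] D(7)[OF M]] by simp
    also have "\<dots> = K * ?q" using assoc_mult_mat[OF D(7)[OF K] pc D(7)[OF M]] comm[OF K] by simp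
    finally show ?thesis .
  qed
  have "(*) ?q ` ?G = (*) ?p ` ?G"
  proof -
    have "(*) ?q ` ?G = (*) ?p ` ((*) M ` ?G)"
      unfolding image_image
      by (rule image_cong[OF refl]) (rule assoc_mult_mat[OF pc D(7)[OF M] D(7)])
    then show ?thesis unfolding coset_self[OF G M] .
  qed
  then have red: "reduction ((*) ?p ` ?G) = (*) N ` reduction ?G"
    using reduction_coset[OF G N qcomm] by simp
  have "K \<noteq> ?q" "K \<noteq> - ?q" if "K \<in> ?G" for K using C(3)[OF q] that by blast+
  then have "N \<notin> reduction ?G" "- N \<notin> reduction ?G"
    using reduces_to_inject[OF _ N] reduces_to_inject[OF _ reduces_to_uminus[OF N]]
    unfolding reduction_def by blast+
  moreover have "N * K' = K' * N" if K': "K' \<in> reduction ?G" for K'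
  proof -
    obtain K where "K \<in> ?G" "reduces_to K K'" using K' unfolding reduction_def by blast
    then show ?thesis using reduces_to_commute[OF N] qcomm by blast
  qed
  ultimately show ?thesis
    unfolding logical_coset_def using reduces_to_hermitian(2)[OF N] red by blast
qed

text \<open>Factors from the stabilizer group commute with both logical operators, so they do not
  affect whether the two commute; reduction preserves this relation.\<close>

lemma reductions_anticommute:
  assumes gs: "stabilizer_generators L gs" and z: "logical_operator L gs zb" and y: "logical_operator L gs yb"
    and anti: "pauli_op L zb * pauli_op L yb = - (pauli_op L yb * pauli_op L zb)"
    and M: "M \<in> stab_group L gs" "reduces_to (pauli_op L zb * M) N1"
    and K: "K \<in> stab_group L gs" "reduces_to (pauli_op L yb * K) N2"
  shows "N1 * N2 \<noteq> N2 * N1"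
proof
  let ?G = "stab_group L gs" and ?Z = "pauli_op L zb" and ?Y = "pauli_op L yb"
  note G = stabilizer_generators_group[OF gs]
  have h: "?Z \<in> hermitian_paulis L" "?Y \<in> hermitian_paulis L"
    using z y pauli_op_hermitian unfolding logical_operator_def by blast+
  have L: "logical_coset L ?G ((*) ?Z ` ?G) ?Z" "logical_coset L ?G ((*) ?Y ` ?G) ?Y"
    using z y h unfolding logical_operator_def logical_coset_def by blast+
  have ne: "?Z * ?Y \<noteq> ?Y * ?Z"
  proof
    assume c: "?Z * ?Y = ?Y * ?Z"
    from hermitian_pauli_neq_uminus[OF hermitian_pauli_mult[OF h c]] c anti show False by simp
  qed
  assume "N1 * N2 = N2 * N1"
  then have c: "?Z * M * (?Y * K) = ?Y * K * (?Z * M)" using reduces_to_commute[OF M(2) K(2)] by simp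
  note D = stabilizer_groupD[OF G]
  note Zc = hermitian_pauli_carrier[OF h(1)] and Yc = hermitian_pauli_carrier[OF h(2)]
  note Mc = D(7)[OF M(1)] and Kc = D(7)[OF K(1)]
  have YM: "?Y * M = M * ?Y" and ZK: "?Z * K = K * ?Z"
    using L M(1) K(1) unfolding logical_coset_def by blast+
  have MK: "M * K = K * M" using D(5)[OF M(1) K(1)] .
  note A = assoc_mult_mat[of _ "2 ^ L" "2 ^ L" _ "2 ^ L" _ "2 ^ L"]
  have l: "?Z * M * (?Y * K) = (?Z * ?Y) * (M * K)"
  proof -
    have "?Z * M * (?Y * K) = ?Z * ((M * ?Y) * K)" using Zc Mc Yc Kc by (simp add: A)
    also have "\<dots> = ?Z * ((?Y * M) * K)" by (simp only: YM)
    also have "\<dots> = (?Z * ?Y) * (M * K)" using Zc Mc Yc Kc by (simp add: A)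
    finally show ?thesis .
  qed
  have r: "?Y * K * (?Z * M) = (?Y * ?Z) * (M * K)"
  proof -
    have "?Y * K * (?Z * M) = ?Y * ((K * ?Z) * M)" using Zc Mc Yc Kc by (simp add: A)
    also have "\<dots> = ?Y * ((?Z * K) * M)" by (simp only: ZK)
    also have "\<dots> = (?Y * ?Z) * (K * M)" using Zc Mc Yc Kc by (simp add: A)
    finally show ?thesis unfolding MK .
  qed
  have MKh: "M * K \<in> ?G" using D(4)[OF M(1) K(1)] .
  \<comment> \<open>\<open>M * K\<close> is an involution, so multiplying by it once more removes
    the common right factor.\<close>
  have cancel: "X * (M * K) * (M * K) = X" if "X \<in> carrier_mat (2 ^ L) (2 ^ L)" for X
    using that assoc_mult_mat[OF that D(7)[OF MKh] D(7)[OF MKh]]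
    unfolding hermitian_pauli_square[OF D(6)[OF MKh]] by simp
  have "(?Z * ?Y) * (M * K) * (M * K) = (?Y * ?Z) * (M * K) * (M * K)"
    using c unfolding l r by (simp only:)
  then show False using ne cancel Zc Yc by simp
qed

end

theorem mainTheorem4:
  shows "\<exists>(alg :: program) (T :: nat \<Rightarrow> nat).
    (\<lambda>L. real (T L)) \<in> O(\<lambda>L. real L ^ 3) \<and>
    (\<forall>(L :: nat) (gs :: pauli list) (zb :: pauli) (yb :: pauli) (A :: nat set).
      1 \<le> L \<and> length gs = L - 1 \<and> stabilizer_generators L gs \<and>
      logical_operator L gs zb \<and> logical_operator L gs yb \<and>
      pauli_op L zb * pauli_op L yb = - (pauli_op L yb * pauli_op L zb) \<and>
      A \<subseteq> {0..<L} \<longrightarrow>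
      (\<exists>t a b spec q.
        computes_in alg (encode_input L gs zb yb A) (encode_output a b spec q) t \<and>
        t \<le> T L \<and>
        (let n = card A; \<rho>\<^sub>A = reduced_state L A (code_magic_state L gs zb yb) in
          represents_robustness a b (robustness n \<rho>\<^sub>A) \<and>
          represents_spectrum spec (pauli_spectrum n \<rho>\<^sub>A) \<and>
          represents_entropy q (stabilizer_entropy n \<rho>\<^sub>A))))"
proof (intro exI[of _ algorithm] exI[of _ running_time] conjI allI impI)
  show "(\<lambda>L. real (running_time L)) \<in> O(\<lambda>L. real L ^ 3)" by (rule running_time_cubic)
  fix L :: nat and gs :: "pauli list" and zb yb :: pauli and A :: "nat set"
  assume "1 \<le> L \<and> length gs = L - 1 \<and> stabilizer_generators L gs \<and>
      logical_operator L gs zb \<and> logical_operator L gs yb \<and>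
      pauli_op L zb * pauli_op L yb = - (pauli_op L yb * pauli_op L zb) \<and>
      A \<subseteq> {0..<L}"
  then have L: "1 \<le> L" "length gs = L - 1" and gs: "stabilizer_generators L gs"
    and z: "logical_operator L gs zb" and y: "logical_operator L gs yb"
    and anti: "pauli_op L zb * pauli_op L yb = - (pauli_op L yb * pauli_op L zb)"
    and A: "A \<subseteq> {0..<L}" by blast+
  interpret qubit_subset L A by standard (rule A)
  let ?G = "stab_group L gs" and ?Z = "pauli_op L zb" and ?Y = "pauli_op L yb"
  let ?R = "map (\<lambda>g. masked kept (snd g))"
  let ?S0 = "reduction ?G" and ?S1 = "reduction ((*) ?Z ` ?G)" and ?S2 = "reduction ((*) ?Y ` ?G)"
  let ?cc = "combination_count (?R gs)"
  note G = stabilizer_generators_group[OF gs]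
  have H: "stabilizer_group n ?S0" by (rule reduction_stabilizer_group[OF G])
  have valid: "valid_pauli L zb" "valid_pauli L yb" "\<forall>g\<in>set gs. valid_pauli L g"
    using z y gs unfolding logical_operator_def stabilizer_generators_def by blast+
  have zcomm: "\<And>M. M \<in> ?G \<Longrightarrow> ?Z * M = M * ?Z" and ycomm: "\<And>M. M \<in> ?G \<Longrightarrow> ?Y * M = M * ?Y"
    using z y unfolding logical_operator_def by blast+
  have len: "\<forall>g\<in>set (gs @ [zb, yb]). length (snd g) = 2 * L"
    using valid by (auto simp: valid_pauli_def)
  have card0: "card ?S0 = ?cc (zeros (2 * L))" by (rule card_reduction_group[OF gs])
  have card1: "card ?S1 = ?cc (masked kept (snd zb))" by (rule card_reduction_coset[OF gs valid(1) zcomm])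
  have card2: "card ?S2 = ?cc (masked kept (snd yb))" by (rule card_reduction_coset[OF gs valid(2) ycomm])
  have rowlen: "\<forall>r\<in>set (?R gs). length r = 2 * L" "\<forall>r\<in>set (?R [zb, yb]). length r = 2 * L"
    using len by auto
  obtain k c where elim: "eliminate (2 * L) (tagged (?R gs) (?R [zb, yb])) =
      replicate k (True, []) @ replicate c (False, [])"
    and k: "?cc (zeros (2 * L)) = 2 ^ k"
    and c: "filter (\<lambda>x. 0 < x) (map ?cc (?R [zb, yb])) = replicate c (2 ^ k)"
    using eliminate_tagged[OF rowlen] by blast
  \<comment> \<open>This links the output of the elimination to the state: \<open>c\<close> is the
    number of nonempty reduced cosets, and each of them has \<open>2 ^ k\<close> elements.\<close>
  have filt: "filter (\<lambda>x. 0 < x) [card ?S1, card ?S2] = replicate c (2 ^ k)"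
    using c by (simp add: card1 card2)
  have c2: "c \<le> 2"
    using arg_cong[OF filt, of length] by (simp split: if_splits)
  \<comment> \<open>The reduced group lives on \<open>n\<close> qubits, which bounds its order by
    \<open>2 ^ n\<close>.\<close>
  have kL: "k \<le> L"
  proof -
    have "2 ^ k \<le> (2 :: nat) ^ n" using stabilizer_group_card_le[OF H] card0 k by simp
    then have "k \<le> n" by simp
    then show ?thesis using n_le_L by simp
  qed
  have sub: "?G \<subseteq> hermitian_paulis L" "(*) ?Z ` ?G \<subseteq> hermitian_paulis L" "(*) ?Y ` ?G \<subseteq> hermitian_paulis L"
    using stabilizer_groupD(1,6)[OF G] hermitian_pauli_mult[OF pauli_op_hermitian[OF valid(1)] _ zcomm]
      hermitian_pauli_mult[OF pauli_op_hermitian[OF valid(2)] _ ycomm] by blast+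
  let ?\<rho> = "reduced_state L A (code_magic_state L gs zb yb)"
  have \<rho>: "?\<rho> = magic_sum n ?S0 ?S1 ?S2"
    unfolding code_magic_state_eq[OF gs valid(1,2)] by (rule reduced_magic_sum[OF sub])
  \<comment> \<open>A nonempty reduction supplies a group element whose product with the logical
    operator is supported on \<open>A\<close>; the image of this product serves as
    representative.\<close>
  have cos: "\<exists>N. S = {} \<or> (logical_coset n ?S0 S N \<and> (\<exists>M\<in>?G. reduces_to (pauli_op L p * M) N))"
    if p: "logical_operator L gs p" and S: "S = reduction ((*) (pauli_op L p) ` ?G)" for S p
  proof (cases "S = {}")
    case False
    then obtain M N where "M \<in> ?G" "reduces_to (pauli_op L p * M) N"
      unfolding S by (auto simp: reduction_def)
    with logical_reduction[OF gs p] S show ?thesis by blast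
  qed blast
  obtain N1 where N1: "?S1 = {} \<or> (logical_coset n ?S0 ?S1 N1 \<and> (\<exists>M\<in>?G. reduces_to (?Z * M) N1))"
    using cos[OF z refl] by blast
  obtain N2 where N2: "?S2 = {} \<or> (logical_coset n ?S0 ?S2 N2 \<and> (\<exists>M\<in>?G. reduces_to (?Y * M) N2))"
    using cos[OF y refl] by blast
  have anti': "N1 * N2 \<noteq> N2 * N1" if "?S1 \<noteq> {}" "?S2 \<noteq> {}"
    using that N1 N2 reductions_anticommute[OF gs z y anti] by blast
  have fin: "finite ?S1" "finite ?S2"
    using N1 N2 stabilizer_groupD(8)[OF H] unfolding logical_coset_def by auto
  have empty: "?S1 = {} \<longleftrightarrow> card ?S1 = 0" "?S2 = {} \<longleftrightarrow> card ?S2 = 0" using fin by simp_all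
  have R: "robustness n ?\<rho> = (if ?S1 = {} \<or> ?S2 = {} then 1 else sqrt 2)"
    unfolding \<rho> by (rule robustness_magic_sum[OF H _ _ anti']) (use N1 N2 in blast)+
  \<comment> \<open>Comparing lengths in \<open>filt\<close> identifies the number of nonempty
    cosets with \<open>c\<close>.\<close>
  have both: "(?S1 = {} \<or> ?S2 = {}) \<longleftrightarrow> c \<noteq> 2"
    using arg_cong[OF filt, of length] unfolding empty by (auto split: if_splits)
  have rob: "represents_robustness (if c = 2 then 0 else 1) (if c = 2 then 1 else 0) (robustness n ?\<rho>)"
    unfolding R both represents_robustness_def by simp
  have facts: "S \<subseteq> hermitian_paulis n \<and> (\<forall>M\<in>S. - M \<notin> S) \<and> (\<forall>M\<in>S. M \<notin> ?S0 \<and> - M \<notin> ?S0)"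
    if "S = {} \<or> logical_coset n ?S0 S N" for S N
    using that logical_cosetD(1-3)[OF H, of S N] by blast
  have f1: "?S1 \<subseteq> hermitian_paulis n" "\<And>M. M \<in> ?S1 \<Longrightarrow> - M \<notin> ?S1" "\<And>M. M \<in> ?S1 \<Longrightarrow> M \<notin> ?S0 \<and> - M \<notin> ?S0"
    using facts[of ?S1 N1] N1 by blast+
  have f2: "?S2 \<subseteq> hermitian_paulis n" "\<And>M. M \<in> ?S2 \<Longrightarrow> - M \<notin> ?S2" "\<And>M. M \<in> ?S2 \<Longrightarrow> M \<notin> ?S0 \<and> - M \<notin> ?S0"
    using facts[of ?S2 N2] N2 by blast+
  have f12: "M \<notin> ?S2 \<and> - M \<notin> ?S2" if "M \<in> ?S1" for M
  proof (cases "?S2 = {}")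
    case False
    with that N1 N2 anti' anticommuting_cosets[OF H, of ?S1 N1 ?S2 N2] show ?thesis by blast
  qed simp
  let ?V = "pauli_vectors n"
  have disj: "?V ?S0 \<inter> ?V ?S1 = {}" "?V ?S0 \<inter> ?V ?S2 = {}" "?V ?S1 \<inter> ?V ?S2 = {}"
    using pauli_vectors_disjoint[of ?S1 ?S0 n, OF f1(3)] pauli_vectors_disjoint[of ?S2 ?S0 n, OF f2(3)]
      pauli_vectors_disjoint[of ?S1 ?S2 n, OF f12] by blast+
  have sq: "(pauli_expectation n ?\<rho> v)\<^sup>2 = (if v \<in> ?V ?S0 then 1 else if v \<in> ?V ?S1 \<union> ?V ?S2 then 1 / 2 else 0)"
    if "length v = 2 * n" for v
    unfolding \<rho> by (rule pauli_expectation_square[OF stabilizer_groupD(1)[OF H] f1(1) f2(1)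
        stabilizer_group_uminus[OF H] f1(2) f2(2) disj that])
  have cV: "card (?V ?S0) = 2 ^ k"
    using card_pauli_vectors[OF stabilizer_groupD(1)[OF H] stabilizer_group_uminus[OF H]] card0 k by simp
  have "card (?V ?S1 \<union> ?V ?S2) = card ?S1 + card ?S2"
    using card_Un_disjoint[OF finite_pauli_vectors finite_pauli_vectors disj(3)]
      card_pauli_vectors[OF f1(1,2)] card_pauli_vectors[OF f2(1,2)] by simp
  \<comment> \<open>Dropping the empty cosets does not change the sum of the sizes, so
    \<open>filt\<close> evaluates it.\<close>
  also have "\<dots> = sum_list (filter (\<lambda>x. 0 < x) [card ?S1, card ?S2])" by simp
  also have "\<dots> = c * 2 ^ k" unfolding filt by (simp add: sum_list_replicate)
  finally have cW: "card (?V ?S1 \<union> ?V ?S2) = c * 2 ^ k" .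
  have Vsub: "?V S \<subseteq> {v. length v = 2 * n}" for S by (auto simp: pauli_vectors_def)
  have "?V ?S0 \<inter> (?V ?S1 \<union> ?V ?S2) = {}" using disj by blast
  note spec = spectrum_and_entropy[OF Vsub Un_least[OF Vsub Vsub] this sq cV cW c2]
  obtain t where t: "computes_in algorithm (encode_input L gs zb yb A) (output_bits n k c) t" "t \<le> running_time L"
    using algorithm_computes[OF L A len elim[unfolded kept_def] kL c2] by blast
  show "\<exists>t a b spec q.
        computes_in algorithm (encode_input L gs zb yb A) (encode_output a b spec q) t \<and>
        t \<le> running_time L \<and>
        (let n = card A; \<rho>\<^sub>A = reduced_state L A (code_magic_state L gs zb yb) in
          represents_robustness a b (robustness n \<rho>\<^sub>A) \<and>
          represents_spectrum spec (pauli_spectrum n \<rho>\<^sub>A) \<and>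
          represents_entropy q (stabilizer_entropy n \<rho>\<^sub>A))"
    unfolding Let_def
    using t rob spec unfolding output_bits_def by blast
qed

end
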